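(* Let $n\ge 3$ and let $E=V\oplus W$ be a contact path geometry on a contact manifold $(M,H)$ of dimension $2n-1$. The skew complement of $W$ in $E^{\perp}$ with respect to the symplectic structure determined on $E^{\perp}$ by the choice of a filtered frame in $\mathrm{Ann}(E^{\perp})$ does not depend on the symplectic structure (i.e. filtered frame) chosen. This skew complement equals $\partial(U,W)$ if and only if the contact torsion vanishes, $\Pi=0$.
   Context: $(M,H)$ is a contact manifold of dimension $2n-1$, $n\ge 3$; each $H_x$ carries the conformal symplectic structure given by restricting $d\theta$ for local contact one-forms $\theta$. $\pi:\mathbb{P}(H)\to M$ is the projectivization; a point $L\in\mathbb{P}(H)$ is a line $L\subset H_{\pi(L)}$, and $L^{\perp}\subset H_{\pi(L)}$ is its skew complement. Define subbundles of $T\mathbb{P}(H)$ by $V=\ker\pi_*$, $E_L=\{v:\pi_*(v)\in L\}$, $E^{\perp}_L=\{v:\pi_*(v)\in L^{\perp}\}$, $\mathcal{H}_L=\{v:\pi_*(v)\in H_{\pi(L)}\}$, and $U\subset V$ by $U_L=\mathrm{Hom}(L,L^{\perp}/L)\subset \mathrm{Hom}(L,H_{\pi(L)}/L)\simeq T_L(\mathbb{P}(H_{\pi(L)}))=V_L$. A contact path geometry is a line subbundle $W\subset E$ with $E=V\oplus W$ (it may be given only on an open subset of $\mathbb{P}(H)$; then $\mathbb{P}(H)$ is to be replaced by that open subset throughout). $\partial(U,W)$ is the subbundle of $T\mathbb{P}(H)$ (in fact of $E^\perp$) spanned by sections of $U$, sections of $W$, and brackets $[A,X]$, $A\in\Gamma(U)$,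 $X\in\Gamma(W)$. The contact torsion $\Pi\in\Gamma((\mathcal{H}/E^{\perp})\otimes S^2(W^* )\otimes U^* )$ is $\Pi(X,X',A)=[X,[X',A]]\bmod E^{\perp}$ for sections $X,X'$ of $W$ and $A$ of $U$. $\mathrm{Ann}(E^\perp)\subset T^*\mathbb{P}(H)$ has rank $2$. A filtered frame in $\mathrm{Ann}(E^\perp)$ is a (local) pair of linearly independent sections $\phi^{-2,-2},\phi^{-1,-2}$ of $\mathrm{Ann}(E^\perp)$ such that $\phi^{-2,-2}$ spans $\mathrm{Ann}(\mathcal{H})$. The symplectic structure it determines on $E^\perp$ is the restriction to $E^\perp$ of $d\phi^{-2,-2}+d\phi^{-1,-2}$, which is nondegenerate on $E^\perp$. *)

theory Defs
  imports "HOL-Analysis.Analysis" "HOL-Library.Function_Algebras"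
begin

section \<open>Pointwise vector space structure on functions\<close>

instantiation "fun" :: (type, real_vector) real_vector
begin

definition scaleR_fun :: "real \<Rightarrow> ('a \<Rightarrow> 'b) \<Rightarrow> 'a \<Rightarrow> 'b"
  where "scaleR_fun c f = (\<lambda>x. c *\<^sub>R f x)"

instance
  by standard (simp_all add: scaleR_fun_def fun_eq_iff scaleR_add_right scaleR_add_left)

end


section \<open>Smooth manifolds\<close>

text \<open>\<open>Ck_on\<close> and \<open>smooth_on\<close> are only meant for open sets \<open>S\<close>.\<close>

primrec Ck_on :: "nat \<Rightarrow> 'a::euclidean_space set \<Rightarrow> ('a \<Rightarrow> 'b::real_normed_vector) \<Rightarrow> bool" where
  "Ck_on 0 S f \<longleftrightarrow> continuous_on S f"
| "Ck_on (Suc k) S f \<longleftrightarrow>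
     (\<forall>x\<in>S. f differentiable (at x)) \<and> (\<forall>v. Ck_on k S (\<lambda>x. frechet_derivative f (at x) v))"

definition smooth_on :: "'a::euclidean_space set \<Rightarrow> ('a \<Rightarrow> 'b::real_normed_vector) \<Rightarrow> bool"
  where "smooth_on S f \<longleftrightarrow> (\<forall>k. Ck_on k S f)"

text \<open>An atlas is a set of charts, each given by its domain and its coordinate map. It determines
  the underlying set, the topology and the smooth structure of the manifold; values of a coordinate
  map outside the chart domain are irrelevant.\<close>

type_synonym ('p, 'e) atlas = "('p set \<times> ('p \<Rightarrow> 'e)) set"

definition points :: "('p, 'e) atlas \<Rightarrow> 'p set"
  where "points A = \<Union> (fst ` A)"

definition smooth_atlas :: "('p, 'e::euclidean_space) atlas \<Rightarrow> bool" where
  "smooth_atlas A \<longleftrightarrow>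
     (\<forall>(D, \<phi>)\<in>A. inj_on \<phi> D \<and> open (\<phi> ` D)) \<and>
     (\<forall>(D, \<phi>)\<in>A. \<forall>(D', \<psi>)\<in>A.
        open (\<phi> ` (D \<inter> D')) \<and> smooth_on (\<phi> ` (D \<inter> D')) (\<psi> \<circ> the_inv_into D \<phi>))"

definition mopen :: "('p, 'e::euclidean_space) atlas \<Rightarrow> 'p set \<Rightarrow> bool"
  where "mopen A N \<longleftrightarrow> N \<subseteq> points A \<and> (\<forall>(D, \<phi>)\<in>A. open (\<phi> ` (N \<inter> D)))"

lemma istopology_mopen:
  assumes "smooth_atlas A"
  shows "istopology (mopen A)"
  unfolding istopology_def
proof (intro conjI allI impI)
  fix S T assume ST: "mopen A S" "mopen A T"
  have "open (\<phi> ` (S \<inter> T \<inter> D))" if D: "(D, \<phi>) \<in> A" for D \<phi>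
  proof -
    have "inj_on \<phi> D" using assms D by (auto simp: smooth_atlas_def)
    then have "\<phi> ` ((S \<inter> D) \<inter> (T \<inter> D)) = \<phi> ` (S \<inter> D) \<inter> \<phi> ` (T \<inter> D)"
      by (intro inj_on_image_Int) auto
    moreover have "open (\<phi> ` (S \<inter> D) \<inter> \<phi> ` (T \<inter> D))"
      using ST D by (auto simp: mopen_def)
    moreover have "S \<inter> T \<inter> D = (S \<inter> D) \<inter> (T \<inter> D)" by auto
    ultimately show ?thesis by simp
  qed
  then show "mopen A (S \<inter> T)" using ST by (auto simp: mopen_def)
next
  fix \<K> assume K: "\<forall>S\<in>\<K>. mopen A S"
  have "open (\<phi> ` (\<Union>\<K> \<inter> D))" if D: "(D, \<phi>) \<in> A" for D \<phi>
  proof -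
    have "\<phi> ` (\<Union>\<K> \<inter> D) = (\<Union>S\<in>\<K>. \<phi> ` (S \<inter> D))" by auto
    moreover have "open (\<phi> ` (S \<inter> D))" if "S \<in> \<K>" for S
      using K D that by (auto simp: mopen_def)
    ultimately show ?thesis by (simp add: open_UN)
  qed
  moreover have "\<Union>\<K> \<subseteq> points A" using K by (auto simp: mopen_def)
  ultimately show "mopen A (\<Union>\<K>)" by (auto simp: mopen_def)
qed

definition mtopology :: "('p, 'e::euclidean_space) atlas \<Rightarrow> 'p topology"
  where "mtopology A = topology (mopen A)"

text \<open>The dimension of the manifold is \<open>DIM('e)\<close>.\<close>

definition smooth_manifold :: "('p, 'e::euclidean_space) atlas \<Rightarrow> bool" where
  "smooth_manifold A \<longleftrightarrow>
     smooth_atlas A \<and> Hausdorff_space (mtopology A) \<and> second_countable (mtopology A)"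

definition smooth_fun :: "('p, 'e::euclidean_space) atlas \<Rightarrow> 'p set \<Rightarrow> ('p \<Rightarrow> real) \<Rightarrow> bool" where
  "smooth_fun A N f \<longleftrightarrow> (\<forall>(D, \<phi>)\<in>A. smooth_on (\<phi> ` (N \<inter> D)) (f \<circ> the_inv_into D \<phi>))"

definition smooth_at :: "('p, 'e::euclidean_space) atlas \<Rightarrow> 'p \<Rightarrow> ('p \<Rightarrow> real) \<Rightarrow> bool" where
  "smooth_at A x f \<longleftrightarrow> (\<exists>N. mopen A N \<and> x \<in> N \<and> smooth_fun A N f)"


section \<open>Tangent vectors, vector fields, differential forms\<close>

text \<open>Tangent vectors at \<open>x\<close> are the derivations of the algebra of germs at \<open>x\<close> of smooth functions.
  A derivation is stored as a functional on all functions; its value on functions that are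
  not smooth near \<open>x\<close> is fixed to be \<open>0\<close>, so that equal derivations are equal as functionals.\<close>

type_synonym 'p tvec = "('p \<Rightarrow> real) \<Rightarrow> real"

definition tangent_space :: "('p, 'e::euclidean_space) atlas \<Rightarrow> 'p \<Rightarrow> 'p tvec set" where
  "tangent_space A x = {v.
     (\<forall>f g. smooth_at A x f \<and> smooth_at A x g \<longrightarrow>
        v (\<lambda>y. f y + g y) = v f + v g \<and> v (\<lambda>y. f y * g y) = f x * v g + g x * v f) \<and>
     (\<forall>c f. smooth_at A x f \<longrightarrow> v (\<lambda>y. c * f y) = c * v f) \<and>
     (\<forall>f g N. smooth_at A x f \<and> smooth_at A x g \<and> mopen A N \<and> x \<in> N \<and> (\<forall>y\<in>N. f y = g y) \<longrightarrow>
        v f = v g) \<and>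
     (\<forall>f. \<not> smooth_at A x f \<longrightarrow> v f = 0)}"

text \<open>\<open>pushforward A F x v\<close> is the image under the differential at \<open>x\<close> of a map \<open>F\<close> into the manifold
  with atlas \<open>A\<close>.\<close>

definition pushforward ::
    "('q, 'e::euclidean_space) atlas \<Rightarrow> ('p \<Rightarrow> 'q) \<Rightarrow> 'p \<Rightarrow> 'p tvec \<Rightarrow> 'q tvec" where
  "pushforward A F x v = (\<lambda>f. if smooth_at A (F x) f then v (f \<circ> F) else 0)"

type_synonym 'p vfield = "'p \<Rightarrow> 'p tvec"

definition smooth_vfield :: "('p, 'e::euclidean_space) atlas \<Rightarrow> 'p set \<Rightarrow> 'p vfield \<Rightarrow> bool" where
  "smooth_vfield A N X \<longleftrightarrow>
     (\<forall>x\<in>N. X x \<in> tangent_space A x) \<and>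
     (\<forall>N' f. mopen A N' \<and> N' \<subseteq> N \<and> smooth_fun A N' f \<longrightarrow> smooth_fun A N' (\<lambda>y. X y f))"

definition bracket :: "('p, 'e::euclidean_space) atlas \<Rightarrow> 'p vfield \<Rightarrow> 'p vfield \<Rightarrow> 'p vfield" where
  "bracket A X Y = (\<lambda>x f. if smooth_at A x f then X x (\<lambda>y. Y y f) - Y x (\<lambda>y. X y f) else 0)"

text \<open>Local sections over \<open>N\<close> of a subbundle \<open>B\<close> of the tangent bundle, given by its fibres.\<close>

definition is_section ::
    "('p, 'e::euclidean_space) atlas \<Rightarrow> 'p set \<Rightarrow> ('p \<Rightarrow> 'p tvec set) \<Rightarrow> 'p vfield \<Rightarrow> bool" where
  "is_section A N B X \<longleftrightarrow> smooth_vfield A N X \<and> (\<forall>x\<in>N. X x \<in> B x)"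

text \<open>Covectors are extended by \<open>0\<close> outside the tangent space.\<close>

definition cotangent_space :: "('p, 'e::euclidean_space) atlas \<Rightarrow> 'p \<Rightarrow> ('p tvec \<Rightarrow> real) set" where
  "cotangent_space A x = {\<alpha>.
     (\<forall>v\<in>tangent_space A x. \<forall>w\<in>tangent_space A x. \<alpha> (v + w) = \<alpha> v + \<alpha> w) \<and>
     (\<forall>c. \<forall>v\<in>tangent_space A x. \<alpha> (c *\<^sub>R v) = c * \<alpha> v) \<and>
     (\<forall>v. v \<notin> tangent_space A x \<longrightarrow> \<alpha> v = 0)}"

definition Ann ::
    "('p, 'e::euclidean_space) atlas \<Rightarrow> ('p \<Rightarrow> 'p tvec set) \<Rightarrow> 'p \<Rightarrow> ('p tvec \<Rightarrow> real) set" where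
  "Ann A B x = {\<alpha> \<in> cotangent_space A x. \<forall>v\<in>B x. \<alpha> v = 0}"

type_synonym 'p oneform = "'p \<Rightarrow> 'p tvec \<Rightarrow> real"

definition smooth_oneform :: "('p, 'e::euclidean_space) atlas \<Rightarrow> 'p set \<Rightarrow> 'p oneform \<Rightarrow> bool" where
  "smooth_oneform A N \<alpha> \<longleftrightarrow>
     (\<forall>x\<in>N. \<alpha> x \<in> cotangent_space A x) \<and>
     (\<forall>N' X. mopen A N' \<and> N' \<subseteq> N \<and> smooth_vfield A N' X \<longrightarrow> smooth_fun A N' (\<lambda>y. \<alpha> y (X y)))"

text \<open>The exterior derivative of a one-form at a point, by the invariant formula
  \<open>d\<alpha>(X, Y) = X(\<alpha>(Y)) - Y(\<alpha>(X)) - \<alpha>([X, Y])\<close>, evaluated on arbitrary local smooth extensions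
  \<open>X\<close>, \<open>Y\<close> of the two tangent vectors.\<close>

definition ext_d ::
    "('p, 'e::euclidean_space) atlas \<Rightarrow> 'p oneform \<Rightarrow> 'p \<Rightarrow> 'p tvec \<Rightarrow> 'p tvec \<Rightarrow> real" where
  "ext_d A \<alpha> x v w = (THE c. \<forall>N X Y.
     mopen A N \<and> x \<in> N \<and> smooth_vfield A N X \<and> smooth_vfield A N Y \<and> X x = v \<and> Y x = w \<longrightarrow>
       c = X x (\<lambda>y. \<alpha> y (Y y)) - Y x (\<lambda>y. \<alpha> y (X y)) - \<alpha> x (bracket A X Y x))"


section \<open>Contact structures\<close>

definition contact_form ::
    "('m, 'e::euclidean_space) atlas \<Rightarrow> ('m \<Rightarrow> 'm tvec set) \<Rightarrow> 'm set \<Rightarrow> 'm oneform \<Rightarrow> bool" where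
  "contact_form A H N \<theta> \<longleftrightarrow>
     mopen A N \<and> smooth_oneform A N \<theta> \<and>
     (\<forall>x\<in>N. \<theta> x \<noteq> 0 \<and> H x = {v \<in> tangent_space A x. \<theta> x v = 0} \<and>
        (\<forall>v\<in>H x. (\<forall>w\<in>H x. ext_d A \<theta> x v w = 0) \<longrightarrow> v = 0))"

definition contact_structure ::
    "('m, 'e::euclidean_space) atlas \<Rightarrow> ('m \<Rightarrow> 'm tvec set) \<Rightarrow> bool" where
  "contact_structure A H \<longleftrightarrow> (\<forall>x\<in>points A. \<exists>N \<theta>. x \<in> N \<and> contact_form A H N \<theta>)"

text \<open>The skew complement \<open>L\<^sup>\<bottom> \<subseteq> H\<^sub>x\<close>; local contact forms differ by a nonvanishing factor, so the
  condition is the same for each of them.\<close>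

definition skew_perp ::
    "('m, 'e::euclidean_space) atlas \<Rightarrow> ('m \<Rightarrow> 'm tvec set) \<Rightarrow> 'm \<Rightarrow> 'm tvec set \<Rightarrow> 'm tvec set" where
  "skew_perp A H x L = {v \<in> H x. \<forall>N \<theta>. contact_form A H N \<theta> \<and> x \<in> N \<longrightarrow>
     (\<forall>l\<in>L. ext_d A \<theta> x v l = 0)}"


section \<open>The projectivization of the contact distribution\<close>

type_synonym 'm line = "'m \<times> 'm tvec set"

definition proj_H ::
    "('m, 'e::euclidean_space) atlas \<Rightarrow> ('m \<Rightarrow> 'm tvec set) \<Rightarrow> 'm line set" where
  "proj_H A H = {(x, L). x \<in> points A \<and> subspace L \<and> dim L = 1 \<and> L \<subseteq> H x}"

text \<open>The charts of the projectivization are the affine charts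
  \<open>(x, span {h\<^sub>0(x) + h(x)(y)}) \<mapsto> (\<phi>(x), y)\<close>, where \<open>\<phi>\<close> is a chart of the base and \<open>(h\<^sub>0, h)\<close> is a
  smooth local frame of \<open>H\<close>, i.e. a trivialization \<open>(t, y) \<mapsto> t h\<^sub>0(x) + h(x)(y)\<close> of \<open>H\<close> with
  fibre \<open>\<real> \<times> 'f\<close>. Hence \<open>DIM('f)\<close> has to be the rank of \<open>H\<close> minus one.\<close>

definition proj_atlas ::
    "('m, 'e::euclidean_space) atlas \<Rightarrow> ('m \<Rightarrow> 'm tvec set) \<Rightarrow>
     ('m line, 'e \<times> 'f::euclidean_space) atlas" where
  "proj_atlas A H = {(D', \<psi>). \<exists>D \<phi> N h\<^sub>0 (h :: 'm \<Rightarrow> 'f \<Rightarrow> 'm tvec).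
     (D, \<phi>) \<in> A \<and> mopen A N \<and> N \<subseteq> D \<and>
     smooth_vfield A N h\<^sub>0 \<and> (\<forall>y. smooth_vfield A N (\<lambda>x. h x y)) \<and>
     (\<forall>x\<in>N. linear (h x) \<and> bij_betw (\<lambda>(t, y). t *\<^sub>R h\<^sub>0 x + h x y) UNIV (H x)) \<and>
     D' = {(x, L) \<in> proj_H A H. x \<in> N \<and> (\<exists>y. L = span {h\<^sub>0 x + h x y})} \<and>
     (\<forall>x\<in>N. \<forall>y. \<psi> (x, span {h\<^sub>0 x + h x y}) = (\<phi> x, y))}"

text \<open>In the following, \<open>A\<close> is the atlas of the contact manifold and \<open>Q\<close> that of the
  projectivization of \<open>H\<close>, whose projection to the base is \<open>fst\<close>. In order: the bundles
  \<open>V\<close>, \<open>E\<close>, \<open>E\<^sup>\<bottom>\<close> and the preimage of \<open>H\<close>.\<close>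

definition vert_bundle ::
    "('m, 'e::euclidean_space) atlas \<Rightarrow> ('m line, 'q::euclidean_space) atlas \<Rightarrow>
     'm line \<Rightarrow> 'm line tvec set" where
  "vert_bundle A Q p = {v \<in> tangent_space Q p. pushforward A fst p v = 0}"

definition E_bundle ::
    "('m, 'e::euclidean_space) atlas \<Rightarrow> ('m line, 'q::euclidean_space) atlas \<Rightarrow>
     'm line \<Rightarrow> 'm line tvec set" where
  "E_bundle A Q p = {v \<in> tangent_space Q p. pushforward A fst p v \<in> snd p}"

definition Eperp_bundle ::
    "('m, 'e::euclidean_space) atlas \<Rightarrow> ('m \<Rightarrow> 'm tvec set) \<Rightarrow>
     ('m line, 'q::euclidean_space) atlas \<Rightarrow> 'm line \<Rightarrow> 'm line tvec set" where
  "Eperp_bundle A H Q p =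
     {v \<in> tangent_space Q p. pushforward A fst p v \<in> skew_perp A H (fst p) (snd p)}"

definition H_bundle ::
    "('m, 'e::euclidean_space) atlas \<Rightarrow> ('m \<Rightarrow> 'm tvec set) \<Rightarrow>
     ('m line, 'q::euclidean_space) atlas \<Rightarrow> 'm line \<Rightarrow> 'm line tvec set" where
  "H_bundle A H Q p = {v \<in> tangent_space Q p. pushforward A fst p v \<in> H (fst p)}"

text \<open>The isomorphism \<open>Hom(L, H\<^sub>x/L) \<simeq> T\<^sub>L(\<bbbP>(H\<^sub>x)) = V\<^sub>L\<close> takes the class modulo \<open>L\<close> of a linear map
  \<open>a : L \<rightarrow> H\<^sub>x\<close> to the velocity at \<open>t = 0\<close> of the curve of lines \<open>L\<^sub>t = {l + t a(l) | l \<in> L}\<close>.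
  Elements of \<open>Hom(L, L\<^sup>\<bottom>/L)\<close> are the classes of the maps \<open>a : L \<rightarrow> L\<^sup>\<bottom>\<close>. Linear maps on \<open>L\<close> are
  represented by their extensions to the whole type.\<close>

definition hom_to_vert ::
    "('m line, 'q::euclidean_space) atlas \<Rightarrow> 'm line \<Rightarrow> ('m tvec \<Rightarrow> 'm tvec) \<Rightarrow> 'm line tvec" where
  "hom_to_vert Q p a = (\<lambda>f. if smooth_at Q p f
     then deriv (\<lambda>t::real. f (fst p, (\<lambda>l. l + t *\<^sub>R a l) ` snd p)) 0 else 0)"

definition U_bundle ::
    "('m, 'e::euclidean_space) atlas \<Rightarrow> ('m \<Rightarrow> 'm tvec set) \<Rightarrow>
     ('m line, 'q::euclidean_space) atlas \<Rightarrow> 'm line \<Rightarrow> 'm line tvec set" where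
  "U_bundle A H Q p =
     {hom_to_vert Q p a | a. linear a \<and> a ` snd p \<subseteq> skew_perp A H (fst p) (snd p)}"


section \<open>Contact path geometries\<close>

definition line_subbundle ::
    "('p, 'e::euclidean_space) atlas \<Rightarrow> 'p set \<Rightarrow> ('p \<Rightarrow> 'p tvec set) \<Rightarrow> bool" where
  "line_subbundle A S W \<longleftrightarrow> (\<forall>p\<in>S. \<exists>N X. mopen A N \<and> p \<in> N \<and> N \<subseteq> S \<and> smooth_vfield A N X \<and>
     (\<forall>q\<in>N. X q \<noteq> 0 \<and> W q = span {X q}))"

definition contact_path_geometry ::
    "('m, 'e::euclidean_space) atlas \<Rightarrow> ('m line, 'q::euclidean_space) atlas \<Rightarrow>
     'm line set \<Rightarrow> ('m line \<Rightarrow> 'm line tvec set) \<Rightarrow> bool" where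
  "contact_path_geometry A Q S W \<longleftrightarrow>
     mopen Q S \<and> line_subbundle Q S W \<and>
     (\<forall>p\<in>S. W p \<subseteq> E_bundle A Q p \<and>
        E_bundle A Q p = {v + w | v w. v \<in> vert_bundle A Q p \<and> w \<in> W p} \<and>
        vert_bundle A Q p \<inter> W p = {0})"

text \<open>\<open>\<partial>(U, W)\<close> over the open set \<open>S\<close>, through local sections.\<close>

definition del_bundle ::
    "('p, 'e::euclidean_space) atlas \<Rightarrow> 'p set \<Rightarrow> ('p \<Rightarrow> 'p tvec set) \<Rightarrow> ('p \<Rightarrow> 'p tvec set) \<Rightarrow>
     'p \<Rightarrow> 'p tvec set" where
  "del_bundle Q S U W p = span
     ({B p | B N. mopen Q N \<and> p \<in> N \<and> N \<subseteq> S \<and> is_section Q N U B} \<union>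
      {X p | X N. mopen Q N \<and> p \<in> N \<and> N \<subseteq> S \<and> is_section Q N W X} \<union>
      {bracket Q B X p | B X N. mopen Q N \<and> p \<in> N \<and> N \<subseteq> S \<and>
         is_section Q N U B \<and> is_section Q N W X})"

text \<open>The value of \<open>\<Pi>(X, X', B)\<close> at \<open>p\<close> is the class of \<open>[X, [X', B]]\<close> modulo \<open>E\<^sup>\<bottom>\<close>, as a coset.
  The zero class is \<open>E\<^sup>\<bottom>\<close> itself.\<close>

definition contact_torsion ::
    "('m, 'e::euclidean_space) atlas \<Rightarrow> ('m \<Rightarrow> 'm tvec set) \<Rightarrow>
     ('m line, 'q::euclidean_space) atlas \<Rightarrow>
     'm line vfield \<Rightarrow> 'm line vfield \<Rightarrow> 'm line vfield \<Rightarrow> 'm line \<Rightarrow> 'm line tvec set" where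
  "contact_torsion A H Q X X' B p =
     {bracket Q X (bracket Q X' B) p + e | e. e \<in> Eperp_bundle A H Q p}"

definition contact_torsion_vanishes ::
    "('m, 'e::euclidean_space) atlas \<Rightarrow> ('m \<Rightarrow> 'm tvec set) \<Rightarrow>
     ('m line, 'q::euclidean_space) atlas \<Rightarrow>
     'm line set \<Rightarrow> ('m line \<Rightarrow> 'm line tvec set) \<Rightarrow> bool" where
  "contact_torsion_vanishes A H Q S W \<longleftrightarrow>
     (\<forall>N X X' B. mopen Q N \<and> N \<subseteq> S \<and> is_section Q N W X \<and> is_section Q N W X' \<and>
        is_section Q N (U_bundle A H Q) B \<longrightarrow>
        (\<forall>p\<in>N. contact_torsion A H Q X X' B p = Eperp_bundle A H Q p))"

text \<open>\<open>\<phi>\<^sub>2\<close> and \<open>\<phi>\<^sub>1\<close> stand for \<open>\<phi>\<close> with superscripts \<open>-2,-2\<close> and \<open>-1,-2\<close>.\<close>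

definition filtered_frame ::
    "('m, 'e::euclidean_space) atlas \<Rightarrow> ('m \<Rightarrow> 'm tvec set) \<Rightarrow>
     ('m line, 'q::euclidean_space) atlas \<Rightarrow>
     'm line set \<Rightarrow> 'm line oneform \<Rightarrow> 'm line oneform \<Rightarrow> bool" where
  "filtered_frame A H Q N \<phi>\<^sub>2 \<phi>\<^sub>1 \<longleftrightarrow>
     mopen Q N \<and> smooth_oneform Q N \<phi>\<^sub>2 \<and> smooth_oneform Q N \<phi>\<^sub>1 \<and>
     (\<forall>p\<in>N. \<phi>\<^sub>2 p \<in> Ann Q (Eperp_bundle A H Q) p \<and> \<phi>\<^sub>1 p \<in> Ann Q (Eperp_bundle A H Q) p \<and>
        \<phi>\<^sub>2 p \<noteq> \<phi>\<^sub>1 p \<and> independent {\<phi>\<^sub>2 p, \<phi>\<^sub>1 p} \<and>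
        span {\<phi>\<^sub>2 p} = Ann Q (H_bundle A H Q) p)"

definition frame_symplectic_form ::
    "('p, 'e::euclidean_space) atlas \<Rightarrow> 'p oneform \<Rightarrow> 'p oneform \<Rightarrow>
     'p \<Rightarrow> 'p tvec \<Rightarrow> 'p tvec \<Rightarrow> real" where
  "frame_symplectic_form Q \<phi>\<^sub>2 \<phi>\<^sub>1 p v w = ext_d Q \<phi>\<^sub>2 p v w + ext_d Q \<phi>\<^sub>1 p v w"

definition frame_skew_complement ::
    "('m, 'e::euclidean_space) atlas \<Rightarrow> ('m \<Rightarrow> 'm tvec set) \<Rightarrow>
     ('m line, 'q::euclidean_space) atlas \<Rightarrow> ('m line \<Rightarrow> 'm line tvec set) \<Rightarrow>
     'm line oneform \<Rightarrow> 'm line oneform \<Rightarrow> 'm line \<Rightarrow> 'm line tvec set" where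
  "frame_skew_complement A H Q W \<phi>\<^sub>2 \<phi>\<^sub>1 p =
     {v \<in> Eperp_bundle A H Q p. \<forall>w\<in>W p. frame_symplectic_form Q \<phi>\<^sub>2 \<phi>\<^sub>1 p v w = 0}"

end

theory Submission
  imports Defs
begin

text \<open>The proof rests on two explicit one-forms near a given point \<open>p\<close>. Choose a local contact form \<open>\<theta>\<close> on
  \<open>M\<close> and a local frame of \<open>H\<close>; the frame gives an affine chart of the projectivization and, at each point
  \<open>q\<close> of it, a vector \<open>\<ell>(q)\<close> spanning the line \<open>q\<close>. Write \<open>\<pi>\<close> for the projection and put
  \<open>\<theta>\<^sub>2 = \<pi>\<^sup>*\<theta>\<close> and \<open>\<theta>\<^sub>1 = d\<theta>(\<ell>, \<pi>\<^sub>* _)\<close>. Then \<open>\<H>\<close> is the kernel of \<open>\<theta>\<^sub>2\<close>, \<open>E\<^sup>\<bottom>\<close> is the common kernel of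
  \<open>\<theta>\<^sub>2\<close> and \<open>\<theta>\<^sub>1\<close>, and \<open>(\<theta>\<^sub>2, \<theta>\<^sub>1)\<close> is a filtered frame (\<open>filtered_frame_standard\<close>).

  Independence of the frame. A form \<open>\<alpha>\<close> that annihilates \<open>E\<^sup>\<bottom>\<close> satisfies \<open>d\<alpha>(Y, X) = - \<alpha>([Y, X])\<close> for
  sections \<open>Y\<close>, \<open>X\<close> of \<open>E\<^sup>\<bottom>\<close>. Hence, on \<open>E\<^sup>\<bottom>\<close>, the symplectic form of a filtered frame is at each point a
  combination of \<open>d\<theta>\<^sub>2\<close> and \<open>d\<theta>\<^sub>1\<close>, with a nonzero coefficient at \<open>d\<theta>\<^sub>1\<close>. If one argument lies in \<open>W\<close>, the
  term with \<open>d\<theta>\<^sub>2\<close> vanishes: it equals \<open>d\<theta>(\<pi>\<^sub>* v, \<pi>\<^sub>* w)\<close> with \<open>\<pi>\<^sub>* v\<close> in the skew complement of the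
  line and \<open>\<pi>\<^sub>* w\<close> in the line (\<open>ext_d_theta2_zero\<close>). So for every filtered frame the skew complement of \<open>W\<close> is
  \<open>C = {v \<in> E\<^sup>\<bottom> | d\<theta>\<^sub>1(v, W) = 0}\<close> (\<open>frame_symplectic_form_eq\<close>, \<open>frame_skew_complement_eq\<close>).

  Comparison with \<open>\<partial>(U, W)\<close>. Let \<open>X\<close> be a section of \<open>E\<close> with \<open>\<pi>\<^sub>* X = m \<ell>\<close>, and let \<open>\<partial>\<^sub>\<eta>\<close> be the vertical
  coordinate field belonging to \<open>\<eta>\<close>. The central formula is
  \<open>\<pi>\<^sub>* [\<partial>\<^sub>\<eta>, X] = \<partial>\<^sub>\<eta>(m) \<ell> + m h(\<eta>)\<close> (\<open>push_bracket_vertical\<close>). It gives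
  \<open>d\<theta>\<^sub>1(\<partial>\<^sub>\<eta>, X) = - m d\<theta>(\<ell>, h(\<eta>))\<close>, and since \<open>U\<close> consists of the \<open>\<partial>\<^sub>\<eta>\<close> with \<open>d\<theta>(\<ell>, h(\<eta>)) = 0\<close>
  (\<open>U_bundle_iff\<close>), the vertical vectors in \<open>C\<close> are exactly those of \<open>U\<close>, and brackets of sections \<open>B\<close> of \<open>U\<close>
  with sections of \<open>W\<close> lie in \<open>E\<^sup>\<bottom>\<close>. Moreover \<open>U\<close> and \<open>W\<close> lie in \<open>C\<close>. Consequently \<open>[X, [X', B]]\<close> lies in \<open>E\<^sup>\<bottom>\<close> if and only if
  \<open>d\<theta>\<^sub>1([X', B], X) = 0\<close> (\<open>torsion_zero_iff\<close>). Thus \<open>\<Pi> = 0\<close> says precisely that all brackets \<open>[B, X]\<close> lie in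
  \<open>C\<close>, that is, that \<open>\<partial>(U, W) \<subseteq> C\<close>. In this case equality holds: \<open>\<pi>\<^sub>*\<close> maps \<open>\<partial>(U, W)\<close> onto the skew complement of
  the line by the central formula, so every element of \<open>C\<close> is the sum of an element of \<open>\<partial>(U, W)\<close> and a
  vertical element of \<open>C\<close>, and the latter belongs to \<open>U\<close> (\<open>complement_subset_del\<close>).

  The remaining parts supply the differential geometry in which these computations take place: tangent
  vectors as derivations are combinations of coordinate derivations, by Hadamard's lemma; the invariant formula
  for \<open>d\<alpha>\<close> depends only on the values of the fields at the point; and the affine charts of the projectivization
  form a smooth atlas, because the coefficients of a smooth field with respect to a smooth frame are
  smooth (\<open>frame_coefficients_smooth\<close>, \<open>smooth_atlas_proj_atlas\<close>).\<close>

section \<open>Smooth maps between Euclidean spaces\<close>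

lemma differentiable_cong_open:
  assumes "open S" "x \<in> S" "\<And>x. x \<in> S \<Longrightarrow> f x = g x" "f differentiable (at x)"
  shows "g differentiable (at x)"
proof -
  obtain f' where "(f has_derivative f') (at x)" using assms(4) by (auto simp: differentiable_def)
  then have "(g has_derivative f') (at x)"
    using assms has_derivative_transform_within_open by blast
  then show ?thesis by (auto simp: differentiable_def)
qed

lemma has_derivative_frechet_derivative:
  "f differentiable (at x) \<Longrightarrow> (f has_derivative frechet_derivative f (at x)) (at x)"
  using frechet_derivative_works by blast

lemma Ck_on_cong:
  assumes "open S" "\<And>x. x \<in> S \<Longrightarrow> f x = g x" "Ck_on k S f"
  shows "Ck_on k S g"
  using assms(2,3)
proof (induction k arbitrary: f g)
  case 0
  then show ?case by (auto cong: continuous_on_cong)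
next
  case (Suc k)
  have d: "f differentiable (at x)" if "x \<in> S" for x using Suc.prems that by auto
  have "g differentiable (at x)" if "x \<in> S" for x
    using differentiable_cong_open[OF assms(1) that Suc.prems(1) d[OF that]] by auto
  moreover have "Ck_on k S (\<lambda>x. frechet_derivative g (at x) v)" for v
  proof (rule Suc.IH)
    show "Ck_on k S (\<lambda>x. frechet_derivative f (at x) v)" using Suc.prems by auto
    show "frechet_derivative f (at x) v = frechet_derivative g (at x) v" if "x \<in> S" for x
      using frechet_derivative_transform_within_open[OF d[OF that] assms(1) that] Suc.prems(1) by simp
  qed
  ultimately show ?case by simp
qed

lemma Ck_on_local:
  assumes "\<And>x. x \<in> S \<Longrightarrow> \<exists>T. open T \<and> x \<in> T \<and> Ck_on k T f"
  shows "Ck_on k S f"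
  using assms
proof (induction k arbitrary: f)
  case 0
  have "isCont f x" if "x \<in> S" for x
    using 0[OF that] by (auto simp: continuous_on_eq_continuous_at)
  then show ?case by (simp add: continuous_at_imp_continuous_on)
next
  case (Suc k)
  have "Ck_on k S (\<lambda>x. frechet_derivative f (at x) v)" for v
    using Suc.prems by (intro Suc.IH) (metis Ck_on.simps(2))
  then show ?case using Suc.prems by (metis Ck_on.simps(2))
qed

lemma Ck_on_subset: "Ck_on k T f \<Longrightarrow> S \<subseteq> T \<Longrightarrow> Ck_on k S f"
  by (induction k arbitrary: f) (auto intro: continuous_on_subset)

lemma Ck_on_SucD: "Ck_on (Suc k) S f \<Longrightarrow> Ck_on k S f"
proof (induction k arbitrary: f)
  case 0
  then show ?case
    by (auto intro!: continuous_at_imp_continuous_on differentiable_imp_continuous_within)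
next
  case (Suc k)
  then show ?case by (metis Ck_on.simps(2))
qed

lemma Ck_on_const: "Ck_on k S (\<lambda>x. c)"
  by (induction k arbitrary: c) auto

lemma Ck_on_add:
  assumes "open S" "Ck_on k S f" "Ck_on k S g"
  shows "Ck_on k S (\<lambda>x. f x + g x)"
  using assms(2,3)
proof (induction k arbitrary: f g)
  case 0
  then show ?case by (auto intro: continuous_intros)
next
  case (Suc k)
  have "Ck_on k S (\<lambda>x. frechet_derivative (\<lambda>x. f x + g x) (at x) v)" for v
  proof (rule Ck_on_cong[OF assms(1)])
    show "Ck_on k S (\<lambda>x. frechet_derivative f (at x) v + frechet_derivative g (at x) v)"
      using Suc by (intro Suc.IH) auto
    fix x assume "x \<in> S"
    then have "(f has_derivative frechet_derivative f (at x)) (at x)"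
      "(g has_derivative frechet_derivative g (at x)) (at x)"
      using Suc.prems by (auto intro!: has_derivative_frechet_derivative)
    then have "((\<lambda>x. f x + g x) has_derivative
        (\<lambda>v. frechet_derivative f (at x) v + frechet_derivative g (at x) v)) (at x)"
      by (rule has_derivative_add)
    from frechet_derivative_at[OF this, symmetric]
    show "frechet_derivative f (at x) v + frechet_derivative g (at x) v
        = frechet_derivative (\<lambda>x. f x + g x) (at x) v" by simp
  qed
  then show ?case using Suc.prems by (auto intro: differentiable_add)
qed

lemma Ck_on_sum:
  assumes "open S" "\<And>i. i \<in> I \<Longrightarrow> Ck_on k S (f i)"
  shows "Ck_on k S (\<lambda>x. \<Sum>i\<in>I. f i x)"
  using assms(2) by (induction I rule: infinite_finite_induct) (auto simp: Ck_on_const Ck_on_add[OF assms(1)])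

lemma Ck_on_linear_compose:
  assumes "bounded_linear L" "open S" "Ck_on k S f"
  shows "Ck_on k S (\<lambda>x. L (f x))"
  using assms(3)
proof (induction k arbitrary: f)
  case 0
  then show ?case using assms(1) by (auto intro: bounded_linear.continuous_on)
next
  case (Suc k)
  have *: "((\<lambda>x. L (f x)) has_derivative (\<lambda>v. L (frechet_derivative f (at x) v))) (at x)" if "x \<in> S" for x
    using that Suc.prems frechet_derivative_works by (intro bounded_linear.has_derivative[OF assms(1)]) auto
  have "Ck_on k S (\<lambda>x. frechet_derivative (\<lambda>x. L (f x)) (at x) v)" for v
    using Suc by (intro Ck_on_cong[OF assms(2) _ Suc.IH[of "\<lambda>x. frechet_derivative f (at x) v"]])
      (auto simp: frechet_derivative_at[OF *, symmetric])
  then show ?case using * by (auto simp: differentiable_def)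
qed

lemma Ck_on_scaleR:
  assumes "open S" "Ck_on k S f" "Ck_on k S g"
  shows "Ck_on k S (\<lambda>x. f x *\<^sub>R g x)"
  using assms(2,3)
proof (induction k arbitrary: f g)
  case 0
  then show ?case by (auto intro: continuous_intros)
next
  case (Suc k)
  have *: "((\<lambda>x. f x *\<^sub>R g x) has_derivative
        (\<lambda>v. f x *\<^sub>R frechet_derivative g (at x) v + frechet_derivative f (at x) v *\<^sub>R g x)) (at x)"
    if "x \<in> S" for x
    using that Suc.prems by (intro has_derivative_scaleR has_derivative_frechet_derivative) auto
  have "Ck_on k S (\<lambda>x. frechet_derivative (\<lambda>x. f x *\<^sub>R g x) (at x) v)" for v
  proof (rule Ck_on_cong[OF assms(1)])
    show "Ck_on k S (\<lambda>x. f x *\<^sub>R frechet_derivative g (at x) v + frechet_derivative f (at x) v *\<^sub>R g x)"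
      using Suc.prems Ck_on_SucD[OF Suc.prems(1)] Ck_on_SucD[OF Suc.prems(2)]
      by (intro Ck_on_add Suc.IH assms(1)) auto
    fix x assume "x \<in> S"
    from frechet_derivative_at[OF *[OF this], symmetric]
    show "f x *\<^sub>R frechet_derivative g (at x) v + frechet_derivative f (at x) v *\<^sub>R g x
        = frechet_derivative (\<lambda>x. f x *\<^sub>R g x) (at x) v" by simp
  qed
  then show ?case using * by (auto simp: differentiable_def)
qed

lemma Ck_on_id: "Ck_on k S (\<lambda>x. x)"
proof (cases k)
  case (Suc j)
  then show ?thesis by (auto simp: Ck_on_const frechet_derivative_at[OF has_derivative_ident, symmetric])
qed auto

text \<open>By induction on the order: the chain rule expresses the derivative of \<open>\<lambda>x. g (f x)\<close> through the
  finitely many functions \<open>\<lambda>x. Dg(f x) b\<close> with \<open>b\<close> in the basis, and to each of these the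
  induction hypothesis applies with a derivative of \<open>g\<close> in place of \<open>g\<close>.\<close>

lemma Ck_on_compose:
  fixes f :: "'a::euclidean_space \<Rightarrow> 'b::euclidean_space" and g :: "'b \<Rightarrow> 'c::real_normed_vector"
  assumes "open S" "f ` S \<subseteq> T" "Ck_on k S f" "Ck_on k T g"
  shows "Ck_on k S (\<lambda>x. g (f x))"
  using assms(3,4)
proof (induction k arbitrary: g)
  case 0
  then show ?case using assms(2) by (auto intro: continuous_on_compose2)
next
  case (Suc k)
  have lin: "linear (frechet_derivative g (at (f x)))" if "x \<in> S" for x
    using that Suc.prems assms(2) by (intro linear_frechet_derivative) auto
  have *: "((\<lambda>x. g (f x)) has_derivative
      (\<lambda>v. frechet_derivative g (at (f x)) (frechet_derivative f (at x) v))) (at x)" if "x \<in> S" for x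
    by (rule has_derivative_compose[OF has_derivative_frechet_derivative has_derivative_frechet_derivative])
      (use that Suc.prems assms(2) in \<open>auto simp: image_subset_iff\<close>)
  have "Ck_on k S (\<lambda>x. frechet_derivative (\<lambda>x. g (f x)) (at x) v)" for v
  proof (rule Ck_on_cong[OF assms(1)])
    show "Ck_on k S (\<lambda>x. \<Sum>b\<in>Basis. (frechet_derivative f (at x) v \<bullet> b) *\<^sub>R frechet_derivative g (at (f x)) b)"
    proof (intro Ck_on_sum Ck_on_scaleR assms(1))
      fix b :: 'b assume "b \<in> Basis"
      show "Ck_on k S (\<lambda>x. frechet_derivative f (at x) v \<bullet> b)"
        using Suc.prems by (intro Ck_on_linear_compose[OF bounded_linear_inner_left assms(1)]) auto
      show "Ck_on k S (\<lambda>x. frechet_derivative g (at (f x)) b)"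
        using Suc.prems Ck_on_SucD[OF Suc.prems(1)] by (intro Suc.IH) auto
    qed
    fix x assume x: "x \<in> S"
    let ?w = "frechet_derivative f (at x) v"
    have "frechet_derivative g (at (f x)) ?w = frechet_derivative g (at (f x)) (\<Sum>b\<in>Basis. (?w \<bullet> b) *\<^sub>R b)"
      by (simp add: euclidean_representation)
    also have "\<dots> = (\<Sum>b\<in>Basis. (?w \<bullet> b) *\<^sub>R frechet_derivative g (at (f x)) b)"
      using lin[OF x] by (simp add: linear_sum linear_scale)
    finally show "(\<Sum>b\<in>Basis. (?w \<bullet> b) *\<^sub>R frechet_derivative g (at (f x)) b)
        = frechet_derivative (\<lambda>x. g (f x)) (at x) v"
      by (simp add: frechet_derivative_at[OF *[OF x], symmetric])
  qed
  then show ?case using * by (auto simp: differentiable_def)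
qed

lemma Ck_on_inverse_real: "Ck_on k (- {0}) (inverse :: real \<Rightarrow> real)"
proof (induction k)
  case 0
  then show ?case by (auto intro!: continuous_intros)
next
  case (Suc k)
  have *: "(inverse has_derivative (\<lambda>v. - (inverse x * v * inverse x))) (at x)" if "x \<noteq> 0" for x :: real
    using has_derivative_inverse'[OF that] .
  have op: "open (- {0::real})" by auto
  have "Ck_on k (- {0::real}) (\<lambda>x. frechet_derivative inverse (at x) v)" for v
  proof (rule Ck_on_cong[OF op])
    show "Ck_on k (- {0::real}) (\<lambda>x. (-v) *\<^sub>R (inverse x *\<^sub>R inverse x))"
      by (intro Ck_on_scaleR op Ck_on_const Suc.IH)
  qed (auto simp: frechet_derivative_at[OF *, symmetric])
  then show ?case using * by (auto simp: differentiable_def)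
qed

lemma smooth_on_cong: "open S \<Longrightarrow> (\<And>x. x \<in> S \<Longrightarrow> f x = g x) \<Longrightarrow> smooth_on S f \<Longrightarrow> smooth_on S g"
  using Ck_on_cong unfolding smooth_on_def by blast

lemma smooth_on_local:
  "(\<And>x. x \<in> S \<Longrightarrow> \<exists>T. open T \<and> x \<in> T \<and> smooth_on T f) \<Longrightarrow> smooth_on S f"
  unfolding smooth_on_def by (meson Ck_on_local)

lemma smooth_on_subset: "smooth_on T f \<Longrightarrow> S \<subseteq> T \<Longrightarrow> smooth_on S f"
  using Ck_on_subset unfolding smooth_on_def by blast

lemma smooth_on_const: "smooth_on S (\<lambda>x. c)"
  by (simp add: smooth_on_def Ck_on_const)

lemma smooth_on_id: "smooth_on S (\<lambda>x. x)"
  by (simp add: smooth_on_def Ck_on_id)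

lemma smooth_on_add: "open S \<Longrightarrow> smooth_on S f \<Longrightarrow> smooth_on S g \<Longrightarrow> smooth_on S (\<lambda>x. f x + g x)"
  by (simp add: smooth_on_def Ck_on_add)

lemma smooth_on_sum: "open S \<Longrightarrow> (\<And>i. i \<in> I \<Longrightarrow> smooth_on S (f i)) \<Longrightarrow> smooth_on S (\<lambda>x. \<Sum>i\<in>I. f i x)"
  by (simp add: smooth_on_def Ck_on_sum)

lemma smooth_on_scaleR: "open S \<Longrightarrow> smooth_on S f \<Longrightarrow> smooth_on S g \<Longrightarrow> smooth_on S (\<lambda>x. f x *\<^sub>R g x)"
  by (simp add: smooth_on_def Ck_on_scaleR)

lemma smooth_on_mult:
  fixes f g :: "'a::euclidean_space \<Rightarrow> real"
  shows "open S \<Longrightarrow> smooth_on S f \<Longrightarrow> smooth_on S g \<Longrightarrow> smooth_on S (\<lambda>x. f x * g x)"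
  using smooth_on_scaleR[of S f g] by simp

lemma smooth_on_linear_compose:
  "bounded_linear L \<Longrightarrow> open S \<Longrightarrow> smooth_on S f \<Longrightarrow> smooth_on S (\<lambda>x. L (f x))"
  by (simp add: smooth_on_def Ck_on_linear_compose)

lemma smooth_on_compose:
  fixes f :: "'a::euclidean_space \<Rightarrow> 'b::euclidean_space"
  shows "open S \<Longrightarrow> f ` S \<subseteq> T \<Longrightarrow> smooth_on S f \<Longrightarrow> smooth_on T g \<Longrightarrow> smooth_on S (\<lambda>x. g (f x))"
  unfolding smooth_on_def using Ck_on_compose by blast

lemma smooth_on_inverse:
  fixes f :: "'a::euclidean_space \<Rightarrow> real"
  assumes "open S" "smooth_on S f" "\<And>x. x \<in> S \<Longrightarrow> f x \<noteq> 0"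
  shows "smooth_on S (\<lambda>x. inverse (f x))"
  using assms by (intro smooth_on_compose[of S f "- {0}" inverse]) (auto simp: smooth_on_def Ck_on_inverse_real)

lemma smooth_on_componentwise:
  fixes f :: "'a::euclidean_space \<Rightarrow> 'b::euclidean_space"
  assumes "open S" "\<And>b. b \<in> Basis \<Longrightarrow> smooth_on S (\<lambda>x. f x \<bullet> b)"
  shows "smooth_on S f"
proof -
  have "smooth_on S (\<lambda>x. \<Sum>b\<in>Basis. (f x \<bullet> b) *\<^sub>R b)"
    using assms by (intro smooth_on_sum smooth_on_scaleR smooth_on_const)
  then show ?thesis by (simp add: euclidean_representation)
qed

lemma smooth_on_continuous: "smooth_on S f \<Longrightarrow> continuous_on S f"
  unfolding smooth_on_def by (metis Ck_on.simps(1))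

lemma smooth_on_differentiable: "smooth_on S f \<Longrightarrow> x \<in> S \<Longrightarrow> f differentiable (at x)"
  unfolding smooth_on_def by (metis Ck_on.simps(2))

lemma smooth_on_has_derivative:
  "smooth_on S f \<Longrightarrow> x \<in> S \<Longrightarrow> (f has_derivative frechet_derivative f (at x)) (at x)"
  using smooth_on_differentiable frechet_derivative_works by blast

lemma smooth_on_derivative: "smooth_on S f \<Longrightarrow> smooth_on S (\<lambda>x. frechet_derivative f (at x) v)"
  unfolding smooth_on_def by (metis Ck_on.simps(2))

section \<open>Hadamard's lemma\<close>

text \<open>Differentiation under the integral sign. The weight \<open>t ^ j\<close> is there for the sake of induction: by
  the chain rule a derivative of \<open>h (a + t (x - a))\<close> in \<open>x\<close> picks up one factor \<open>t\<close>, so the family of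
  these integrals is closed under differentiation.\<close>

lemma moment_integral_has_derivative:
  fixes h :: "'a::euclidean_space \<Rightarrow> real"
  assumes h: "smooth_on (ball a r) h" and x: "x \<in> ball a r"
  shows "((\<lambda>x. integral {0..1} (\<lambda>t. t ^ j * h (a + t *\<^sub>R (x - a)))) has_derivative
    (\<lambda>v. integral {0..1} (\<lambda>t. t ^ Suc j * frechet_derivative h (at (a + t *\<^sub>R (x - a))) v))) (at x)"
proof -
  let ?U = "ball a r"
  let ?p = "\<lambda>t x. a + t *\<^sub>R (x - a)"
  have pU: "?p t y \<in> ?U" if "y \<in> ?U" "t \<in> {0..1}" for t y
  proof -
    have "norm (t *\<^sub>R (y - a)) \<le> 1 * norm (y - a)"
      unfolding norm_scaleR using that by (intro mult_right_mono) auto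
    then show ?thesis using that by (auto simp: dist_norm norm_minus_commute)
  qed
  have bl: "bounded_linear (\<lambda>v. t ^ Suc j * frechet_derivative h (at (?p t y)) v)"
    if "y \<in> ?U" "t \<in> {0..1}" for t y
    using has_derivative_bounded_linear[OF smooth_on_has_derivative[OF h pU[OF that]]]
    by (rule bounded_linear_const_mult)
  define fx where "fx y t = Blinfun (\<lambda>v. t ^ Suc j * frechet_derivative h (at (?p t y)) v)" for y t
  have fx: "blinfun_apply (fx y t) = (\<lambda>v. t ^ Suc j * frechet_derivative h (at (?p t y)) v)"
    if "y \<in> ?U" "t \<in> {0..1}" for t y
    unfolding fx_def using bl[OF that] by (rule bounded_linear_Blinfun_apply)
  have cont: "continuous_on (?U \<times> {0..1}) (\<lambda>(y, t). fx y t)"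
  proof (rule continuous_on_blinfun_componentwise)
    fix i :: 'a assume "i \<in> Basis"
    have c: "continuous_on ?U (\<lambda>x. frechet_derivative h (at x) i)"
      using h by (intro smooth_on_continuous smooth_on_derivative)
    have "continuous_on (?U \<times> {0..1}) (\<lambda>z. frechet_derivative h (at (?p (snd z) (fst z))) i)"
      by (rule continuous_on_compose2[OF c]) (use pU in \<open>auto intro!: continuous_intros simp del: mem_ball\<close>)
    then have "continuous_on (?U \<times> {0..1}) (\<lambda>z. snd z ^ Suc j * frechet_derivative h (at (?p (snd z) (fst z))) i)"
      by (intro continuous_intros)
    then show "continuous_on (?U \<times> {0..1}) (\<lambda>z. blinfun_apply (case z of (y, t) \<Rightarrow> fx y t) i)"
      by (rule continuous_on_cong[THEN iffD1, rotated 2]) (use fx in \<open>auto simp del: mem_ball\<close>)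
  qed
  have "((\<lambda>x. integral (cbox 0 1) (\<lambda>t. t ^ j * h (?p t x))) has_derivative integral (cbox 0 1) (fx x)) (at x within ?U)"
  proof (rule leibniz_rule)
    fix y t assume yt: "y \<in> ?U" "t \<in> cbox (0::real) 1"
    have "((\<lambda>x. h (?p t x)) has_derivative (\<lambda>v. frechet_derivative h (at (?p t y)) (t *\<^sub>R v))) (at y)"
      by (rule has_derivative_compose[where f = "?p t" and g = h, OF _ smooth_on_has_derivative[OF h pU]])
        (use yt in \<open>auto intro!: derivative_eq_intros\<close>)
    moreover have "frechet_derivative h (at (?p t y)) (t *\<^sub>R v) = t * frechet_derivative h (at (?p t y)) v" for v
      using linear_scale[OF linear_frechet_derivative[OF smooth_on_differentiable[OF h pU]]] yt by auto
    ultimately have "((\<lambda>x. h (?p t x)) has_derivative (\<lambda>v. t * frechet_derivative h (at (?p t y)) v)) (at y)"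
      by simp
    from has_derivative_mult_right[OF this, of "t ^ j"]
    have "((\<lambda>x. t ^ j * h (?p t x)) has_derivative blinfun_apply (fx y t)) (at y)"
      using yt by (simp add: fx mult_ac)
    then show "((\<lambda>x. t ^ j * h (?p t x)) has_derivative blinfun_apply (fx y t)) (at y within ?U)"
      by (rule has_derivative_at_withinI)
  next
    fix y assume y: "y \<in> ?U"
    have "continuous_on (cbox 0 1) (\<lambda>t. h (?p t y))"
      by (rule continuous_on_compose2[OF smooth_on_continuous[OF h]])
        (use pU[OF y] in \<open>auto intro!: continuous_intros simp del: mem_ball\<close>)
    then show "(\<lambda>t. t ^ j * h (?p t y)) integrable_on cbox 0 1"
      by (intro integrable_continuous continuous_intros)
  qed (use cont x in \<open>auto simp del: mem_ball\<close>)
  moreover have "blinfun_apply (integral (cbox 0 1) (fx x)) =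
      (\<lambda>v. integral {0..1} (\<lambda>t. t ^ Suc j * frechet_derivative h (at (?p t x)) v))"
  proof
    fix v
    have "continuous_on (cbox 0 1) (\<lambda>t. case (x, t) of (y, t) \<Rightarrow> fx y t)"
      by (rule continuous_on_compose2[OF cont]) (use x in \<open>auto intro!: continuous_intros\<close>)
    then have "continuous_on (cbox 0 1) (fx x)" by simp
    then have "blinfun_apply (integral (cbox 0 1) (fx x)) v = integral (cbox 0 1) (\<lambda>t. blinfun_apply (fx x t) v)"
      by (intro blinfun_apply_integral integrable_continuous)
    also have "\<dots> = integral {0..1} (\<lambda>t. t ^ Suc j * frechet_derivative h (at (?p t x)) v)"
      unfolding box_real by (intro integral_cong) (simp add: fx[OF x])
    finally show "blinfun_apply (integral (cbox 0 1) (fx x)) v =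
      integral {0..1} (\<lambda>t. t ^ Suc j * frechet_derivative h (at (?p t x)) v)" .
  qed
  ultimately show ?thesis using x by (simp add: at_within_open[OF x])
qed

lemma smooth_on_moment_integral:
  fixes h :: "'a::euclidean_space \<Rightarrow> real"
  assumes "smooth_on (ball a r) h"
  shows "smooth_on (ball a r) (\<lambda>x. integral {0..1} (\<lambda>t. t ^ j * h (a + t *\<^sub>R (x - a))))"
proof -
  have "Ck_on k (ball a r) (\<lambda>x. integral {0..1} (\<lambda>t. t ^ j * h (a + t *\<^sub>R (x - a))))" for k
    using assms
  proof (induction k arbitrary: h j)
    case 0
    show ?case
      using has_derivative_continuous[OF moment_integral_has_derivative[OF 0]]
      by (auto intro: continuous_at_imp_continuous_on simp del: mem_ball)
  next
    case (Suc k)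
    note * = moment_integral_has_derivative[OF Suc.prems]
    have "Ck_on k (ball a r) (\<lambda>x. frechet_derivative (\<lambda>x. integral {0..1} (\<lambda>t. t ^ j * h (a + t *\<^sub>R (x - a)))) (at x) v)" for v
      by (rule Ck_on_cong[OF open_ball _ Suc.IH[OF smooth_on_derivative[OF Suc.prems], of "Suc j" v]])
        (simp only: frechet_derivative_at[OF *, symmetric])
    moreover have "(\<lambda>x. integral {0..1} (\<lambda>t. t ^ j * h (a + t *\<^sub>R (x - a)))) differentiable (at x)"
      if "x \<in> ball a r" for x
      using *[OF that] unfolding differentiable_def by blast
    ultimately show ?case by (simp only: Ck_on.simps) blast
  qed
  then show ?thesis by (simp add: smooth_on_def)
qed

text \<open>The fundamental theorem of calculus along the segment from \<open>a\<close> to \<open>x\<close>: the coefficient functions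
  are the means of the partial derivatives of \<open>f\<close> over that segment.\<close>

lemma Hadamard_lemma:
  fixes f :: "'a::euclidean_space \<Rightarrow> real"
  assumes f: "smooth_on (ball a r) f"
  obtains g where "\<And>b. b \<in> Basis \<Longrightarrow> smooth_on (ball a r) (g b)"
    "\<And>b. b \<in> Basis \<Longrightarrow> g b a = frechet_derivative f (at a) b"
    "\<And>x. x \<in> ball a r \<Longrightarrow> f x = f a + (\<Sum>b\<in>Basis. ((x - a) \<bullet> b) * g b x)"
proof
  define g where "g b x = integral {0..1} (\<lambda>t. t ^ 0 * frechet_derivative f (at (a + t *\<^sub>R (x - a))) b)" for b x
  show "smooth_on (ball a r) (g b)" for b
    unfolding g_def by (intro smooth_on_moment_integral smooth_on_derivative f)
  show "g b a = frechet_derivative f (at a) b" for b by (simp add: g_def)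
  fix x assume x: "x \<in> ball a r"
  let ?p = "\<lambda>t. a + t *\<^sub>R (x - a)"
  have pU: "?p t \<in> ball a r" if "t \<in> {0..1}" for t
  proof -
    have "norm (t *\<^sub>R (x - a)) \<le> 1 * norm (x - a)"
      unfolding norm_scaleR using that by (intro mult_right_mono) auto
    then show ?thesis using x by (auto simp: dist_norm norm_minus_commute)
  qed
  have lin: "linear (frechet_derivative f (at (?p t)))" if "t \<in> {0..1}" for t
    by (intro linear_frechet_derivative smooth_on_differentiable[OF f] pU that)
  have "((\<lambda>t. frechet_derivative f (at (?p t)) (x - a)) has_integral (f (?p 1) - f (?p 0))) {0..1}"
  proof (rule fundamental_theorem_of_calculus)
    fix t :: real assume t: "t \<in> {0..1}"
    have "((\<lambda>t. f (?p t)) has_derivative (\<lambda>s. frechet_derivative f (at (?p t)) (s *\<^sub>R (x - a)))) (at t)"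
      by (rule has_derivative_compose[where f = ?p and g = f, OF _ smooth_on_has_derivative[OF f pU[OF t]]])
        (auto intro!: derivative_eq_intros)
    then have "((\<lambda>t. f (?p t)) has_vector_derivative frechet_derivative f (at (?p t)) (x - a)) (at t)"
      using linear_scale[OF lin[OF t]] by (simp add: has_vector_derivative_def)
    then show "((\<lambda>t. f (?p t)) has_vector_derivative frechet_derivative f (at (?p t)) (x - a)) (at t within {0..1})"
      by (rule has_vector_derivative_at_within)
  qed simp
  then have "f x - f a = integral {0..1} (\<lambda>t. frechet_derivative f (at (?p t)) (x - a))"
    by (simp add: integral_unique)
  also have "\<dots> = integral {0..1} (\<lambda>t. \<Sum>b\<in>Basis. ((x - a) \<bullet> b) * frechet_derivative f (at (?p t)) b)"
  proof (rule integral_cong)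
    fix t :: real assume t: "t \<in> {0..1}"
    have "frechet_derivative f (at (?p t)) (x - a)
        = frechet_derivative f (at (?p t)) (\<Sum>b\<in>Basis. ((x - a) \<bullet> b) *\<^sub>R b)"
      by (simp add: euclidean_representation)
    then show "frechet_derivative f (at (?p t)) (x - a)
        = (\<Sum>b\<in>Basis. ((x - a) \<bullet> b) * frechet_derivative f (at (?p t)) b)"
      by (simp add: linear_sum[OF lin[OF t]] linear_scale[OF lin[OF t]])
  qed
  also have "\<dots> = (\<Sum>b\<in>Basis. integral {0..1} (\<lambda>t. ((x - a) \<bullet> b) * frechet_derivative f (at (?p t)) b))"
  proof (rule integral_sum)
    fix b :: 'a
    have "continuous_on {0..1} (\<lambda>t. frechet_derivative f (at (?p t)) b)"
      by (rule continuous_on_compose2[OF smooth_on_continuous[OF smooth_on_derivative[OF f]]])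
        (use pU in \<open>auto intro!: continuous_intros simp del: mem_ball\<close>)
    then show "(\<lambda>t. ((x - a) \<bullet> b) * frechet_derivative f (at (?p t)) b) integrable_on {0..1}"
      by (intro integrable_continuous_interval continuous_intros)
  qed simp
  finally show "f x = f a + (\<Sum>b\<in>Basis. ((x - a) \<bullet> b) * g b x)"
    by (simp add: g_def)
qed

section \<open>Smooth functions on a manifold\<close>

lemma sum_fun_apply: "(\<Sum>i\<in>I. F i) x = (\<Sum>i\<in>I. F i x)"
  by (induction I rule: infinite_finite_induct) auto

lemma scaleR_fun_apply: "(c *\<^sub>R f) x = c *\<^sub>R f x"
  by (simp add: scaleR_fun_def)

locale manifold_atlas =
  fixes A :: "('p, 'e::euclidean_space) atlas"
  assumes smooth_atlas: "smooth_atlas A"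
begin

lemma chart_inj: "(D, \<phi>) \<in> A \<Longrightarrow> inj_on \<phi> D"
  using smooth_atlas by (auto simp: smooth_atlas_def)

lemma chart_open: "(D, \<phi>) \<in> A \<Longrightarrow> open (\<phi> ` D)"
  using smooth_atlas by (auto simp: smooth_atlas_def)

lemma transition_open: "(D, \<phi>) \<in> A \<Longrightarrow> (D', \<psi>) \<in> A \<Longrightarrow> open (\<phi> ` (D \<inter> D'))"
  using smooth_atlas unfolding smooth_atlas_def by blast

lemma transition_smooth:
  "(D, \<phi>) \<in> A \<Longrightarrow> (D', \<psi>) \<in> A \<Longrightarrow> smooth_on (\<phi> ` (D \<inter> D')) (\<lambda>u. \<psi> (the_inv_into D \<phi> u))"
  using smooth_atlas unfolding smooth_atlas_def o_def by blast

lemma chart_inverse: "(D, \<phi>) \<in> A \<Longrightarrow> x \<in> D \<Longrightarrow> the_inv_into D \<phi> (\<phi> x) = x"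
  using chart_inj by (simp add: the_inv_into_f_f)

lemma mopen_Int: "mopen A N \<Longrightarrow> mopen A N' \<Longrightarrow> mopen A (N \<inter> N')"
  using istopology_mopen[OF smooth_atlas] by (simp add: istopology_def)

text \<open>Openness in one chart is enough, since transition maps are continuous.\<close>

lemma mopen_chartI:
  assumes "(D, \<phi>) \<in> A" "N \<subseteq> D" "open (\<phi> ` N)"
  shows "mopen A N"
  unfolding mopen_def
proof (intro conjI ballI)
  show "N \<subseteq> points A" using assms by (force simp: points_def)
  fix c assume c: "c \<in> A"
  obtain D' \<psi> where [simp]: "c = (D', \<psi>)" by (cases c)
  let ?S = "\<psi> ` (D' \<inter> D)"
  have "continuous_on ?S (\<lambda>u. \<phi> (the_inv_into D' \<psi> u))"
    using c assms by (intro smooth_on_continuous transition_smooth) auto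
  then have "open (?S \<inter> (\<lambda>u. \<phi> (the_inv_into D' \<psi> u)) -` (\<phi> ` N))"
    using c assms transition_open[of D' \<psi> D \<phi>] by (intro continuous_open_preimage) auto
  moreover have "?S \<inter> (\<lambda>u. \<phi> (the_inv_into D' \<psi> u)) -` (\<phi> ` N) = \<psi> ` (N \<inter> D')"
  proof -
    have mem: "\<phi> x \<in> \<phi> ` N \<longleftrightarrow> x \<in> N" if "x \<in> D" for x
      using inj_on_image_mem_iff[OF chart_inj[OF assms(1)] that assms(2)] .
    have "{x \<in> D' \<inter> D. \<phi> x \<in> \<phi> ` N} = N \<inter> D'"
      using mem assms(2) by blast
    moreover have "?S \<inter> (\<lambda>u. \<phi> (the_inv_into D' \<psi> u)) -` (\<phi> ` N) = \<psi> ` {x \<in> D' \<inter> D. \<phi> x \<in> \<phi> ` N}"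
      using c by (auto simp: chart_inverse)
    ultimately show ?thesis by simp
  qed
  ultimately show "case c of (D, \<phi>) \<Rightarrow> open (\<phi> ` (N \<inter> D))" by simp
qed

lemma mopen_chart: "(D, \<phi>) \<in> A \<Longrightarrow> mopen A D"
  by (rule mopen_chartI) (auto intro: chart_open)

lemma mopen_image_open: "mopen A N \<Longrightarrow> (D, \<phi>) \<in> A \<Longrightarrow> open (\<phi> ` (N \<inter> D))"
  by (auto simp: mopen_def)

lemma mopen_obtain_chart:
  assumes "mopen A N" "x \<in> N"
  obtains D \<phi> where "(D, \<phi>) \<in> A" "x \<in> D"
  using assms by (auto simp: mopen_def points_def)

lemma smooth_fun_on_chart:
  "smooth_fun A N f \<Longrightarrow> (D, \<phi>) \<in> A \<Longrightarrow> smooth_on (\<phi> ` (N \<inter> D)) (\<lambda>u. f (the_inv_into D \<phi> u))"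
  by (auto simp: smooth_fun_def o_def)

lemma smooth_funI:
  "(\<And>D \<phi>. (D, \<phi>) \<in> A \<Longrightarrow> smooth_on (\<phi> ` (N \<inter> D)) (\<lambda>u. f (the_inv_into D \<phi> u))) \<Longrightarrow> smooth_fun A N f"
  by (auto simp: smooth_fun_def o_def)

lemma smooth_fun_subset: "smooth_fun A N f \<Longrightarrow> N' \<subseteq> N \<Longrightarrow> smooth_fun A N' f"
  by (rule smooth_funI) (auto intro: smooth_on_subset dest: smooth_fun_on_chart)

lemma smooth_fun_local:
  assumes "\<And>x. x \<in> N \<Longrightarrow> \<exists>N'. mopen A N' \<and> x \<in> N' \<and> smooth_fun A N' f"
  shows "smooth_fun A N f"
proof (intro smooth_funI smooth_on_local)
  fix D \<phi> u assume D: "(D, \<phi>) \<in> A" and "u \<in> \<phi> ` (N \<inter> D)"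
  then obtain x where x: "x \<in> N" "x \<in> D" "u = \<phi> x" by auto
  then obtain N' where "mopen A N'" "x \<in> N'" "smooth_fun A N' f" using assms by blast
  then show "\<exists>T. open T \<and> u \<in> T \<and> smooth_on T (\<lambda>u. f (the_inv_into D \<phi> u))"
    using x D by (intro exI[of _ "\<phi> ` (N' \<inter> D)"]) (auto intro: mopen_image_open smooth_fun_on_chart)
qed

lemma smooth_fun_cong:
  assumes "mopen A N" "\<And>x. x \<in> N \<Longrightarrow> f x = g x" "smooth_fun A N f"
  shows "smooth_fun A N g"
proof (rule smooth_funI)
  fix D \<phi> assume D: "(D, \<phi>) \<in> A"
  show "smooth_on (\<phi> ` (N \<inter> D)) (\<lambda>u. g (the_inv_into D \<phi> u))"
    by (rule smooth_on_cong[OF mopen_image_open[OF assms(1) D] _ smooth_fun_on_chart[OF assms(3) D]])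
      (use assms(2) D in \<open>auto simp: chart_inverse\<close>)
qed

text \<open>Smoothness in one chart is enough, since transition maps are smooth.\<close>

lemma smooth_fun_chartI:
  assumes N: "mopen A N" "N \<subseteq> D" and D: "(D, \<phi>) \<in> A"
    and f: "smooth_on (\<phi> ` N) (\<lambda>u. f (the_inv_into D \<phi> u))"
  shows "smooth_fun A N f"
proof (rule smooth_funI)
  fix D' \<psi> assume D': "(D', \<psi>) \<in> A"
  let ?S = "\<psi> ` (N \<inter> D')"
  have op: "open ?S" using N(1) D' by (rule mopen_image_open)
  have "smooth_on ?S (\<lambda>u. f (the_inv_into D \<phi> (\<phi> (the_inv_into D' \<psi> u))))"
  proof (rule smooth_on_compose[OF op _ _ f])
    show "(\<lambda>u. \<phi> (the_inv_into D' \<psi> u)) ` ?S \<subseteq> \<phi> ` N" using D' by (auto simp: chart_inverse)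
    show "smooth_on ?S (\<lambda>u. \<phi> (the_inv_into D' \<psi> u))"
      by (rule smooth_on_subset[OF transition_smooth[OF D' D]]) (use N in auto)
  qed
  then show "smooth_on ?S (\<lambda>u. f (the_inv_into D' \<psi> u))"
    by (rule smooth_on_cong[OF op, rotated]) (use D D' N in \<open>auto simp: chart_inverse subset_iff\<close>)
qed

lemma smooth_fun_const: "smooth_fun A N (\<lambda>y. c)"
  by (intro smooth_funI smooth_on_const)

lemma smooth_fun_add:
  "mopen A N \<Longrightarrow> smooth_fun A N f \<Longrightarrow> smooth_fun A N g \<Longrightarrow> smooth_fun A N (\<lambda>y. f y + g y)"
  by (rule smooth_funI, rule smooth_on_add) (auto intro: mopen_image_open smooth_fun_on_chart)

lemma smooth_fun_mult:
  "mopen A N \<Longrightarrow> smooth_fun A N f \<Longrightarrow> smooth_fun A N g \<Longrightarrow> smooth_fun A N (\<lambda>y. f y * g y)"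
  by (rule smooth_funI, rule smooth_on_mult) (auto intro: mopen_image_open smooth_fun_on_chart)

lemma smooth_fun_minus:
  "mopen A N \<Longrightarrow> smooth_fun A N f \<Longrightarrow> smooth_fun A N (\<lambda>y. - f y)"
  using smooth_fun_mult[of N "\<lambda>_. - 1" f] by (simp add: smooth_fun_const)

lemma smooth_fun_diff:
  "mopen A N \<Longrightarrow> smooth_fun A N f \<Longrightarrow> smooth_fun A N g \<Longrightarrow> smooth_fun A N (\<lambda>y. f y - g y)"
  using smooth_fun_add[of N f "\<lambda>y. - g y"] smooth_fun_minus by simp

lemma smooth_fun_sum:
  "mopen A N \<Longrightarrow> (\<And>i. i \<in> I \<Longrightarrow> smooth_fun A N (f i)) \<Longrightarrow> smooth_fun A N (\<lambda>y. \<Sum>i\<in>I. f i y)"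
  by (rule smooth_funI, rule smooth_on_sum) (auto intro: mopen_image_open smooth_fun_on_chart)

lemma smooth_fun_inverse:
  assumes "mopen A N" "smooth_fun A N f" "\<And>y. y \<in> N \<Longrightarrow> f y \<noteq> 0"
  shows "smooth_fun A N (\<lambda>y. inverse (f y))"
  by (rule smooth_funI, rule smooth_on_inverse)
    (use assms in \<open>auto simp: chart_inverse intro: mopen_image_open smooth_fun_on_chart\<close>)

lemma smooth_fun_divide:
  assumes "mopen A N" "smooth_fun A N f" "smooth_fun A N g" "\<And>y. y \<in> N \<Longrightarrow> g y \<noteq> 0"
  shows "smooth_fun A N (\<lambda>y. f y / g y)"
  unfolding divide_inverse using assms by (intro smooth_fun_mult smooth_fun_inverse)

lemma smooth_fun_coord: "(D, \<phi>) \<in> A \<Longrightarrow> smooth_fun A D (\<lambda>y. \<phi> y \<bullet> b)"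
proof (rule smooth_fun_chartI[OF mopen_chart subset_refl])
  assume D: "(D, \<phi>) \<in> A"
  have "smooth_on (\<phi> ` D) (\<lambda>u. u \<bullet> b)"
    using D by (intro smooth_on_linear_compose[OF bounded_linear_inner_left] smooth_on_id chart_open)
  then show "smooth_on (\<phi> ` D) (\<lambda>u. \<phi> (the_inv_into D \<phi> u) \<bullet> b)"
    by (rule smooth_on_cong[OF chart_open[OF D], rotated]) (use D in \<open>auto simp: chart_inverse\<close>)
qed

lemma mopen_nonzero:
  assumes "mopen A N" "smooth_fun A N f"
  shows "mopen A {y \<in> N. f y \<noteq> 0}"
  unfolding mopen_def
proof (intro conjI ballI)
  show "{y \<in> N. f y \<noteq> 0} \<subseteq> points A" using assms by (auto simp: mopen_def)
  fix c assume c: "c \<in> A"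
  obtain D \<phi> where [simp]: "c = (D, \<phi>)" by (cases c)
  have "open (\<phi> ` (N \<inter> D) \<inter> (\<lambda>u. f (the_inv_into D \<phi> u)) -` (- {0}))"
    using assms c by (intro continuous_open_preimage smooth_on_continuous[OF smooth_fun_on_chart] mopen_image_open) auto
  also have "\<phi> ` (N \<inter> D) \<inter> (\<lambda>u. f (the_inv_into D \<phi> u)) -` (- {0}) = \<phi> ` ({y \<in> N. f y \<noteq> 0} \<inter> D)"
    using c by (auto simp: chart_inverse)
  finally show "case c of (D, \<phi>) \<Rightarrow> open (\<phi> ` ({y \<in> N. f y \<noteq> 0} \<inter> D))" by simp
qed

lemma smooth_atI: "mopen A N \<Longrightarrow> x \<in> N \<Longrightarrow> smooth_fun A N f \<Longrightarrow> smooth_at A x f"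
  by (auto simp: smooth_at_def)

lemma smooth_at_common:
  assumes "smooth_at A x f" "smooth_at A x g"
  obtains N where "mopen A N" "x \<in> N" "smooth_fun A N f" "smooth_fun A N g"
proof -
  obtain N1 N2 where "mopen A N1" "x \<in> N1" "smooth_fun A N1 f" "mopen A N2" "x \<in> N2" "smooth_fun A N2 g"
    using assms by (auto simp: smooth_at_def)
  then show ?thesis
    by (intro that[of "N1 \<inter> N2"]) (auto intro: mopen_Int smooth_fun_subset)
qed

lemma smooth_at_add: "smooth_at A x f \<Longrightarrow> smooth_at A x g \<Longrightarrow> smooth_at A x (\<lambda>y. f y + g y)"
  by (metis smooth_at_common smooth_atI smooth_fun_add)

lemma smooth_at_mult: "smooth_at A x f \<Longrightarrow> smooth_at A x g \<Longrightarrow> smooth_at A x (\<lambda>y. f y * g y)"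
  by (metis smooth_at_common smooth_atI smooth_fun_mult)

lemma smooth_at_const: "x \<in> points A \<Longrightarrow> smooth_at A x (\<lambda>y. c)"
  using mopen_chart by (force simp: points_def intro: smooth_atI smooth_fun_const)

lemma smooth_at_points: "smooth_at A x f \<Longrightarrow> x \<in> points A"
  by (auto simp: smooth_at_def mopen_def)

lemma smooth_at_sum:
  assumes "x \<in> points A" "\<And>i. i \<in> I \<Longrightarrow> smooth_at A x (f i)"
  shows "smooth_at A x (\<lambda>y. \<Sum>i\<in>I. f i y)"
  using assms(2)
  by (induction I rule: infinite_finite_induct) (auto simp: smooth_at_const assms(1) smooth_at_add)

lemma smooth_at_cong:
  assumes "mopen A N" "x \<in> N" "\<And>y. y \<in> N \<Longrightarrow> f y = g y" "smooth_at A x f"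
  shows "smooth_at A x g"
proof -
  obtain N1 where "mopen A N1" "x \<in> N1" "smooth_fun A N1 f" using assms(4) by (auto simp: smooth_at_def)
  moreover from this assms have "smooth_fun A (N1 \<inter> N) g"
    by (intro smooth_fun_cong[OF mopen_Int _ smooth_fun_subset[of N1 f]]) auto
  ultimately show ?thesis using assms by (intro smooth_atI[of "N1 \<inter> N"]) (auto intro: mopen_Int)
qed

lemma smooth_at_coord: "(D, \<phi>) \<in> A \<Longrightarrow> x \<in> D \<Longrightarrow> smooth_at A x (\<lambda>y. \<phi> y \<bullet> b)"
  using smooth_atI[OF mopen_chart _ smooth_fun_coord] .

section \<open>Tangent vectors\<close>

abbreviation T :: "'p \<Rightarrow> 'p tvec set" where "T \<equiv> tangent_space A"

lemma tv_add: "v \<in> T x \<Longrightarrow> smooth_at A x f \<Longrightarrow> smooth_at A x g \<Longrightarrow> v (\<lambda>y. f y + g y) = v f + v g"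
  by (simp add: tangent_space_def)

lemma tv_mult:
  "v \<in> T x \<Longrightarrow> smooth_at A x f \<Longrightarrow> smooth_at A x g \<Longrightarrow> v (\<lambda>y. f y * g y) = f x * v g + g x * v f"
  by (simp add: tangent_space_def)

lemma tv_cmult: "v \<in> T x \<Longrightarrow> smooth_at A x f \<Longrightarrow> v (\<lambda>y. c * f y) = c * v f"
  by (simp add: tangent_space_def)

lemma tv_not_smooth: "v \<in> T x \<Longrightarrow> \<not> smooth_at A x f \<Longrightarrow> v f = 0"
  by (simp add: tangent_space_def)

lemma tv_cong:
  assumes "v \<in> T x" "mopen A N" "x \<in> N" "\<And>y. y \<in> N \<Longrightarrow> f y = g y"
  shows "v f = v g"
proof (cases "smooth_at A x f")
  case True
  then have "smooth_at A x g" using assms smooth_at_cong by blast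
  then show ?thesis using True assms unfolding tangent_space_def by blast
next
  case False
  then have "\<not> smooth_at A x g" using assms smooth_at_cong[of N x g f] by auto
  then show ?thesis using False assms tv_not_smooth by metis
qed

lemma tv_const: assumes "v \<in> T x" shows "v (\<lambda>y. c) = 0"
proof (cases "x \<in> points A")
  case True
  have "v (\<lambda>y. c * 1) = c * v (\<lambda>y. 1)" using assms True by (intro tv_cmult smooth_at_const)
  moreover have "v (\<lambda>y. 1 * 1) = 1 * v (\<lambda>y. 1) + 1 * v (\<lambda>y. 1)"
    using assms True by (intro tv_mult smooth_at_const)
  ultimately show ?thesis by simp
next
  case False
  then show ?thesis using assms tv_not_smooth smooth_at_points by metis
qed

lemma tv_minus: "v \<in> T x \<Longrightarrow> smooth_at A x f \<Longrightarrow> v (\<lambda>y. - f y) = - v f"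
  using tv_cmult[of v x f "-1"] by simp

lemma tv_diff: "v \<in> T x \<Longrightarrow> smooth_at A x f \<Longrightarrow> smooth_at A x g \<Longrightarrow> v (\<lambda>y. f y - g y) = v f - v g"
  using tv_add[of v x f "\<lambda>y. - g y"] tv_minus[of v x g] smooth_at_mult[of x "\<lambda>_. -1" g]
  by (simp add: smooth_at_const smooth_at_points)

lemma tv_sum:
  assumes "v \<in> T x" "x \<in> points A" "\<And>i. i \<in> I \<Longrightarrow> smooth_at A x (f i)"
  shows "v (\<lambda>y. \<Sum>i\<in>I. f i y) = (\<Sum>i\<in>I. v (f i))"
  using assms(3)
proof (induction I rule: infinite_finite_induct)
  case (insert i I)
  then show ?case using assms(1,2) tv_add[of v x "f i" "\<lambda>y. \<Sum>i\<in>I. f i y"] smooth_at_sum[of x I f] by simp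
qed (use assms tv_const in auto)

lemma subspace_T: "subspace (T x)"
  unfolding subspace_def
proof (intro conjI ballI allI)
  show "0 \<in> T x" by (simp add: tangent_space_def)
  fix v w assume v: "v \<in> T x" and w: "w \<in> T x"
  have "v f + w f = v g + w g" if "mopen A N" "x \<in> N" "\<forall>y\<in>N. f y = g y" for f g N
    using that tv_cong[OF v, of N f g] tv_cong[OF w, of N f g] by simp
  then show "v + w \<in> T x"
    unfolding tangent_space_def using v w
    by (auto simp: tv_add tv_mult tv_cmult tv_not_smooth algebra_simps)
next
  fix c v assume v: "v \<in> T x"
  have "c * v f = c * v g" if "mopen A N" "x \<in> N" "\<forall>y\<in>N. f y = g y" for f g N
    using that tv_cong[OF v, of N f g] by simp
  then show "c *\<^sub>R v \<in> T x"
    unfolding tangent_space_def using v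
    by (auto simp: tv_add tv_mult tv_cmult tv_not_smooth scaleR_fun_def algebra_simps)
qed

text \<open>The coordinate derivation in the direction \<open>e\<close> of the chart; like every tangent vector it is \<open>0\<close> on
  functions that are not smooth at the point.\<close>

definition coord_vfield :: "'p set \<Rightarrow> ('p \<Rightarrow> 'e) \<Rightarrow> 'e \<Rightarrow> 'p vfield" where
  "coord_vfield D \<phi> e x = (\<lambda>f. if smooth_at A x f
     then frechet_derivative (\<lambda>u. f (the_inv_into D \<phi> u)) (at (\<phi> x)) e else 0)"

lemma smooth_at_chart_differentiable:
  assumes "smooth_at A x f" "(D, \<phi>) \<in> A" "x \<in> D"
  shows "((\<lambda>u. f (the_inv_into D \<phi> u)) has_derivative (\<lambda>e. coord_vfield D \<phi> e x f)) (at (\<phi> x))"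
proof -
  obtain N where "mopen A N" "x \<in> N" "smooth_fun A N f" using assms(1) by (auto simp: smooth_at_def)
  then have "((\<lambda>u. f (the_inv_into D \<phi> u)) has_derivative
      frechet_derivative (\<lambda>u. f (the_inv_into D \<phi> u)) (at (\<phi> x))) (at (\<phi> x))"
    using assms by (intro smooth_on_has_derivative[OF smooth_fun_on_chart]) auto
  then show ?thesis using assms(1) by (simp add: coord_vfield_def cong: if_cong)
qed

lemma coord_vfield_eqI:
  assumes "smooth_at A x f" "((\<lambda>u. f (the_inv_into D \<phi> u)) has_derivative f') (at (\<phi> x))"
  shows "coord_vfield D \<phi> e x f = f' e"
  using assms by (simp add: coord_vfield_def frechet_derivative_at[symmetric])

lemma coord_vfield_in_T:
  assumes D: "(D, \<phi>) \<in> A" "x \<in> D"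
  shows "coord_vfield D \<phi> e x \<in> T x"
proof -
  note der = smooth_at_chart_differentiable[OF _ D]
  let ?v = "coord_vfield D \<phi> e x"
  have "?v (\<lambda>y. f y + g y) = ?v f + ?v g" if "smooth_at A x f" "smooth_at A x g" for f g
    by (rule coord_vfield_eqI[OF smooth_at_add[OF that] has_derivative_add[OF der[OF that(1)] der[OF that(2)]]])
  moreover have "?v (\<lambda>y. f y * g y) = f x * ?v g + g x * ?v f" if "smooth_at A x f" "smooth_at A x g" for f g
    using coord_vfield_eqI[OF smooth_at_mult[OF that] has_derivative_mult[OF der[OF that(1)] der[OF that(2)]]]
    by (simp add: chart_inverse[OF D] mult.commute)
  moreover have "?v (\<lambda>y. c * f y) = c * ?v f" if "smooth_at A x f" for f c
    using that
    by (intro coord_vfield_eqI smooth_at_mult smooth_at_const has_derivative_mult_right der) (auto intro: smooth_at_points)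
  moreover have "?v f = ?v g"
    if fg: "smooth_at A x f" "smooth_at A x g" and N: "mopen A N" "x \<in> N" "\<forall>y\<in>N. f y = g y" for f g N
  proof -
    have "((\<lambda>u. g (the_inv_into D \<phi> u)) has_derivative (\<lambda>e. coord_vfield D \<phi> e x f)) (at (\<phi> x))"
      by (rule has_derivative_transform_within_open[OF der[OF fg(1)] mopen_image_open[OF N(1) D(1)]])
        (use D N in \<open>auto simp: chart_inverse\<close>)
    from coord_vfield_eqI[OF fg(2) this] show ?thesis by simp
  qed
  moreover have "?v f = 0" if "\<not> smooth_at A x f" for f using that by (simp add: coord_vfield_def)
  ultimately show ?thesis unfolding tangent_space_def by blast
qed

lemma coord_vfield_linear:
  assumes D: "(D, \<phi>) \<in> A" "x \<in> D"
  shows "linear (\<lambda>e. coord_vfield D \<phi> e x)"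
proof -
  have "linear (\<lambda>e. coord_vfield D \<phi> e x f)" for f
  proof (cases "smooth_at A x f")
    case True
    then show ?thesis using smooth_at_chart_differentiable[OF _ D] has_derivative_linear by blast
  next
    case False
    then show ?thesis by (simp add: coord_vfield_def linear_iff)
  qed
  then show ?thesis by (simp add: linear_iff fun_eq_iff scaleR_fun_def)
qed

lemma coord_vfield_coord:
  assumes D: "(D, \<phi>) \<in> A" "x \<in> D"
  shows "coord_vfield D \<phi> e x (\<lambda>y. \<phi> y \<bullet> b) = e \<bullet> b"
proof -
  have "((\<lambda>u. u \<bullet> b) has_derivative (\<lambda>u. u \<bullet> b)) (at (\<phi> x))"
    by (intro bounded_linear_imp_has_derivative bounded_linear_inner_left)
  then have "((\<lambda>u. \<phi> (the_inv_into D \<phi> u) \<bullet> b) has_derivative (\<lambda>u. u \<bullet> b)) (at (\<phi> x))"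
    by (rule has_derivative_transform_within_open[OF _ chart_open[OF D(1)]]) (use D in \<open>auto simp: chart_inverse\<close>)
  from coord_vfield_eqI[OF smooth_at_coord[OF D] this] show ?thesis .
qed

text \<open>A derivation is determined by its values on the coordinate functions. By Hadamard's lemma a smooth
  function is near \<open>x\<close> a constant plus a sum of products of functions, the first factor being a
  coordinate that vanishes at \<open>x\<close>; the derivation kills the constant, and the product rule leaves
  the coefficients at \<open>x\<close>, which are the partial derivatives.\<close>

lemma tangent_vector_in_coordinates:
  assumes D: "(D, \<phi>) \<in> A" "x \<in> D" and v: "v \<in> T x"
  shows "v = coord_vfield D \<phi> (\<Sum>b\<in>Basis. v (\<lambda>y. \<phi> y \<bullet> b) *\<^sub>R b) x"
proof
  fix f
  let ?c = "\<lambda>b. v (\<lambda>y. \<phi> y \<bullet> b)"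
  show "v f = coord_vfield D \<phi> (\<Sum>b\<in>Basis. ?c b *\<^sub>R b) x f"
  proof (cases "smooth_at A x f")
    case False
    then show ?thesis using v by (simp add: tv_not_smooth coord_vfield_def)
  next
    case True
    then obtain N where N: "mopen A N" "x \<in> N" "smooth_fun A N f" by (auto simp: smooth_at_def)
    have "open (\<phi> ` (N \<inter> D))" "\<phi> x \<in> \<phi> ` (N \<inter> D)" using N D by (auto intro: mopen_image_open)
    then obtain r where r: "r > 0" "ball (\<phi> x) r \<subseteq> \<phi> ` (N \<inter> D)"
      unfolding open_contains_ball by blast
    let ?F = "\<lambda>u. f (the_inv_into D \<phi> u)"
    have F: "smooth_on (ball (\<phi> x) r) ?F"
      using smooth_on_subset[OF smooth_fun_on_chart[OF N(3) D(1)] r(2)] .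
    obtain g where g: "\<And>b. b \<in> Basis \<Longrightarrow> smooth_on (ball (\<phi> x) r) (g b)"
      "\<And>b. b \<in> Basis \<Longrightarrow> g b (\<phi> x) = frechet_derivative ?F (at (\<phi> x)) b"
      "\<And>u. u \<in> ball (\<phi> x) r \<Longrightarrow> ?F u = ?F (\<phi> x) + (\<Sum>b\<in>Basis. ((u - \<phi> x) \<bullet> b) * g b u)"
      using Hadamard_lemma[OF F] by blast
    define B where "B = {y \<in> D. \<phi> y \<in> ball (\<phi> x) r}"
    have img: "\<phi> ` B = ball (\<phi> x) r" using r by (auto simp: B_def)
    have B: "mopen A B" "x \<in> B" "B \<subseteq> D"
      using D r img by (auto simp: B_def intro: mopen_chartI[OF D(1)])
    have sg: "smooth_at A x (\<lambda>y. g b (\<phi> y))" if "b \<in> Basis" for b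
    proof (rule smooth_atI[OF B(1,2) smooth_fun_chartI[OF B(1,3) D(1)]])
      show "smooth_on (\<phi> ` B) (\<lambda>u. g b (\<phi> (the_inv_into D \<phi> u)))"
        unfolding img by (rule smooth_on_cong[OF _ _ g(1)[OF that]]) (use r D in \<open>auto simp: chart_inverse subset_iff\<close>)
    qed
    have px: "x \<in> points A" using D by (force simp: points_def)
    have sd: "smooth_at A x (\<lambda>y. \<phi> y \<bullet> b - \<phi> x \<bullet> b)" for b
      using smooth_at_add[OF smooth_at_coord[OF D] smooth_at_const[OF px], of b "- (\<phi> x \<bullet> b)"] by simp
    have dv: "v (\<lambda>y. \<phi> y \<bullet> b - \<phi> x \<bullet> b) = ?c b" for b
      using tv_diff[OF v smooth_at_coord[OF D] smooth_at_const[OF px]] tv_const[OF v] by simp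
    have s: "smooth_at A x (\<lambda>y. (\<phi> y \<bullet> b - \<phi> x \<bullet> b) * g b (\<phi> y))" if "b \<in> Basis" for b
      using smooth_at_mult[OF sd sg[OF that]] .
    have "v f = v (\<lambda>y. f x + (\<Sum>b\<in>Basis. (\<phi> y \<bullet> b - \<phi> x \<bullet> b) * g b (\<phi> y)))"
    proof (rule tv_cong[OF v B(1,2)])
      fix y assume "y \<in> B"
      then show "f y = f x + (\<Sum>b\<in>Basis. (\<phi> y \<bullet> b - \<phi> x \<bullet> b) * g b (\<phi> y))"
        using g(3)[of "\<phi> y"] D by (simp add: B_def chart_inverse inner_diff_left del: mem_ball)
    qed
    also have "\<dots> = (\<Sum>b\<in>Basis. v (\<lambda>y. (\<phi> y \<bullet> b - \<phi> x \<bullet> b) * g b (\<phi> y)))"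
    proof -
      have "smooth_at A x (\<lambda>y. \<Sum>b\<in>Basis. (\<phi> y \<bullet> b - \<phi> x \<bullet> b) * g b (\<phi> y))"
        using px s by (rule smooth_at_sum)
      from tv_add[OF v smooth_at_const[OF px] this, of "f x"]
      have "v (\<lambda>y. f x + (\<Sum>b\<in>Basis. (\<phi> y \<bullet> b - \<phi> x \<bullet> b) * g b (\<phi> y)))
          = v (\<lambda>y. \<Sum>b\<in>Basis. (\<phi> y \<bullet> b - \<phi> x \<bullet> b) * g b (\<phi> y))"
        by (simp add: tv_const[OF v])
      also have "\<dots> = (\<Sum>b\<in>Basis. v (\<lambda>y. (\<phi> y \<bullet> b - \<phi> x \<bullet> b) * g b (\<phi> y)))"
        using v px s by (rule tv_sum)
      finally show ?thesis .
    qed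
    also have "\<dots> = (\<Sum>b\<in>Basis. ?c b * coord_vfield D \<phi> b x f)"
    proof (rule sum.cong[OF refl])
      fix b :: 'e assume b: "b \<in> Basis"
      have "v (\<lambda>y. (\<phi> y \<bullet> b - \<phi> x \<bullet> b) * g b (\<phi> y)) = g b (\<phi> x) * ?c b"
        using tv_mult[OF v sd sg[OF b]] dv by simp
      then show "v (\<lambda>y. (\<phi> y \<bullet> b - \<phi> x \<bullet> b) * g b (\<phi> y)) = ?c b * coord_vfield D \<phi> b x f"
        using True by (simp add: g(2)[OF b] coord_vfield_def)
    qed
    also have "\<dots> = coord_vfield D \<phi> (\<Sum>b\<in>Basis. ?c b *\<^sub>R b) x f"
    proof -
      have lin: "linear (\<lambda>e. coord_vfield D \<phi> e x f)"
        using smooth_at_chart_differentiable[OF True D] has_derivative_linear by blast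
      show ?thesis by (simp add: linear_sum[OF lin] linear_scale[OF lin])
    qed
    finally show ?thesis .
  qed
qed

section \<open>Vector fields and their brackets\<close>

lemma T_add: "v \<in> T x \<Longrightarrow> w \<in> T x \<Longrightarrow> v + w \<in> T x"
  using subspace_T subspace_add by blast

lemma T_scale: "v \<in> T x \<Longrightarrow> c *\<^sub>R v \<in> T x"
  using subspace_T subspace_scale by blast

lemma T_zero: "0 \<in> T x"
  using subspace_T subspace_0 by blast

lemma T_diff: "v \<in> T x \<Longrightarrow> w \<in> T x \<Longrightarrow> v - w \<in> T x"
  using subspace_T subspace_diff by blast

lemma vfield_T: "smooth_vfield A N X \<Longrightarrow> x \<in> N \<Longrightarrow> X x \<in> T x"
  by (simp add: smooth_vfield_def)

lemma vfield_fun: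
  "smooth_vfield A N X \<Longrightarrow> mopen A N' \<Longrightarrow> N' \<subseteq> N \<Longrightarrow> smooth_fun A N' f \<Longrightarrow> smooth_fun A N' (\<lambda>y. X y f)"
  by (simp add: smooth_vfield_def)

lemma vfield_subset: "smooth_vfield A N X \<Longrightarrow> N' \<subseteq> N \<Longrightarrow> smooth_vfield A N' X"
  unfolding smooth_vfield_def by (meson subset_iff)

lemma vfield_smooth_at:
  assumes "smooth_vfield A N X" "mopen A N" "x \<in> N" "smooth_at A x f"
  shows "smooth_at A x (\<lambda>y. X y f)"
proof -
  obtain N1 where "mopen A N1" "x \<in> N1" "smooth_fun A N1 f" using assms(4) by (auto simp: smooth_at_def)
  then show ?thesis using assms
    by (intro smooth_atI[of "N1 \<inter> N"] vfield_fun[of N X]) (auto intro: mopen_Int smooth_fun_subset)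
qed

lemma vfield_add:
  assumes "smooth_vfield A N X" "smooth_vfield A N Y"
  shows "smooth_vfield A N (\<lambda>y. X y + Y y)"
  using assms by (auto simp: smooth_vfield_def T_add intro!: smooth_fun_add)

lemma vfield_scale:
  assumes "smooth_fun A N f" "smooth_vfield A N X"
  shows "smooth_vfield A N (\<lambda>y. f y *\<^sub>R X y)"
  using assms by (auto simp: smooth_vfield_def T_scale scaleR_fun_apply intro!: smooth_fun_mult intro: smooth_fun_subset)

lemma vfield_zero: "smooth_vfield A N (\<lambda>y. 0)"
  by (simp add: smooth_vfield_def T_zero smooth_fun_const)

lemma vfield_cscale: "smooth_vfield A N X \<Longrightarrow> smooth_vfield A N (\<lambda>y. c *\<^sub>R X y)"
  using vfield_scale[OF smooth_fun_const] by blast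

lemma vfield_diff:
  assumes "smooth_vfield A N X" "smooth_vfield A N Y"
  shows "smooth_vfield A N (\<lambda>y. X y - Y y)"
  using vfield_add[OF assms(1) vfield_cscale[OF assms(2), of "-1"]] by simp

lemma vfield_sum:
  "(\<And>i. i \<in> I \<Longrightarrow> smooth_vfield A N (X i)) \<Longrightarrow> smooth_vfield A N (\<lambda>y. \<Sum>i\<in>I. X i y)"
  by (induction I rule: infinite_finite_induct) (auto simp: vfield_zero vfield_add)

lemma vfield_coord:
  assumes D: "(D, \<phi>) \<in> A"
  shows "smooth_vfield A D (coord_vfield D \<phi> e)"
  unfolding smooth_vfield_def
proof (intro conjI ballI allI impI)
  show "coord_vfield D \<phi> e x \<in> T x" if "x \<in> D" for x using coord_vfield_in_T[OF D that] .
  fix N f assume N: "mopen A N \<and> N \<subseteq> D \<and> smooth_fun A N f"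
  then have ND: "N \<inter> D = N" by blast
  have "smooth_on (\<phi> ` N) (\<lambda>u. f (the_inv_into D \<phi> u))"
    using smooth_fun_on_chart[OF _ D, of N f] N ND by simp
  then have "smooth_on (\<phi> ` N) (\<lambda>u. frechet_derivative (\<lambda>u. f (the_inv_into D \<phi> u)) (at u) e)"
    by (rule smooth_on_derivative)
  moreover have "open (\<phi> ` N)" using mopen_image_open[OF _ D, of N] N ND by simp
  moreover have "smooth_at A y f" if "y \<in> N" for y using that N smooth_atI by blast
  ultimately have "smooth_on (\<phi> ` N) (\<lambda>u. coord_vfield D \<phi> e (the_inv_into D \<phi> u) f)"
    using N by (elim smooth_on_cong[rotated 2]) (auto simp: coord_vfield_def chart_inverse[OF D] subset_iff)
  then show "smooth_fun A N (\<lambda>y. coord_vfield D \<phi> e y f)"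
    using N D by (intro smooth_fun_chartI[of N D \<phi>]) auto
qed

lemma vfield_in_coordinates:
  assumes "(D, \<phi>) \<in> A" "x \<in> D" "v \<in> T x"
  shows "v = (\<Sum>b\<in>Basis. v (\<lambda>y. \<phi> y \<bullet> b) *\<^sub>R coord_vfield D \<phi> b x)"
proof -
  note lin = coord_vfield_linear[OF assms(1,2)]
  show ?thesis
    using tangent_vector_in_coordinates[OF assms] by (simp add: linear_sum[OF lin] linear_scale[OF lin])
qed

lemma bracket_apply:
  "smooth_at A x f \<Longrightarrow> bracket A X Y x f = X x (\<lambda>y. Y y f) - Y x (\<lambda>y. X y f)"
  by (simp add: bracket_def)

lemma bracket_antisym: "bracket A Y X x = - bracket A X Y x"
  by (simp add: bracket_def fun_eq_iff)

text \<open>The product rule holds for the commutator because the mixed terms, in which each of the two fields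
  differentiates one factor, are symmetric in the two fields and cancel.\<close>

lemma bracket_in_T:
  assumes N: "mopen A N" "x \<in> N" and X: "smooth_vfield A N X" and Y: "smooth_vfield A N Y"
  shows "bracket A X Y x \<in> T x"
proof -
  let ?v = "bracket A X Y x"
  note XT = vfield_T[OF X] and YT = vfield_T[OF Y]
  note sX = vfield_smooth_at[OF X N] and sY = vfield_smooth_at[OF Y N]
  have smooth_near: "\<exists>N'. mopen A N' \<and> x \<in> N' \<and> N' \<subseteq> N \<and> (\<forall>y\<in>N'. smooth_at A y f)" if f: "smooth_at A x f" for f
  proof -
    obtain N1 where "mopen A N1" "x \<in> N1" "smooth_fun A N1 f" using f by (auto simp: smooth_at_def)
    then show ?thesis using N by (intro exI[of _ "N1 \<inter> N"]) (auto intro: mopen_Int smooth_atI)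
  qed
  have eq: "Z x (\<lambda>y. W y f) = Z x g"
    if Z: "smooth_vfield A N Z" and N': "mopen A N'" "x \<in> N'" "\<And>y. y \<in> N' \<Longrightarrow> W y f = g y" for Z W :: "'p vfield" and f g N'
    using tv_cong[OF vfield_T[OF Z N(2)] N'] .
  have "?v (\<lambda>y. f y + g y) = ?v f + ?v g" if fg: "smooth_at A x f" "smooth_at A x g" for f g
  proof -
    obtain N1 N2 where N1: "mopen A N1" "x \<in> N1" "N1 \<subseteq> N" "\<And>y. y \<in> N1 \<Longrightarrow> smooth_at A y f"
      and N2: "mopen A N2" "x \<in> N2" "\<And>y. y \<in> N2 \<Longrightarrow> smooth_at A y g"
      using smooth_near fg by metis
    note N12 = mopen_Int[OF N1(1) N2(1)] IntI[OF N1(2) N2(2)]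
    have Z: "Z x (\<lambda>y. W y (\<lambda>y. f y + g y)) = Z x (\<lambda>y. W y f) + Z x (\<lambda>y. W y g)"
      if Z: "smooth_vfield A N Z" and W: "smooth_vfield A N W" for Z W
    proof -
      have "Z x (\<lambda>y. W y (\<lambda>y. f y + g y)) = Z x (\<lambda>y. W y f + W y g)"
        by (rule eq[OF Z N12]) (use N1 N2 vfield_T[OF W] tv_add in blast)
      also have "\<dots> = Z x (\<lambda>y. W y f) + Z x (\<lambda>y. W y g)"
        by (rule tv_add[OF vfield_T[OF Z N(2)] vfield_smooth_at[OF W N fg(1)] vfield_smooth_at[OF W N fg(2)]])
      finally show ?thesis .
    qed
    show ?thesis using fg by (simp add: bracket_apply smooth_at_add Z X Y)
  qed
  moreover have "?v (\<lambda>y. f y * g y) = f x * ?v g + g x * ?v f" if fg: "smooth_at A x f" "smooth_at A x g" for f g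
  proof -
    obtain N1 N2 where N1: "mopen A N1" "x \<in> N1" "N1 \<subseteq> N" "\<And>y. y \<in> N1 \<Longrightarrow> smooth_at A y f"
      and N2: "mopen A N2" "x \<in> N2" "\<And>y. y \<in> N2 \<Longrightarrow> smooth_at A y g"
      using smooth_near fg by metis
    note N12 = mopen_Int[OF N1(1) N2(1)] IntI[OF N1(2) N2(2)]
    have Z: "Z x (\<lambda>y. W y (\<lambda>y. f y * g y))
        = (f x * Z x (\<lambda>y. W y g) + W x g * Z x f) + (g x * Z x (\<lambda>y. W y f) + W x f * Z x g)"
      if Z: "smooth_vfield A N Z" and W: "smooth_vfield A N W" for Z W
    proof -
      note ZT = vfield_T[OF Z N(2)] and sW = vfield_smooth_at[OF W N]
      have "Z x (\<lambda>y. W y (\<lambda>y. f y * g y)) = Z x (\<lambda>y. f y * W y g + g y * W y f)"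
        by (rule eq[OF Z N12]) (use N1 N2 vfield_T[OF W] tv_mult in blast)
      also have "\<dots> = Z x (\<lambda>y. f y * W y g) + Z x (\<lambda>y. g y * W y f)"
        by (rule tv_add[OF ZT smooth_at_mult[OF fg(1) sW[OF fg(2)]] smooth_at_mult[OF fg(2) sW[OF fg(1)]]])
      finally show ?thesis using fg by (simp add: tv_mult[OF ZT] sW)
    qed
    show ?thesis using fg by (simp add: bracket_apply smooth_at_mult Z X Y algebra_simps)
  qed
  moreover have "?v (\<lambda>y. c * f y) = c * ?v f" if f: "smooth_at A x f" for c f
  proof -
    obtain N1 where N1: "mopen A N1" "x \<in> N1" "N1 \<subseteq> N" "\<And>y. y \<in> N1 \<Longrightarrow> smooth_at A y f"
      using smooth_near f by metis
    have Z: "Z x (\<lambda>y. W y (\<lambda>y. c * f y)) = c * Z x (\<lambda>y. W y f)"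
      if Z: "smooth_vfield A N Z" and W: "smooth_vfield A N W" for Z W
    proof -
      have "Z x (\<lambda>y. W y (\<lambda>y. c * f y)) = Z x (\<lambda>y. c * W y f)"
        by (rule eq[OF Z N1(1,2)]) (use N1 vfield_T[OF W] tv_cmult in blast)
      then show ?thesis using tv_cmult[OF vfield_T[OF Z N(2)] vfield_smooth_at[OF W N f]] by simp
    qed
    have "smooth_at A x (\<lambda>y. c * f y)" using f smooth_at_mult smooth_at_const smooth_at_points by blast
    then show ?thesis using f by (simp add: bracket_apply Z X Y algebra_simps)
  qed
  moreover have "?v f = ?v g"
    if fg: "smooth_at A x f" "smooth_at A x g" and N': "mopen A N'" "x \<in> N'" "\<forall>y\<in>N'. f y = g y" for f g N'
  proof -
    have Z: "Z x (\<lambda>y. W y f) = Z x (\<lambda>y. W y g)"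
      if Z: "smooth_vfield A N Z" and W: "smooth_vfield A N W" for Z W
    proof (rule eq[OF Z mopen_Int[OF N(1) N'(1)]])
      show "x \<in> N \<inter> N'" using N N' by blast
      fix y assume y: "y \<in> N \<inter> N'"
      show "W y f = W y g" by (rule tv_cong[OF vfield_T[OF W] N'(1)]) (use y N' in auto)
    qed
    show ?thesis using fg by (simp add: bracket_apply Z[OF X Y] Z[OF Y X])
  qed
  moreover have "?v f = 0" if "\<not> smooth_at A x f" for f using that by (simp add: bracket_def)
  ultimately show ?thesis unfolding tangent_space_def by blast
qed

lemma vfield_bracket:
  assumes N: "mopen A N" and X: "smooth_vfield A N X" and Y: "smooth_vfield A N Y"
  shows "smooth_vfield A N (bracket A X Y)"
  unfolding smooth_vfield_def
proof (intro conjI ballI allI impI)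
  show "bracket A X Y x \<in> T x" if "x \<in> N" for x using bracket_in_T[OF N that X Y] .
  fix N' f assume N': "mopen A N' \<and> N' \<subseteq> N \<and> smooth_fun A N' f"
  then have "smooth_fun A N' (\<lambda>y. X y (\<lambda>y. Y y f) - Y y (\<lambda>y. X y f))"
    using N' by (intro smooth_fun_diff) (auto intro!: vfield_fun[OF X] vfield_fun[OF Y])
  then show "smooth_fun A N' (\<lambda>y. bracket A X Y y f)"
    using N' by (elim smooth_fun_cong[rotated 2]) (auto simp: bracket_apply smooth_atI)
qed

lemma bracket_cong:
  assumes N: "mopen A N" "x \<in> N" and X: "\<And>y. y \<in> N \<Longrightarrow> X y = X' y" and Y: "\<And>y. y \<in> N \<Longrightarrow> Y y = Y' y"
    and T: "X x \<in> T x" "Y x \<in> T x"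
  shows "bracket A X Y x = bracket A X' Y' x"
proof
  fix f
  have "X x (\<lambda>y. Y y f) = X x (\<lambda>y. Y' y f)" by (rule tv_cong[OF T(1) N]) (simp add: Y)
  then have 1: "X x (\<lambda>y. Y y f) = X' x (\<lambda>y. Y' y f)" by (rule trans) (simp only: X[OF N(2)])
  have "Y x (\<lambda>y. X y f) = Y x (\<lambda>y. X' y f)" by (rule tv_cong[OF T(2) N]) (simp add: X)
  then have 2: "Y x (\<lambda>y. X y f) = Y' x (\<lambda>y. X' y f)" by (rule trans) (simp only: Y[OF N(2)])
  show "bracket A X Y x f = bracket A X' Y' x f" unfolding bracket_def 1 2 ..
qed

lemma bracket_add_left:
  assumes N: "mopen A N" "x \<in> N" and "smooth_vfield A N X" "smooth_vfield A N X'" "smooth_vfield A N Y"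
  shows "bracket A (\<lambda>y. X y + X' y) Y x = bracket A X Y x + bracket A X' Y x"
proof
  fix f
  show "bracket A (\<lambda>y. X y + X' y) Y x f = (bracket A X Y x + bracket A X' Y x) f"
  proof (cases "smooth_at A x f")
    case True
    have "Y x (\<lambda>y. X y f + X' y f) = Y x (\<lambda>y. X y f) + Y x (\<lambda>y. X' y f)"
      using tv_add[OF vfield_T[OF assms(5) N(2)] vfield_smooth_at[OF assms(3) N True]
          vfield_smooth_at[OF assms(4) N True]] .
    then show ?thesis using True by (simp add: bracket_apply)
  qed (simp add: bracket_def)
qed

lemma bracket_scale_left:
  assumes N: "mopen A N" "x \<in> N" and g: "smooth_at A x g" and XY: "smooth_vfield A N X" "smooth_vfield A N Y"
  shows "bracket A (\<lambda>y. g y *\<^sub>R X y) Y x = g x *\<^sub>R bracket A X Y x - Y x g *\<^sub>R X x"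
proof
  fix f
  show "bracket A (\<lambda>y. g y *\<^sub>R X y) Y x f = (g x *\<^sub>R bracket A X Y x - Y x g *\<^sub>R X x) f"
  proof (cases "smooth_at A x f")
    case True
    have "Y x (\<lambda>y. g y * X y f) = g x * Y x (\<lambda>y. X y f) + X x f * Y x g"
      using tv_mult[OF vfield_T[OF XY(2) N(2)] g vfield_smooth_at[OF XY(1) N True]] .
    then show ?thesis using True by (simp add: bracket_apply scaleR_fun_apply algebra_simps)
  next
    case False
    then show ?thesis using tv_not_smooth[OF vfield_T[OF XY(1) N(2)]] by (simp add: bracket_def scaleR_fun_apply)
  qed
qed

section \<open>One-forms and the exterior derivative\<close>

lemma form_add:
  "smooth_oneform A N \<alpha> \<Longrightarrow> x \<in> N \<Longrightarrow> v \<in> T x \<Longrightarrow> w \<in> T x \<Longrightarrow> \<alpha> x (v + w) = \<alpha> x v + \<alpha> x w"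
  by (simp add: smooth_oneform_def cotangent_space_def)

lemma form_scale: "smooth_oneform A N \<alpha> \<Longrightarrow> x \<in> N \<Longrightarrow> v \<in> T x \<Longrightarrow> \<alpha> x (c *\<^sub>R v) = c * \<alpha> x v"
  by (simp add: smooth_oneform_def cotangent_space_def)

lemma form_zero: "smooth_oneform A N \<alpha> \<Longrightarrow> x \<in> N \<Longrightarrow> \<alpha> x 0 = 0"
  using form_scale[of N \<alpha> x 0 0] T_zero by simp

lemma form_minus: "smooth_oneform A N \<alpha> \<Longrightarrow> x \<in> N \<Longrightarrow> v \<in> T x \<Longrightarrow> \<alpha> x (- v) = - \<alpha> x v"
  using form_scale[of N \<alpha> x v "-1"] by simp

lemma form_diff:
  "smooth_oneform A N \<alpha> \<Longrightarrow> x \<in> N \<Longrightarrow> v \<in> T x \<Longrightarrow> w \<in> T x \<Longrightarrow> \<alpha> x (v - w) = \<alpha> x v - \<alpha> x w"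
  using form_add[of N \<alpha> x v "- w"] form_minus[of N \<alpha> x w] T_scale[of w x "-1"] by simp

lemma form_outside: "smooth_oneform A N \<alpha> \<Longrightarrow> x \<in> N \<Longrightarrow> v \<notin> T x \<Longrightarrow> \<alpha> x v = 0"
  by (simp add: smooth_oneform_def cotangent_space_def)

lemma form_sum:
  assumes \<alpha>: "smooth_oneform A N \<alpha>" and x: "x \<in> N" and v: "\<And>i. i \<in> I \<Longrightarrow> v i \<in> T x"
  shows "\<alpha> x (\<Sum>i\<in>I. c i *\<^sub>R v i) = (\<Sum>i\<in>I. c i * \<alpha> x (v i))"
  using v
proof (induction I rule: infinite_finite_induct)
  case (insert i I)
  have "(\<Sum>i\<in>I. c i *\<^sub>R v i) \<in> T x"
    using insert.prems subspace_sum[OF subspace_T[of x], of I "\<lambda>i. c i *\<^sub>R v i"] by (simp add: T_scale)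
  then have "\<alpha> x (c i *\<^sub>R v i + (\<Sum>i\<in>I. c i *\<^sub>R v i)) = c i * \<alpha> x (v i) + \<alpha> x (\<Sum>i\<in>I. c i *\<^sub>R v i)"
    using insert.prems by (simp add: form_add[OF \<alpha> x] form_scale[OF \<alpha> x] T_scale)
  moreover have "\<alpha> x (\<Sum>i\<in>I. c i *\<^sub>R v i) = (\<Sum>i\<in>I. c i * \<alpha> x (v i))"
    using insert by simp
  ultimately show ?case unfolding sum.insert[OF insert.hyps] by (simp only:)
qed (simp_all add: form_zero[OF \<alpha> x])

lemma form_fun:
  "smooth_oneform A N \<alpha> \<Longrightarrow> mopen A N' \<Longrightarrow> N' \<subseteq> N \<Longrightarrow> smooth_vfield A N' X \<Longrightarrow> smooth_fun A N' (\<lambda>y. \<alpha> y (X y))"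
  by (simp add: smooth_oneform_def)

lemma form_subset: "smooth_oneform A N \<alpha> \<Longrightarrow> N' \<subseteq> N \<Longrightarrow> smooth_oneform A N' \<alpha>"
  unfolding smooth_oneform_def by (meson subset_iff)

lemma form_smooth_at:
  "smooth_oneform A N \<alpha> \<Longrightarrow> mopen A N \<Longrightarrow> x \<in> N \<Longrightarrow> smooth_vfield A N X \<Longrightarrow> smooth_at A x (\<lambda>y. \<alpha> y (X y))"
  using form_fun smooth_atI by blast

text \<open>The invariant formula for the exterior derivative, evaluated on two given vector fields. It is used
  to show that \<open>ext_d\<close> is well defined, that is, that only the values of the fields at \<open>x\<close> count.\<close>

definition dform :: "'p oneform \<Rightarrow> 'p vfield \<Rightarrow> 'p vfield \<Rightarrow> 'p \<Rightarrow> real" where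
  "dform \<alpha> X Y x = X x (\<lambda>y. \<alpha> y (Y y)) - Y x (\<lambda>y. \<alpha> y (X y)) - \<alpha> x (bracket A X Y x)"

context
  fixes N \<alpha> x
  assumes N: "mopen A N" "x \<in> N" and \<alpha>: "smooth_oneform A N \<alpha>"
begin

lemma dform_antisym:
  assumes "smooth_vfield A N X" "smooth_vfield A N Y"
  shows "dform \<alpha> Y X x = - dform \<alpha> X Y x"
  using form_minus[OF \<alpha> N(2) bracket_in_T[OF N assms]] bracket_antisym[of Y X x] by (simp add: dform_def)

lemma dform_add_left:
  assumes "smooth_vfield A N X" "smooth_vfield A N X'" "smooth_vfield A N Y"
  shows "dform \<alpha> (\<lambda>y. X y + X' y) Y x = dform \<alpha> X Y x + dform \<alpha> X' Y x"
proof -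
  have "Y x (\<lambda>y. \<alpha> y (X y + X' y)) = Y x (\<lambda>y. \<alpha> y (X y) + \<alpha> y (X' y))"
    by (rule tv_cong[OF vfield_T[OF assms(3) N(2)] N]) (use assms form_add[OF \<alpha>] vfield_T in blast)
  also have "\<dots> = Y x (\<lambda>y. \<alpha> y (X y)) + Y x (\<lambda>y. \<alpha> y (X' y))"
    using tv_add[OF vfield_T[OF assms(3) N(2)] form_smooth_at[OF \<alpha> N assms(1)] form_smooth_at[OF \<alpha> N assms(2)]] .
  finally show ?thesis
    using form_add[OF \<alpha> N(2) bracket_in_T[OF N assms(1,3)] bracket_in_T[OF N assms(2,3)]]
    by (simp add: dform_def bracket_add_left[OF N assms])
qed

text \<open>Function-linearity: the derivative of the factor occurs once in \<open>Y (\<alpha> (g X))\<close> and once in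
  \<open>[g X, Y]\<close>, with opposite signs.\<close>

lemma dform_scale_left:
  assumes g: "smooth_fun A N g" and X: "smooth_vfield A N X" and Y: "smooth_vfield A N Y"
  shows "dform \<alpha> (\<lambda>y. g y *\<^sub>R X y) Y x = g x * dform \<alpha> X Y x"
proof -
  have "Y x (\<lambda>y. \<alpha> y (g y *\<^sub>R X y)) = Y x (\<lambda>y. g y * \<alpha> y (X y))"
    by (rule tv_cong[OF vfield_T[OF Y N(2)] N]) (use form_scale[OF \<alpha>] vfield_T[OF X] in blast)
  also have "\<dots> = g x * Y x (\<lambda>y. \<alpha> y (X y)) + \<alpha> x (X x) * Y x g"
    using tv_mult[OF vfield_T[OF Y N(2)] smooth_atI[OF N g] form_smooth_at[OF \<alpha> N X]] .
  moreover have "\<alpha> x (bracket A (\<lambda>y. g y *\<^sub>R X y) Y x) = g x * \<alpha> x (bracket A X Y x) - Y x g * \<alpha> x (X x)"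
    using bracket_in_T[OF N X Y] vfield_T[OF X N(2)]
    by (simp add: bracket_scale_left[OF N smooth_atI[OF N g] X Y] form_diff[OF \<alpha> N(2)] form_scale[OF \<alpha> N(2)] T_scale)
  ultimately show ?thesis by (simp add: dform_def scaleR_fun_apply algebra_simps)
qed

lemma dform_sum_left:
  assumes "finite I" "\<And>i. i \<in> I \<Longrightarrow> smooth_fun A N (g i)" "\<And>i. i \<in> I \<Longrightarrow> smooth_vfield A N (X i)"
    and Y: "smooth_vfield A N Y"
  shows "dform \<alpha> (\<lambda>y. \<Sum>i\<in>I. g i y *\<^sub>R X i y) Y x = (\<Sum>i\<in>I. g i x * dform \<alpha> (X i) Y x)"
  using assms(1-3)
proof (induction I rule: finite_induct)
  case empty
  have "dform \<alpha> (\<lambda>y. 0 *\<^sub>R 0) Y x = 0 * dform \<alpha> (\<lambda>y. 0) Y x"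
    using dform_scale_left[OF smooth_fun_const vfield_zero Y, of 0] .
  then show ?case by (simp only: sum.empty scaleR_zero_left mult_zero_left)
next
  case (insert i I)
  have "dform \<alpha> (\<lambda>y. g i y *\<^sub>R X i y + (\<Sum>i\<in>I. g i y *\<^sub>R X i y)) Y x
     = dform \<alpha> (\<lambda>y. g i y *\<^sub>R X i y) Y x + dform \<alpha> (\<lambda>y. \<Sum>i\<in>I. g i y *\<^sub>R X i y) Y x"
    using insert by (intro dform_add_left vfield_scale vfield_sum Y) auto
  also have "dform \<alpha> (\<lambda>y. g i y *\<^sub>R X i y) Y x = g i x * dform \<alpha> (X i) Y x"
    using insert by (intro dform_scale_left Y) auto
  finally show ?case using insert by simp
qed

end

lemma dform_cong_left:
  assumes N: "mopen A N" "x \<in> N" and X: "\<And>y. y \<in> N \<Longrightarrow> X y = X' y" and T: "X x \<in> T x" "Y x \<in> T x"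
  shows "dform \<alpha> X Y x = dform \<alpha> X' Y x"
proof -
  have "Y x (\<lambda>y. \<alpha> y (X y)) = Y x (\<lambda>y. \<alpha> y (X' y))" by (rule tv_cong[OF T(2) N]) (simp add: X)
  then show ?thesis using bracket_cong[OF N, of X X' Y Y] X T X[OF N(2)] by (simp add: dform_def)
qed

text \<open>A field is near \<open>x\<close> a combination of coordinate fields with function coefficients, so by
  function-linearity only the coefficients at \<open>x\<close> enter.\<close>

lemma dform_pointwise_left:
  assumes N: "mopen A N" "x \<in> N" and \<alpha>: "smooth_oneform A N \<alpha>"
    and X: "smooth_vfield A N X" "smooth_vfield A N X'" "X x = X' x" and Y: "smooth_vfield A N Y"
  shows "dform \<alpha> X Y x = dform \<alpha> X' Y x"
proof -
  obtain D \<phi> where D: "(D, \<phi>) \<in> A" "x \<in> D" using mopen_obtain_chart[OF N] .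
  define M where "M = N \<inter> D"
  have M: "mopen A M" "x \<in> M" "M \<subseteq> N" "M \<subseteq> D" using N D by (auto simp: M_def mopen_Int mopen_chart)
  have "dform \<alpha> Z Y x = (\<Sum>b\<in>Basis. Z x (\<lambda>y. \<phi> y \<bullet> b) * dform \<alpha> (coord_vfield D \<phi> b) Y x)"
    if Z: "smooth_vfield A N Z" for Z
  proof -
    have "dform \<alpha> Z Y x = dform \<alpha> (\<lambda>y. \<Sum>b\<in>Basis. Z y (\<lambda>y. \<phi> y \<bullet> b) *\<^sub>R coord_vfield D \<phi> b y) Y x"
      by (rule dform_cong_left[OF M(1,2)])
        (use M D N Y Z vfield_T vfield_in_coordinates[OF D(1)] in \<open>blast intro: vfield_T\<close>)+
    also have "\<dots> = (\<Sum>b\<in>Basis. Z x (\<lambda>y. \<phi> y \<bullet> b) * dform \<alpha> (coord_vfield D \<phi> b) Y x)"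
      using M smooth_fun_subset[OF smooth_fun_coord[OF D(1)] M(4)]
      by (intro dform_sum_left[OF M(1,2) form_subset[OF \<alpha> M(3)]] vfield_fun[OF Z] vfield_subset[OF Y M(3)]
          vfield_subset[OF vfield_coord[OF D(1)] M(4)]) auto
    finally show ?thesis .
  qed
  then show ?thesis using X by simp
qed

lemma dform_pointwise:
  assumes N: "mopen A N" "x \<in> N" and \<alpha>: "smooth_oneform A N \<alpha>"
    and X: "smooth_vfield A N X" "smooth_vfield A N X'" "X x = X' x"
    and Y: "smooth_vfield A N Y" "smooth_vfield A N Y'" "Y x = Y' x"
  shows "dform \<alpha> X Y x = dform \<alpha> X' Y' x"
  using dform_pointwise_left[OF N \<alpha> X Y(1)] dform_pointwise_left[OF N \<alpha> Y X(2)]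
    dform_antisym[OF N \<alpha> X(2) Y(1)] dform_antisym[OF N \<alpha> X(2) Y(2)] by simp

lemma ext_d_eq_dform:
  assumes N: "mopen A N" "x \<in> N" and \<alpha>: "smooth_oneform A N \<alpha>"
    and N': "mopen A N'" "x \<in> N'" and X: "smooth_vfield A N' X" and Y: "smooth_vfield A N' Y"
  shows "ext_d A \<alpha> x (X x) (Y x) = dform \<alpha> X Y x"
  unfolding ext_d_def
proof (rule the_equality)
  show "\<forall>M X' Y'. mopen A M \<and> x \<in> M \<and> smooth_vfield A M X' \<and> smooth_vfield A M Y' \<and> X' x = X x \<and> Y' x = Y x \<longrightarrow>
    dform \<alpha> X Y x = X' x (\<lambda>y. \<alpha> y (Y' y)) - Y' x (\<lambda>y. \<alpha> y (X' y)) - \<alpha> x (bracket A X' Y' x)"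
  proof (intro allI impI, elim conjE)
    fix M X' Y' assume M: "mopen A M" "x \<in> M" and X': "smooth_vfield A M X'" "X' x = X x"
      and Y': "smooth_vfield A M Y'" "Y' x = Y x"
    let ?M = "N \<inter> (N' \<inter> M)"
    have "dform \<alpha> X Y x = dform \<alpha> X' Y' x"
      by (rule dform_pointwise[of ?M])
        (use N N' M X Y X' Y' \<alpha> in \<open>auto intro!: mopen_Int intro: vfield_subset form_subset\<close>)
    then show "dform \<alpha> X Y x = X' x (\<lambda>y. \<alpha> y (Y' y)) - Y' x (\<lambda>y. \<alpha> y (X' y)) - \<alpha> x (bracket A X' Y' x)"
      by (simp add: dform_def)
  qed
next
  fix c assume "\<forall>M X' Y'. mopen A M \<and> x \<in> M \<and> smooth_vfield A M X' \<and> smooth_vfield A M Y' \<and> X' x = X x \<and> Y' x = Y x \<longrightarrow>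
    c = X' x (\<lambda>y. \<alpha> y (Y' y)) - Y' x (\<lambda>y. \<alpha> y (X' y)) - \<alpha> x (bracket A X' Y' x)"
  then show "c = dform \<alpha> X Y x" using N' X Y unfolding dform_def by blast
qed

text \<open>For sections of the kernel of a one-form only the bracket survives in the invariant formula.\<close>

lemma ext_d_kernel:
  assumes N: "mopen A N" "x \<in> N" and \<alpha>: "smooth_oneform A N \<alpha>"
    and N': "mopen A N'" "x \<in> N'" and X: "smooth_vfield A N' X" and Y: "smooth_vfield A N' Y"
    and ker: "\<And>y. y \<in> N' \<Longrightarrow> \<alpha> y (X y) = 0" "\<And>y. y \<in> N' \<Longrightarrow> \<alpha> y (Y y) = 0"
  shows "ext_d A \<alpha> x (X x) (Y x) = - \<alpha> x (bracket A X Y x)"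
proof -
  have "X x (\<lambda>y. \<alpha> y (Y y)) = X x (\<lambda>y. 0)" by (rule tv_cong[OF vfield_T[OF X N'(2)] N']) (simp add: ker)
  moreover have "Y x (\<lambda>y. \<alpha> y (X y)) = Y x (\<lambda>y. 0)" by (rule tv_cong[OF vfield_T[OF Y N'(2)] N']) (simp add: ker)
  ultimately show ?thesis
    using ext_d_eq_dform[OF N \<alpha> N' X Y] tv_const[OF vfield_T[OF X N'(2)]] tv_const[OF vfield_T[OF Y N'(2)]]
    by (simp add: dform_def)
qed

text \<open>Coordinate fields with constant coefficients extend given tangent vectors; they are taken on one
  common neighbourhood, so that the formulas for vector fields apply to all of them at once.\<close>

lemma tangent_vectors_extend:
  assumes N: "mopen A N" "x \<in> N" and "finite V" "V \<subseteq> T x"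
  shows "\<exists>N' E. mopen A N' \<and> x \<in> N' \<and> N' \<subseteq> N \<and> (\<forall>v\<in>V. smooth_vfield A N' (E v) \<and> E v x = v)"
proof -
  obtain D \<phi> where D: "(D, \<phi>) \<in> A" "x \<in> D" using mopen_obtain_chart[OF N] .
  define E where "E v = coord_vfield D \<phi> (\<Sum>b\<in>Basis. v (\<lambda>y. \<phi> y \<bullet> b) *\<^sub>R b)" for v :: "'p tvec"
  have "smooth_vfield A (N \<inter> D) (E v)" "E v x = v" if "v \<in> V" for v
    unfolding E_def using tangent_vector_in_coordinates[OF D, of v] that assms(4)
    by (auto intro: vfield_subset[OF vfield_coord[OF D(1)]])
  then show ?thesis using N D by (intro exI[of _ "N \<inter> D"] exI[of _ E]) (auto intro: mopen_Int mopen_chart)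
qed

context
  fixes N \<alpha> x
  assumes N: "mopen A N" "x \<in> N" and \<alpha>: "smooth_oneform A N \<alpha>"
begin

lemma ext_d_antisym: assumes "v \<in> T x" "w \<in> T x" shows "ext_d A \<alpha> x w v = - ext_d A \<alpha> x v w"
proof -
  obtain N' E where E: "mopen A N'" "x \<in> N'" "N' \<subseteq> N" "\<forall>u\<in>{v, w}. smooth_vfield A N' (E u) \<and> E u x = u"
    using tangent_vectors_extend[OF N, of "{v, w}"] assms by auto
  then show ?thesis
    using ext_d_eq_dform[OF N \<alpha> E(1,2), of "E v" "E w"] ext_d_eq_dform[OF N \<alpha> E(1,2), of "E w" "E v"]
      dform_antisym[OF E(1,2) form_subset[OF \<alpha> E(3)], of "E v" "E w"] by simp
qed

lemma ext_d_add_left: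
  assumes "v \<in> T x" "v' \<in> T x" "w \<in> T x"
  shows "ext_d A \<alpha> x (v + v') w = ext_d A \<alpha> x v w + ext_d A \<alpha> x v' w"
proof -
  obtain N' E where E: "mopen A N'" "x \<in> N'" "N' \<subseteq> N" "\<forall>u\<in>{v, v', w}. smooth_vfield A N' (E u) \<and> E u x = u"
    using tangent_vectors_extend[OF N, of "{v, v', w}"] assms by auto
  then show ?thesis
    using ext_d_eq_dform[OF N \<alpha> E(1,2), of "E v" "E w"] ext_d_eq_dform[OF N \<alpha> E(1,2), of "E v'" "E w"]
      ext_d_eq_dform[OF N \<alpha> E(1,2), of "\<lambda>y. E v y + E v' y" "E w"] vfield_add[of N' "E v" "E v'"]
      dform_add_left[OF E(1,2) form_subset[OF \<alpha> E(3)], of "E v" "E v'" "E w"] by simp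
qed

lemma ext_d_scale_left:
  assumes "v \<in> T x" "w \<in> T x"
  shows "ext_d A \<alpha> x (c *\<^sub>R v) w = c * ext_d A \<alpha> x v w"
proof -
  obtain N' E where E: "mopen A N'" "x \<in> N'" "N' \<subseteq> N" "\<forall>u\<in>{v, w}. smooth_vfield A N' (E u) \<and> E u x = u"
    using tangent_vectors_extend[OF N, of "{v, w}"] assms by auto
  then show ?thesis
    using ext_d_eq_dform[OF N \<alpha> E(1,2), of "E v" "E w"]
      ext_d_eq_dform[OF N \<alpha> E(1,2), of "\<lambda>y. c *\<^sub>R E v y" "E w"] vfield_cscale[of N' "E v"]
      dform_scale_left[OF E(1,2) form_subset[OF \<alpha> E(3)] smooth_fun_const, of "E v" "E w" c] by simp
qed

lemma ext_d_add_right: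
  assumes "v \<in> T x" "w \<in> T x" "w' \<in> T x"
  shows "ext_d A \<alpha> x v (w + w') = ext_d A \<alpha> x v w + ext_d A \<alpha> x v w'"
  using ext_d_antisym[of v "w + w'"] ext_d_antisym[of v w] ext_d_antisym[of v w'] ext_d_add_left[of w w' v]
    assms T_add[of w x w'] by simp

lemma ext_d_scale_right:
  assumes "v \<in> T x" "w \<in> T x"
  shows "ext_d A \<alpha> x v (c *\<^sub>R w) = c * ext_d A \<alpha> x v w"
  using ext_d_antisym[of v "c *\<^sub>R w"] ext_d_antisym[of v w] ext_d_scale_left[of w v c] assms T_scale[of w x c] by simp

lemma ext_d_self: "v \<in> T x \<Longrightarrow> ext_d A \<alpha> x v v = 0"
  using ext_d_antisym[of v v] by simp

end

lemma interior_product_smooth: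
  assumes N: "mopen A N" and \<alpha>: "smooth_oneform A N \<alpha>" and Y: "smooth_vfield A N Y"
  shows "smooth_oneform A N (\<lambda>x v. if v \<in> T x then ext_d A \<alpha> x (Y x) v else 0)"
  unfolding smooth_oneform_def
proof (intro conjI ballI allI impI)
  fix x assume x: "x \<in> N"
  show "(\<lambda>v. if v \<in> T x then ext_d A \<alpha> x (Y x) v else 0) \<in> cotangent_space A x"
    unfolding cotangent_space_def
    using ext_d_add_right[OF N x \<alpha> vfield_T[OF Y x]] ext_d_scale_right[OF N x \<alpha> vfield_T[OF Y x]]
    by (auto simp: T_add T_scale)
next
  fix N' X assume N': "mopen A N' \<and> N' \<subseteq> N \<and> smooth_vfield A N' X"
  have Y': "smooth_vfield A N' Y" using vfield_subset[OF Y] N' by blast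
  have "smooth_fun A N' (\<lambda>x. dform \<alpha> Y X x)"
    unfolding dform_def using N' Y' form_fun[OF \<alpha>] vfield_bracket[of N' Y X]
    by (auto intro!: smooth_fun_diff vfield_fun[OF Y'] vfield_fun[of N' X N'])
  then show "smooth_fun A N' (\<lambda>y. if X y \<in> T y then ext_d A \<alpha> y (Y y) (X y) else 0)"
    using N' N \<alpha> Y' vfield_T[of N' X]
    by (elim smooth_fun_cong[rotated 2]) (auto simp: ext_d_eq_dform[of N])
qed

section \<open>Coefficients with respect to a frame\<close>

text \<open>Gaussian elimination, by induction on the number of fields in the frame. Since \<open>X r\<close> is a nonzero
  derivation at the point, some function \<open>f\<close> has \<open>X r f \<noteq> 0\<close> nearby; subtracting multiples of \<open>X r\<close>
  makes all other fields and \<open>Y\<close> annihilate \<open>f\<close> without changing the remaining coefficients, and the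
  coefficient of \<open>X r\<close> is then read off by applying the expansion of \<open>Y\<close> to \<open>f\<close>.\<close>

lemma frame_coefficients_smooth:
  assumes "finite J" "mopen A N" "\<And>j. j \<in> J \<Longrightarrow> smooth_vfield A N (X j)" "smooth_vfield A N Y"
    and "\<And>x c. x \<in> N \<Longrightarrow> (\<Sum>j\<in>J. c j *\<^sub>R X j x) = 0 \<Longrightarrow> \<forall>j\<in>J. c j = 0"
    and "\<And>x. x \<in> N \<Longrightarrow> Y x = (\<Sum>j\<in>J. a j x *\<^sub>R X j x)"
    and "i \<in> J"
  shows "smooth_fun A N (a i)"
  using assms
proof (induction J arbitrary: N X Y i rule: finite_induct)
  case (insert r J)
  note X = insert.prems(2) and Y = insert.prems(3) and indep = insert.prems(4) and Yeq = insert.prems(5)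
  show ?case
  proof (rule smooth_fun_local)
    fix x assume x: "x \<in> N"
    have "X r x \<noteq> 0"
    proof
      assume "X r x = 0"
      then have "(\<Sum>j\<in>insert r J. (if j = r then 1 else 0) *\<^sub>R X j x) = 0"
        by (intro sum.neutral) auto
      from indep[OF x this] show False by auto
    qed
    then obtain f where f: "X r x f \<noteq> 0" by (auto simp: fun_eq_iff)
    then have "smooth_at A x f" using tv_not_smooth[OF vfield_T[OF X x]] by auto
    then obtain N1 where N1: "mopen A N1" "x \<in> N1" "smooth_fun A N1 f" by (auto simp: smooth_at_def)
    define N2 where "N2 = {y \<in> N \<inter> N1. X r y f \<noteq> 0}"
    have o1: "mopen A (N \<inter> N1)" using N1 insert.prems(1) by (intro mopen_Int)
    have f1: "smooth_fun A (N \<inter> N1) (\<lambda>y. X r y f)"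
      using N1 o1 X by (intro vfield_fun[of N "X r"]) (auto intro: smooth_fun_subset)
    have N2: "mopen A N2" "x \<in> N2" "N2 \<subseteq> N" "N2 \<subseteq> N1" "\<And>y. y \<in> N2 \<Longrightarrow> X r y f \<noteq> 0"
      using mopen_nonzero[OF o1 f1] x N1 f by (auto simp: N2_def)
    have fN2: "smooth_fun A N2 f" using smooth_fun_subset[OF N1(3) N2(4)] .
    have Zf: "smooth_fun A N2 (\<lambda>y. Z y f)" if "smooth_vfield A N Z" for Z
      using that N2 fN2 by (intro vfield_fun[of N Z])
    (* The elimination step: X' and Y' annihilate f on N2. *)
    define X' where "X' j y = X j y - (X j y f / X r y f) *\<^sub>R X r y" for j y
    define Y' where "Y' y = Y y - (Y y f / X r y f) *\<^sub>R X r y" for y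
    have quot: "smooth_fun A N2 (\<lambda>y. Z y f / X r y f)" if "smooth_vfield A N Z" for Z
      using that X N2 by (intro smooth_fun_divide Zf) auto
    have X': "smooth_vfield A N2 (X' j)" if "j \<in> J" for j
      unfolding X'_def using that X N2(3)
      by (intro vfield_diff vfield_scale quot) (auto intro: vfield_subset)
    have Y': "smooth_vfield A N2 Y'"
      unfolding Y'_def using X Y N2(3)
      by (intro vfield_diff vfield_scale quot) (auto intro: vfield_subset)
    have indep': "\<forall>j\<in>J. c j = 0" if y: "y \<in> N2" and 0: "(\<Sum>j\<in>J. c j *\<^sub>R X' j y) = 0" for y c
    proof -
      define d where "d j = (if j = r then - (\<Sum>j\<in>J. c j * (X j y f / X r y f)) else c j)" for j
      have "(\<Sum>j\<in>J. d j *\<^sub>R X j y) = (\<Sum>j\<in>J. c j *\<^sub>R X j y)"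
        using insert.hyps by (intro sum.cong) (auto simp: d_def)
      moreover have "(\<Sum>j\<in>J. c j *\<^sub>R X' j y)
          = (\<Sum>j\<in>J. c j *\<^sub>R X j y) - (\<Sum>j\<in>J. c j * (X j y f / X r y f)) *\<^sub>R X r y"
        by (simp add: X'_def scaleR_diff_right sum_subtractf scaleR_sum_left)
      ultimately have "(\<Sum>j\<in>insert r J. d j *\<^sub>R X j y) = 0"
        using insert.hyps 0 by (simp add: d_def)
      from indep[OF _ this] y N2(3) have "\<forall>j\<in>insert r J. d j = 0" by blast
      then show ?thesis using insert.hyps by (auto simp: d_def split: if_splits)
    qed
    have Yf: "Y y f = (\<Sum>j\<in>J. a j y * X j y f) + a r y * X r y f" if "y \<in> N2" for y
      using Yeq[of y] that N2(3) insert.hyps by (auto simp: sum_fun_apply scaleR_fun_apply)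
    have Yeq': "Y' y = (\<Sum>j\<in>J. a j y *\<^sub>R X' j y)" if y: "y \<in> N2" for y
    proof -
      have "(Y y f / X r y f) *\<^sub>R X r y = (\<Sum>j\<in>J. (a j y * (X j y f / X r y f)) *\<^sub>R X r y) + a r y *\<^sub>R X r y"
        using N2(5)[OF y] by (simp add: Yf[OF y] add_divide_distrib scaleR_add_left sum_divide_distrib scaleR_sum_left)
      moreover have "Y y = a r y *\<^sub>R X r y + (\<Sum>j\<in>J. a j y *\<^sub>R X j y)"
        using Yeq[of y] y N2(3) sum.insert[OF insert.hyps, of "\<lambda>j. a j y *\<^sub>R X j y"] by (metis subsetD)
      ultimately have "Y' y = (\<Sum>j\<in>J. a j y *\<^sub>R X j y) - (\<Sum>j\<in>J. (a j y * (X j y f / X r y f)) *\<^sub>R X r y)"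
        unfolding Y'_def by (simp only: add_diff_add diff_self add_0_left add.commute[of _ "a r y *\<^sub>R X r y"])
      then show ?thesis
        by (simp only: X'_def scaleR_diff_right sum_subtractf scaleR_scaleR)
    qed
    have aJ: "smooth_fun A N2 (a j)" if "j \<in> J" for j
      by (rule insert.IH[OF N2(1) X' Y' indep' Yeq' that])
    have ar: "smooth_fun A N2 (a r)"
    proof (rule smooth_fun_cong[OF N2(1)])
      show "smooth_fun A N2 (\<lambda>y. (Y y f - (\<Sum>j\<in>J. a j y * X j y f)) / X r y f)"
        using N2(1,5) X by (intro smooth_fun_divide smooth_fun_diff smooth_fun_sum Zf[OF Y] Zf[OF X]
            smooth_fun_mult[OF N2(1) aJ Zf[OF X]]) auto
    qed (use Yf N2(5) in auto)
    show "\<exists>N'. mopen A N' \<and> x \<in> N' \<and> smooth_fun A N' (a i)"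
      using N2 aJ ar insert.prems(6) by (intro exI[of _ N2]) auto
  qed
qed simp

end

section \<open>The smooth structure of the projectivization\<close>

text \<open>The trivialization \<open>(t, y) \<mapsto> t h\<^sub>0(x) + h(x)(y)\<close> of \<open>H\<close>, as a function of the pair. The point \<open>y\<close> of
  an affine chart of the projectivization stands for the line spanned by the image of \<open>(1, y)\<close>.\<close>

definition frame_map :: "('m \<Rightarrow> 'm tvec) \<Rightarrow> ('m \<Rightarrow> 'f::real_vector \<Rightarrow> 'm tvec) \<Rightarrow> 'm \<Rightarrow> real \<times> 'f \<Rightarrow> 'm tvec" where
  "frame_map h\<^sub>0 h x z = fst z *\<^sub>R h\<^sub>0 x + h x (snd z)"

text \<open>The defining condition of \<open>proj_atlas\<close>, with the base chart and the local frame made explicit.\<close>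

definition is_proj_chart ::
    "('m, 'e::euclidean_space) atlas \<Rightarrow> ('m \<Rightarrow> 'm tvec set) \<Rightarrow> 'm set \<Rightarrow> ('m \<Rightarrow> 'e) \<Rightarrow> 'm set \<Rightarrow>
     ('m \<Rightarrow> 'm tvec) \<Rightarrow> ('m \<Rightarrow> 'f::euclidean_space \<Rightarrow> 'm tvec) \<Rightarrow> 'm line set \<Rightarrow> ('m line \<Rightarrow> 'e \<times> 'f) \<Rightarrow> bool" where
  "is_proj_chart A H D \<phi> N h\<^sub>0 h D' \<psi> \<longleftrightarrow>
     (D, \<phi>) \<in> A \<and> mopen A N \<and> N \<subseteq> D \<and>
     smooth_vfield A N h\<^sub>0 \<and> (\<forall>y. smooth_vfield A N (\<lambda>x. h x y)) \<and>
     (\<forall>x\<in>N. linear (h x) \<and> bij_betw (\<lambda>(t, y). t *\<^sub>R h\<^sub>0 x + h x y) UNIV (H x)) \<and>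
     D' = {(x, L) \<in> proj_H A H. x \<in> N \<and> (\<exists>y. L = span {h\<^sub>0 x + h x y})} \<and>
     (\<forall>x\<in>N. \<forall>y. \<psi> (x, span {h\<^sub>0 x + h x y}) = (\<phi> x, y))"

lemma mem_proj_atlas_iff:
  "(D', \<psi>) \<in> proj_atlas A H \<longleftrightarrow> (\<exists>D \<phi> N h\<^sub>0 h. is_proj_chart A H D \<phi> N h\<^sub>0 h D' \<psi>)"
  by (simp add: proj_atlas_def is_proj_chart_def)

lemma span_singleton_eqD:
  fixes v w :: "'a::real_vector"
  assumes "span {v} = span {w}" "v \<noteq> 0"
  obtains s where "s \<noteq> 0" "v = s *\<^sub>R w"
proof -
  have "v \<in> span {w}" using assms(1) span_base[of v "{v}"] by simp
  then obtain s where "v = s *\<^sub>R w" by (auto simp: span_singleton)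
  then show ?thesis using assms(2) that[of s] by auto
qed

lemma span_singleton_scale:
  fixes v :: "'a::real_vector"
  assumes "s \<noteq> 0"
  shows "span {s *\<^sub>R v} = span {v}"
proof -
  have "\<exists>t. k *\<^sub>R v = t *\<^sub>R s *\<^sub>R v" for k using assms by (intro exI[of _ "k / s"]) simp
  then show ?thesis by (fastforce simp: span_singleton)
qed

locale proj_chart_data = manifold_atlas A
  for A :: "('m, 'e::euclidean_space) atlas" +
  fixes H :: "'m \<Rightarrow> 'm tvec set" and D :: "'m set" and \<phi> :: "'m \<Rightarrow> 'e" and N :: "'m set"
    and h\<^sub>0 :: "'m \<Rightarrow> 'm tvec" and h :: "'m \<Rightarrow> 'f::euclidean_space \<Rightarrow> 'm tvec"
    and D' :: "'m line set" and \<psi> :: "'m line \<Rightarrow> 'e \<times> 'f"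
  assumes proj_chart: "is_proj_chart A H D \<phi> N h\<^sub>0 h D' \<psi>"
begin

abbreviation F :: "'m \<Rightarrow> real \<times> 'f \<Rightarrow> 'm tvec" where "F \<equiv> frame_map h\<^sub>0 h"

lemma base_chart: "(D, \<phi>) \<in> A" "mopen A N" "N \<subseteq> D"
  using proj_chart by (auto simp: is_proj_chart_def)

lemma frame_smooth: "smooth_vfield A N (\<lambda>x. F x z)"
  using proj_chart by (auto simp: is_proj_chart_def frame_map_def intro!: vfield_add vfield_cscale)

lemma frame_linear: "x \<in> N \<Longrightarrow> linear (F x)"
  using proj_chart
  by (auto simp: is_proj_chart_def frame_map_def[abs_def] linear_iff scaleR_add_left scaleR_add_right)

lemma frame_bij: "x \<in> N \<Longrightarrow> bij_betw (F x) UNIV (H x)"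
  using proj_chart by (simp add: is_proj_chart_def frame_map_def[abs_def] case_prod_beta')

lemma frame_mem: "x \<in> N \<Longrightarrow> F x z \<in> H x"
  using frame_bij by (auto simp: bij_betw_def)

lemma frame_surj: assumes "x \<in> N" "v \<in> H x" obtains z where "v = F x z"
  using frame_bij[OF assms(1)] assms(2) that unfolding bij_betw_def by blast

lemma frame_inj: "x \<in> N \<Longrightarrow> F x z = F x z' \<longleftrightarrow> z = z'"
  using frame_bij[of x] by (metis bij_betw_def inj_eq)

lemma frame_zero_iff: "x \<in> N \<Longrightarrow> F x z = 0 \<longleftrightarrow> z = 0"
  using frame_inj[of x z 0] linear_0[OF frame_linear] by simp

lemma frame_scale: "x \<in> N \<Longrightarrow> F x (c *\<^sub>R z) = c *\<^sub>R F x z"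
  by (intro linear_scale frame_linear)

lemma H_subspace: "x \<in> N \<Longrightarrow> subspace (H x)"
  using linear_subspace_image[OF frame_linear subspace_UNIV, of x] frame_bij[of x] by (simp add: bij_betw_def)

lemma H_subset_T: assumes "x \<in> N" shows "H x \<subseteq> T x"
  using frame_surj[OF assms] vfield_T[OF frame_smooth assms] by blast

lemma frame_expand:
  assumes "x \<in> N" shows "F x z = (\<Sum>j\<in>Basis. (z \<bullet> j) *\<^sub>R F x j)"
proof -
  have "F x z = F x (\<Sum>j\<in>Basis. (z \<bullet> j) *\<^sub>R j)" by (simp add: euclidean_representation)
  then show ?thesis by (simp only: linear_sum[OF frame_linear[OF assms]] linear_scale[OF frame_linear[OF assms]])
qed

text \<open>Every vector \<open>h\<^sub>0 + h(y)\<close> is nonzero, as \<open>h\<^sub>0\<close> is transverse to the image of \<open>h\<close>, so each \<open>y\<close> gives a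
  point of the projectivization.\<close>

lemma domain_eq: "D' = {(x, span {F x (1, y)}) | x y. x \<in> N}"
proof -
  have "(x, span {F x (1, y)}) \<in> proj_H A H" if x: "x \<in> N" for x y
  proof -
    have nz: "F x (1, y) \<noteq> 0" using frame_zero_iff[OF x] by (simp add: zero_prod_def)
    have "span {F x (1, y)} \<subseteq> H x"
      using span_minimal[of "{F x (1, y)}" "H x"] frame_mem[OF x] H_subspace[OF x] by simp
    moreover have "dim (span {F x (1, y)}) = 1"
      using nz dim_eq_card_independent[of "{F x (1, y)}"] by (simp add: dim_span)
    moreover have "x \<in> points A" using x base_chart(2) by (auto simp: mopen_def)
    ultimately show ?thesis by (simp add: proj_H_def)
  qed
  then show ?thesis using proj_chart by (auto simp: is_proj_chart_def frame_map_def)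
qed

lemma domainE:
  assumes "p \<in> D'" obtains y where "fst p \<in> N" "snd p = span {F (fst p) (1, y)}" "\<psi> p = (\<phi> (fst p), y)"
proof -
  obtain x y where xy: "p = (x, span {F x (1, y)})" "x \<in> N" using assms by (auto simp: domain_eq)
  then have "\<psi> p = (\<phi> x, y)" using proj_chart by (simp add: is_proj_chart_def frame_map_def)
  then show ?thesis using that xy by simp
qed

lemma domainI: "x \<in> N \<Longrightarrow> (x, span {F x (1, y)}) \<in> D'"
  by (auto simp: domain_eq)

lemma chart_apply: "x \<in> N \<Longrightarrow> \<psi> (x, span {F x (1, y)}) = (\<phi> x, y)"
  using proj_chart by (auto simp: is_proj_chart_def frame_map_def)

lemma line_eq:
  assumes "p \<in> D'" shows "p = (fst p, span {F (fst p) (1, snd (\<psi> p))})" "fst p \<in> N" "fst (\<psi> p) = \<phi> (fst p)"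
  using domainE[OF assms] by (metis prod.collapse fst_conv snd_conv)+

lemma chart_inj: "inj_on \<psi> D'"
proof (rule inj_onI)
  fix p q assume pq: "p \<in> D'" "q \<in> D'" "\<psi> p = \<psi> q"
  have "\<phi> (fst p) = \<phi> (fst q)" using line_eq(3)[OF pq(1)] line_eq(3)[OF pq(2)] pq(3) by simp
  then have "fst p = fst q"
    using manifold_atlas.chart_inj[OF manifold_atlas_axioms base_chart(1)] line_eq(2) pq base_chart(3)
    by (auto simp: inj_on_def subset_iff)
  then show "p = q" using line_eq(1)[OF pq(1)] line_eq(1)[OF pq(2)] pq(3) by metis
qed

lemma chart_inverse_apply:
  assumes "u \<in> \<phi> ` N"
  shows "the_inv_into D' \<psi> (u, y) = (the_inv_into D \<phi> u, span {F (the_inv_into D \<phi> u) (1, y)})"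
proof -
  obtain x where x: "x \<in> N" "u = \<phi> x" using assms by auto
  then have "the_inv_into D \<phi> u = x" using chart_inverse[OF base_chart(1)] base_chart(3) by auto
  moreover have "the_inv_into D' \<psi> (\<psi> (x, span {F x (1, y)})) = (x, span {F x (1, y)})"
    by (rule the_inv_into_f_f[OF chart_inj domainI[OF x(1)]])
  ultimately show ?thesis using x chart_apply by simp
qed

lemma image_restrict: "\<psi> ` {p \<in> D'. fst p \<in> M} = \<phi> ` (M \<inter> N) \<times> UNIV"
proof (intro equalityI subsetI)
  fix w assume "w \<in> \<psi> ` {p \<in> D'. fst p \<in> M}"
  then obtain p where p: "p \<in> D'" "fst p \<in> M" "w = \<psi> p" by blast
  then show "w \<in> \<phi> ` (M \<inter> N) \<times> UNIV"
    using line_eq(2,3)[OF p(1)] by (intro SigmaI[of "fst w" _ "snd w", simplified]) auto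
next
  fix w assume "w \<in> \<phi> ` (M \<inter> N) \<times> (UNIV :: 'f set)"
  then obtain x where x: "x \<in> M" "x \<in> N" "w = (\<phi> x, snd w)" by (auto simp: prod_eq_iff)
  then have "w = \<psi> (x, span {F x (1, snd w)})" using chart_apply by simp
  moreover have "(x, span {F x (1, snd w)}) \<in> {p \<in> D'. fst p \<in> M}" using x domainI by simp
  ultimately show "w \<in> \<psi> ` {p \<in> D'. fst p \<in> M}" by (rule image_eqI)
qed

lemma image_domain: "\<psi> ` D' = \<phi> ` N \<times> UNIV"
  using image_restrict[of UNIV] by simp

lemma open_image_restrict: "mopen A M \<Longrightarrow> open (\<phi> ` (M \<inter> N) \<times> (UNIV :: 'f set))"
  using mopen_image_open[OF mopen_Int[OF _ base_chart(2), of M] base_chart(1)] base_chart(3)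
  by (intro open_Times) (auto simp: Int_absorb2 Int_assoc)

lemma smooth_on_base_coordinate:
  assumes "mopen A M" "smooth_fun A M f"
  shows "smooth_on (\<phi> ` (M \<inter> N) \<times> (UNIV :: 'f set)) (\<lambda>w. f (the_inv_into D \<phi> (fst w)))"
proof (rule smooth_on_compose[OF open_image_restrict[OF assms(1)], of fst "\<phi> ` (M \<inter> N)"])
  show "smooth_on (\<phi> ` (M \<inter> N) \<times> (UNIV :: 'f set)) fst"
    using smooth_on_linear_compose[OF bounded_linear_fst open_image_restrict[OF assms(1)] smooth_on_id] .
  show "smooth_on (\<phi> ` (M \<inter> N)) (\<lambda>u. f (the_inv_into D \<phi> u))"
    by (rule smooth_on_subset[OF smooth_fun_on_chart[OF assms(2) base_chart(1)]]) (use base_chart in auto)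
qed auto

end

locale proj_chart_pair =
  P: proj_chart_data A H D \<phi> N h\<^sub>0 h D' \<psi> + R: proj_chart_data A H E \<xi> M k\<^sub>0 k E' \<omega>
  for A :: "('m, 'e::euclidean_space) atlas" and H
    and D \<phi> N h\<^sub>0 and h :: "'m \<Rightarrow> 'f::euclidean_space \<Rightarrow> 'm tvec" and D' \<psi>
    and E \<xi> M k\<^sub>0 and k :: "'m \<Rightarrow> 'f \<Rightarrow> 'm tvec" and E' \<omega>
begin

text \<open>The transition matrix between two local frames of \<open>H\<close>, as a linear map of the model fibre.\<close>

definition change :: "'m \<Rightarrow> real \<times> 'f \<Rightarrow> real \<times> 'f" where
  "change x z = inv (R.F x) (P.F x z)"

lemma change_eq: assumes "x \<in> N" "x \<in> M" shows "R.F x (change x z) = P.F x z"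
proof -
  have "P.F x z \<in> range (R.F x)" using P.frame_mem[OF assms(1)] R.frame_bij[OF assms(2)] by (simp add: bij_betw_def)
  then show ?thesis unfolding change_def by (rule f_inv_into_f)
qed

lemma change_eqI: "x \<in> N \<Longrightarrow> x \<in> M \<Longrightarrow> R.F x w = P.F x z \<Longrightarrow> change x z = w"
  using change_eq R.frame_inj by metis

lemma change_linear: assumes "x \<in> N" "x \<in> M" shows "linear (change x)"
proof (rule linearI)
  show "change x (z + w) = change x z + change x w" for z w
    by (rule change_eqI[OF assms])
      (simp only: linear_add[OF R.frame_linear[OF assms(2)]] linear_add[OF P.frame_linear[OF assms(1)]] change_eq[OF assms])
  show "change x (c *\<^sub>R z) = c *\<^sub>R change x z" for c z
    by (rule change_eqI[OF assms])
      (simp only: P.frame_scale[OF assms(1)] R.frame_scale[OF assms(2)] change_eq[OF assms])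
qed

lemma open_overlap: "mopen A (M \<inter> N)"
  by (intro P.mopen_Int P.base_chart R.base_chart)

text \<open>The entries of the transition matrix are the coefficients of one frame with respect to the other.\<close>

lemma change_smooth:
  assumes "j \<in> Basis" shows "smooth_fun A (M \<inter> N) (\<lambda>x. change x z \<bullet> j)"
proof (rule P.frame_coefficients_smooth[of Basis "M \<inter> N" "\<lambda>j x. R.F x j" "\<lambda>x. P.F x z" "\<lambda>j x. change x z \<bullet> j"])
  show "smooth_vfield A (M \<inter> N) (\<lambda>x. R.F x j)" for j
    by (rule P.vfield_subset[OF R.frame_smooth]) auto
  show "smooth_vfield A (M \<inter> N) (\<lambda>x. P.F x z)"
    by (rule P.vfield_subset[OF P.frame_smooth]) auto
  show "P.F x z = (\<Sum>j\<in>Basis. (change x z \<bullet> j) *\<^sub>R R.F x j)" if "x \<in> M \<inter> N" for x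
    using that change_eq[of x z] R.frame_expand[of x "change x z"] by simp
  show "\<forall>j\<in>Basis. c j = 0" if x: "x \<in> M \<inter> N" and 0: "(\<Sum>j\<in>Basis. c j *\<^sub>R R.F x j) = 0" for x and c :: "real \<times> 'f \<Rightarrow> real"
  proof -
    have lin: "linear (R.F x)" using x R.frame_linear by blast
    have "R.F x (\<Sum>j\<in>Basis. c j *\<^sub>R j) = 0" using 0 by (simp only: linear_sum[OF lin] linear_scale[OF lin])
    then have "(\<Sum>j\<in>Basis. c j *\<^sub>R j) = 0" using x R.frame_zero_iff by blast
    then show ?thesis by (metis inner_sum_left_Basis inner_zero_left)
  qed
qed (use assms open_overlap in auto)

lemma overlap_iff:
  assumes x: "x \<in> N"
  shows "(x, span {P.F x (1, y)}) \<in> E' \<longleftrightarrow> x \<in> M \<and> fst (change x (1, y)) \<noteq> 0"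
proof (intro iffI)
  assume "(x, span {P.F x (1, y)}) \<in> E'"
  then obtain y' where y': "x \<in> M" "span {P.F x (1, y)} = span {R.F x (1, y')}" by (auto elim: R.domainE)
  have "P.F x (1, y) \<noteq> 0" using P.frame_zero_iff[OF x] by (simp add: zero_prod_def)
  from span_singleton_eqD[OF y'(2) this] obtain s where s: "s \<noteq> 0" "P.F x (1, y) = s *\<^sub>R R.F x (1, y')" .
  then have "change x (1, y) = s *\<^sub>R (1, y')" using y' x R.frame_scale[OF y'(1), of s "(1, y')"] by (intro change_eqI) simp_all
  then show "x \<in> M \<and> fst (change x (1, y)) \<noteq> 0" using y' s by simp
next
  assume "x \<in> M \<and> fst (change x (1, y)) \<noteq> 0"
  then have M: "x \<in> M" and c: "fst (change x (1, y)) \<noteq> 0" by auto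
  let ?c = "fst (change x (1, y))" and ?e = "snd (change x (1, y))"
  have "change x (1, y) = ?c *\<^sub>R (1, inverse ?c *\<^sub>R ?e)" using c by (simp add: prod_eq_iff)
  then have "P.F x (1, y) = ?c *\<^sub>R R.F x (1, inverse ?c *\<^sub>R ?e)"
    using change_eq[OF x M] R.frame_scale[OF M] by metis
  then have "span {P.F x (1, y)} = span {R.F x (1, inverse ?c *\<^sub>R ?e)}" using span_singleton_scale[OF c] by metis
  then show "(x, span {P.F x (1, y)}) \<in> E'" using R.domainI[OF M] by simp
qed

text \<open>Homogeneous coordinates are normalized by dividing by the first one.\<close>

lemma transition_apply:
  assumes x: "x \<in> N" "x \<in> M" and c: "fst (change x (1, y)) \<noteq> 0"
  shows "\<omega> (x, span {P.F x (1, y)}) = (\<xi> x, inverse (fst (change x (1, y))) *\<^sub>R snd (change x (1, y)))"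
proof -
  let ?c = "fst (change x (1, y))" and ?e = "snd (change x (1, y))"
  have "change x (1, y) = ?c *\<^sub>R (1, inverse ?c *\<^sub>R ?e)" using c by (simp add: prod_eq_iff)
  then have "P.F x (1, y) = ?c *\<^sub>R R.F x (1, inverse ?c *\<^sub>R ?e)"
    using change_eq[OF x] R.frame_scale[OF x(2)] by metis
  then have "span {P.F x (1, y)} = span {R.F x (1, inverse ?c *\<^sub>R ?e)}" using span_singleton_scale[OF c] by metis
  then show ?thesis using R.chart_apply[OF x(2)] by simp
qed

abbreviation overlap :: "('e \<times> 'f) set" where "overlap \<equiv> \<phi> ` (M \<inter> N) \<times> UNIV"

lemma open_overlap_coordinates: "open overlap"
  by (rule P.open_image_restrict[OF R.base_chart(2)])

lemma change_coordinate_smooth: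
  assumes j: "j \<in> Basis"
  shows "smooth_on overlap (\<lambda>w. change (the_inv_into D \<phi> (fst w)) (1, snd w) \<bullet> j)"
proof -
  note op = open_overlap_coordinates
  have "smooth_on overlap (\<lambda>w. \<Sum>i\<in>Basis. ((1, snd w) \<bullet> i) * (change (the_inv_into D \<phi> (fst w)) i \<bullet> j))"
  proof (intro smooth_on_sum smooth_on_mult op)
    fix i :: "real \<times> 'f"
    have "smooth_on overlap (\<lambda>w. fst i + snd w \<bullet> snd i)"
      by (intro smooth_on_add smooth_on_const op smooth_on_linear_compose[OF _ op smooth_on_id]
          bounded_linear_inner_left_comp bounded_linear_snd)
    then show "smooth_on overlap (\<lambda>w. (1, snd w) \<bullet> i)" by (simp add: inner_prod_def)
    have "smooth_on (\<phi> ` ((M \<inter> N) \<inter> N) \<times> (UNIV :: 'f set)) (\<lambda>w. change (the_inv_into D \<phi> (fst w)) i \<bullet> j)"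
      by (rule P.smooth_on_base_coordinate[OF open_overlap change_smooth[OF j, of i]])
    then show "smooth_on overlap (\<lambda>w. change (the_inv_into D \<phi> (fst w)) i \<bullet> j)" by (simp add: Int_assoc)
  qed
  moreover have "(\<Sum>i\<in>Basis. ((1, snd w) \<bullet> i) * (change (the_inv_into D \<phi> (fst w)) i \<bullet> j))
      = change (the_inv_into D \<phi> (fst w)) (1, snd w) \<bullet> j" if w: "w \<in> overlap" for w
  proof -
    obtain x where x: "x \<in> M" "x \<in> N" "fst w = \<phi> x" using w by auto
    then have ix: "the_inv_into D \<phi> (fst w) = x" using P.chart_inverse[OF P.base_chart(1)] P.base_chart(3) by auto
    note lin = change_linear[OF x(2,1)]
    have "change x (1, snd w) = change x (\<Sum>i\<in>Basis. ((1, snd w) \<bullet> i) *\<^sub>R i)" by (simp only: euclidean_representation)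
    then show ?thesis unfolding ix by (simp only: linear_sum[OF lin] linear_scale[OF lin] inner_sum_left inner_scaleR_left)
  qed
  ultimately show ?thesis by (rule smooth_on_cong[OF op, rotated])
qed

lemma change_fst_smooth: "smooth_on overlap (\<lambda>w. fst (change (the_inv_into D \<phi> (fst w)) (1, snd w)))"
  using change_coordinate_smooth[of "(1, 0)"] by (simp add: Basis_prod_def inner_prod_def)

lemma image_overlap:
  "\<psi> ` (D' \<inter> E') = {w \<in> overlap. fst (change (the_inv_into D \<phi> (fst w)) (1, snd w)) \<noteq> 0}" (is "_ = ?R")
proof (intro equalityI subsetI)
  fix w assume "w \<in> \<psi> ` (D' \<inter> E')"
  then obtain p where p: "p \<in> D'" "p \<in> E'" "w = \<psi> p" by auto
  obtain y where y: "fst p \<in> N" "snd p = span {P.F (fst p) (1, y)}" "\<psi> p = (\<phi> (fst p), y)"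
    using P.domainE[OF p(1)] .
  have "(fst p, span {P.F (fst p) (1, y)}) \<in> E'" using p y by (metis prod.collapse)
  then show "w \<in> ?R"
    using overlap_iff[OF y(1)] y p P.chart_inverse[OF P.base_chart(1)] P.base_chart(3) by auto
next
  fix w assume w: "w \<in> ?R"
  then obtain x where x: "x \<in> M" "x \<in> N" "fst w = \<phi> x" by auto
  then have "the_inv_into D \<phi> (fst w) = x" using P.chart_inverse[OF P.base_chart(1)] P.base_chart(3) by auto
  then have "(x, span {P.F x (1, snd w)}) \<in> D' \<inter> E'" using w x overlap_iff[OF x(2)] P.domainI by auto
  moreover have "w = \<psi> (x, span {P.F x (1, snd w)})" using P.chart_apply[OF x(2)] x by (simp add: prod_eq_iff)
  ultimately show "w \<in> \<psi> ` (D' \<inter> E')" by blast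
qed

lemma open_image_overlap: "open (\<psi> ` (D' \<inter> E'))"
proof -
  have "open (overlap \<inter> (\<lambda>w. fst (change (the_inv_into D \<phi> (fst w)) (1, snd w))) -` (- {0}))"
    by (intro continuous_open_preimage smooth_on_continuous change_fst_smooth open_overlap_coordinates) auto
  also have "overlap \<inter> (\<lambda>w. fst (change (the_inv_into D \<phi> (fst w)) (1, snd w))) -` (- {0}) = \<psi> ` (D' \<inter> E')"
    unfolding image_overlap by auto
  finally show ?thesis .
qed

lemma transition_smooth: "smooth_on (\<psi> ` (D' \<inter> E')) (\<omega> \<circ> the_inv_into D' \<psi>)"
proof -
  let ?O = "\<psi> ` (D' \<inter> E')"
  let ?x = "\<lambda>w. the_inv_into D \<phi> (fst w)"
  let ?c = "\<lambda>w. change (?x w) (1, snd w)"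
  have sub: "?O \<subseteq> overlap" unfolding image_overlap by auto
  have "smooth_on ?O (\<lambda>w. (\<xi> (?x w), inverse (fst (?c w)) *\<^sub>R snd (?c w)))"
  proof (rule smooth_on_componentwise[OF open_image_overlap])
    fix b :: "'e \<times> 'f" assume b: "b \<in> Basis"
    have "smooth_fun A (M \<inter> N) (\<lambda>x. \<xi> x \<bullet> fst b)"
      using P.smooth_fun_subset[OF P.smooth_fun_coord[OF R.base_chart(1)]] R.base_chart(3) by blast
    from P.smooth_on_base_coordinate[OF open_overlap this]
    have 1: "smooth_on ?O (\<lambda>w. \<xi> (?x w) \<bullet> fst b)"
      by (rule smooth_on_subset) (use sub in \<open>simp add: Int_assoc\<close>)
    have "smooth_on ?O (\<lambda>w. snd (?c w) \<bullet> snd b)"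
    proof (cases "snd b = 0")
      case False
      then have "(0, snd b) \<in> Basis" using b by (auto simp: Basis_prod_def)
      from smooth_on_subset[OF change_coordinate_smooth[OF this] sub] show ?thesis by (simp add: inner_prod_def)
    qed (simp add: smooth_on_const)
    moreover have "smooth_on ?O (\<lambda>w. inverse (fst (?c w)))"
    proof (rule smooth_on_inverse[OF open_image_overlap smooth_on_subset[OF change_fst_smooth sub]])
      show "fst (?c w) \<noteq> 0" if "w \<in> ?O" for w using that unfolding image_overlap by simp
    qed
    ultimately show "smooth_on ?O (\<lambda>w. (\<xi> (?x w), inverse (fst (?c w)) *\<^sub>R snd (?c w)) \<bullet> b)"
      using 1 by (simp add: inner_prod_def smooth_on_add smooth_on_mult open_image_overlap)
  qed
  then show ?thesis
  proof (rule smooth_on_cong[OF open_image_overlap, rotated])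
    fix w assume "w \<in> ?O"
    then have w: "w \<in> overlap" "fst (?c w) \<noteq> 0" unfolding image_overlap by auto
    then obtain x where x: "x \<in> M" "x \<in> N" "fst w = \<phi> x" by auto
    then have "?x w = x" using P.chart_inverse[OF P.base_chart(1)] P.base_chart(3) by auto
    then have "the_inv_into D' \<psi> w = (x, span {P.F x (1, snd w)})"
      using P.chart_inverse_apply[of "fst w" "snd w"] x \<open>?x w = x\<close> by (metis image_eqI prod.collapse)
    then show "(\<xi> (?x w), inverse (fst (?c w)) *\<^sub>R snd (?c w)) = (\<omega> \<circ> the_inv_into D' \<psi>) w"
      using transition_apply[OF x(2,1), of "snd w"] w \<open>?x w = x\<close> by simp
  qed
qed

end

context manifold_atlas
begin

lemma proj_chart_dataI:
  "is_proj_chart A H D \<phi> N h\<^sub>0 h D' \<psi> \<Longrightarrow> proj_chart_data A H D \<phi> N h\<^sub>0 h D' \<psi>"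
  by unfold_locales

lemma smooth_atlas_proj_atlas: "smooth_atlas (proj_atlas A H :: ('p line, 'e \<times> 'f::euclidean_space) atlas)"
proof -
  have "inj_on \<psi> D' \<and> open (\<psi> ` D')" if D': "(D', \<psi>) \<in> (proj_atlas A H :: ('p line, 'e \<times> 'f) atlas)" for D' \<psi>
  proof -
    obtain D \<phi> N h\<^sub>0 h where "is_proj_chart A H D \<phi> N h\<^sub>0 h D' \<psi>"
      using D' unfolding mem_proj_atlas_iff by blast
    then interpret proj_chart_data A H D \<phi> N h\<^sub>0 h D' \<psi> by (rule proj_chart_dataI)
    show ?thesis using chart_inj image_domain open_image_restrict[OF base_chart(2)] by simp
  qed
  moreover have "open (\<psi> ` (D' \<inter> E')) \<and> smooth_on (\<psi> ` (D' \<inter> E')) (\<omega> \<circ> the_inv_into D' \<psi>)"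
    if D': "(D', \<psi>) \<in> (proj_atlas A H :: ('p line, 'e \<times> 'f) atlas)"
      and E': "(E', \<omega>) \<in> (proj_atlas A H :: ('p line, 'e \<times> 'f) atlas)"
    for D' \<psi> E' \<omega>
  proof -
    obtain D \<phi> N h\<^sub>0 h where "is_proj_chart A H D \<phi> N h\<^sub>0 h D' \<psi>"
      using D' unfolding mem_proj_atlas_iff by blast
    then interpret P: proj_chart_data A H D \<phi> N h\<^sub>0 h D' \<psi> by (rule proj_chart_dataI)
    obtain E \<xi> M k\<^sub>0 k where "is_proj_chart A H E \<xi> M k\<^sub>0 k E' \<omega>"
      using E' unfolding mem_proj_atlas_iff by blast
    then interpret R: proj_chart_data A H E \<xi> M k\<^sub>0 k E' \<omega> by (rule proj_chart_dataI)
    interpret proj_chart_pair A H D \<phi> N h\<^sub>0 h D' \<psi> E \<xi> M k\<^sub>0 k E' \<omega> by unfold_locales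
    show ?thesis using open_image_overlap transition_smooth by blast
  qed
  ultimately show ?thesis unfolding smooth_atlas_def by fast
qed

end

section \<open>The projection to the contact manifold\<close>

lemma pushforward_add: "pushforward A f x (v + w) = pushforward A f x v + pushforward A f x w"
  by (auto simp: pushforward_def fun_eq_iff)

lemma pushforward_scale: "pushforward A f x (c *\<^sub>R v) = c *\<^sub>R pushforward A f x v"
  by (auto simp: pushforward_def fun_eq_iff scaleR_fun_apply)

lemma pushforward_diff: "pushforward A f x (v - w) = pushforward A f x v - pushforward A f x w"
  by (auto simp: pushforward_def fun_eq_iff)

locale contact_chart = proj_chart_data A H D \<phi> N h\<^sub>0 h D' \<psi>
  for A :: "('m, 'e::euclidean_space) atlas" and H D \<phi> N h\<^sub>0
    and h :: "'m \<Rightarrow> 'f::euclidean_space \<Rightarrow> 'm tvec" and D' \<psi> +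
  fixes Q :: "('m line, 'e \<times> 'f) atlas" and \<theta> :: "'m oneform"
  assumes Q_def: "Q = proj_atlas A H" and contact_form: "contact_form A H N \<theta>"
begin

sublocale Q: manifold_atlas Q
  unfolding Q_def by unfold_locales (rule smooth_atlas_proj_atlas)

lemma Q_chart: "(D', \<psi>) \<in> Q"
  unfolding Q_def mem_proj_atlas_iff using proj_chart by blast

lemmas open_domain = Q.mopen_chart[OF Q_chart]

lemma mopen_lift: "mopen A M \<Longrightarrow> mopen Q {q \<in> D'. fst q \<in> M}"
  by (rule Q.mopen_chartI[OF Q_chart]) (auto simp: image_restrict intro: open_image_restrict)

lemma smooth_fun_lift:
  assumes M: "mopen A M" "smooth_fun A M f"
  shows "smooth_fun Q {q \<in> D'. fst q \<in> M} (\<lambda>q. f (fst q))"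
proof (rule Q.smooth_fun_chartI[OF mopen_lift[OF M(1)] _ Q_chart])
  show "smooth_on (\<psi> ` {q \<in> D'. fst q \<in> M}) (\<lambda>w. f (fst (the_inv_into D' \<psi> w)))"
    unfolding image_restrict
  proof (rule smooth_on_cong[OF open_image_restrict[OF M(1)] _ smooth_on_base_coordinate[OF M]])
    fix w assume "w \<in> \<phi> ` (M \<inter> N) \<times> (UNIV :: 'f set)"
    then show "f (the_inv_into D \<phi> (fst w)) = f (fst (the_inv_into D' \<psi> w))"
      using chart_inverse_apply[of "fst w" "snd w"] by auto
  qed
qed auto

lemma smooth_fun_lift_N: "smooth_fun A N f \<Longrightarrow> smooth_fun Q D' (\<lambda>q. f (fst q))"
  using Q.smooth_fun_subset[OF smooth_fun_lift[OF base_chart(2)]] line_eq(2) by blast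

lemma smooth_at_lift:
  assumes "q \<in> D'" "smooth_at A (fst q) f"
  shows "smooth_at Q q (\<lambda>q. f (fst q))"
proof -
  obtain M where M: "mopen A M" "fst q \<in> M" "smooth_fun A M f" using assms(2) by (auto simp: smooth_at_def)
  then show ?thesis using Q.smooth_atI[OF mopen_lift[OF M(1)] _ smooth_fun_lift[OF M(1,3)]] assms(1) by simp
qed

abbreviation push :: "'m line \<Rightarrow> 'm line tvec \<Rightarrow> 'm tvec" where
  "push q v \<equiv> pushforward A fst q v"

lemma push_apply: "smooth_at A (fst q) f \<Longrightarrow> push q v f = v (\<lambda>q. f (fst q))"
  by (simp add: pushforward_def o_def)

lemma push_not_smooth: "\<not> smooth_at A (fst q) f \<Longrightarrow> push q v f = 0"
  by (simp add: pushforward_def)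

lemma push_in_T:
  assumes q: "q \<in> D'" and v: "v \<in> Q.T q"
  shows "push q v \<in> T (fst q)"
proof -
  note lift = smooth_at_lift[OF q]
  have cong: "v (\<lambda>q. f (fst q)) = v (\<lambda>q. g (fst q))" if "mopen A M" "fst q \<in> M" "\<forall>y\<in>M. f y = g y" for f g M
    by (rule Q.tv_cong[OF v mopen_lift[OF that(1)]]) (use that q in auto)
  have px: "fst q \<in> points A" using line_eq(2)[OF q] base_chart(2) by (auto simp: mopen_def)
  show ?thesis
    unfolding tangent_space_def
    using cong lift px
    by (auto simp: push_apply push_not_smooth smooth_at_add smooth_at_mult smooth_at_const
        Q.tv_add[OF v] Q.tv_mult[OF v] Q.tv_cmult[OF v])
qed

abbreviation coordv :: "'e \<times> 'f \<Rightarrow> 'm line vfield" where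
  "coordv w \<equiv> Q.coord_vfield D' \<psi> w"

lemma coordv_smooth: "smooth_vfield Q D' (coordv w)"
  by (rule Q.vfield_coord[OF Q_chart])

lemma coordv_in_T: "q \<in> D' \<Longrightarrow> coordv w q \<in> Q.T q"
  by (rule Q.coord_vfield_in_T[OF Q_chart])

lemma coordvE:
  assumes "q \<in> D'" "v \<in> Q.T q" obtains w where "v = coordv w q"
  using Q.tangent_vector_in_coordinates[OF Q_chart assms] that by blast

text \<open>The projection is \<open>fst\<close> in the charts, so coordinate fields with constant coefficients upstairs and
  downstairs are related by it.\<close>

lemma push_coordv:
  assumes q: "q \<in> D'"
  shows "push q (coordv w q) = coord_vfield D \<phi> (fst w) (fst q)"
proof
  fix f
  have x: "fst q \<in> D" using line_eq(2)[OF q] base_chart(3) by blast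
  show "push q (coordv w q) f = coord_vfield D \<phi> (fst w) (fst q) f"
  proof (cases "smooth_at A (fst q) f")
    case True
    have "((\<lambda>u. f (the_inv_into D \<phi> u)) has_derivative (\<lambda>e. coord_vfield D \<phi> e (fst q) f)) (at (fst (\<psi> q)))"
      using smooth_at_chart_differentiable[OF True base_chart(1) x] line_eq(3)[OF q] by simp
    from has_derivative_compose[OF bounded_linear_imp_has_derivative[OF bounded_linear_fst] this]
    have "((\<lambda>w. f (the_inv_into D \<phi> (fst w))) has_derivative (\<lambda>w. coord_vfield D \<phi> (fst w) (fst q) f)) (at (\<psi> q))" .
    then have "((\<lambda>w. f (fst (the_inv_into D' \<psi> w))) has_derivative (\<lambda>w. coord_vfield D \<phi> (fst w) (fst q) f)) (at (\<psi> q))"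
    proof (rule has_derivative_transform_within_open[OF _ Q.chart_open[OF Q_chart]])
      show "\<psi> q \<in> \<psi> ` D'" using q by blast
      fix w assume "w \<in> \<psi> ` D'"
      then show "f (the_inv_into D \<phi> (fst w)) = f (fst (the_inv_into D' \<psi> w))"
        unfolding image_domain using chart_inverse_apply[of "fst w" "snd w"] by auto
    qed
    from Q.coord_vfield_eqI[OF smooth_at_lift[OF q True] this] show ?thesis by (simp add: push_apply[OF True])
  next
    case False
    then show ?thesis by (simp add: push_not_smooth coord_vfield_def)
  qed
qed

lemma coord_vfield_eq_0: assumes "x \<in> D" "coord_vfield D \<phi> e x = 0" shows "e = 0"
proof (rule euclidean_eqI)
  fix b :: 'e
  show "e \<bullet> b = 0 \<bullet> b" using coord_vfield_coord[OF base_chart(1) assms(1), of e b] assms(2) by simp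
qed

lemma vert_iff:
  assumes q: "q \<in> D'"
  shows "v \<in> vert_bundle A Q q \<longleftrightarrow> (\<exists>\<eta>. v = coordv (0, \<eta>) q)"
proof
  have x: "fst q \<in> D" using line_eq(2)[OF q] base_chart(3) by blast
  assume "v \<in> vert_bundle A Q q"
  then have v: "v \<in> Q.T q" "push q v = 0" by (auto simp: vert_bundle_def)
  obtain w where w: "v = coordv w q" using coordvE[OF q v(1)] .
  then have "fst w = 0" using v(2) push_coordv[OF q] coord_vfield_eq_0[OF x] by simp
  then show "\<exists>\<eta>. v = coordv (0, \<eta>) q" using w by (metis prod.collapse)
next
  have x: "fst q \<in> D" using line_eq(2)[OF q] base_chart(3) by blast
  assume "\<exists>\<eta>. v = coordv (0, \<eta>) q"
  then show "v \<in> vert_bundle A Q q"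
    using coordv_in_T[OF q] push_coordv[OF q] linear_0[OF coord_vfield_linear[OF base_chart(1) x]]
    by (auto simp: vert_bundle_def)
qed

lemma push_vertical: "q \<in> D' \<Longrightarrow> push q (coordv (0, \<eta>) q) = 0"
  using vert_iff[of q "coordv (0, \<eta>) q"] by (auto simp: vert_bundle_def)

lemma push_surj:
  assumes q: "q \<in> D'" and u: "u \<in> T (fst q)"
  obtains v where "v \<in> Q.T q" "push q v = u"
proof -
  have x: "fst q \<in> D" using line_eq(2)[OF q] base_chart(3) by blast
  show ?thesis
    using tangent_vector_in_coordinates[OF base_chart(1) x u] that[OF coordv_in_T[OF q]] push_coordv[OF q]
    by (metis fst_conv)
qed

definition pullback :: "'m oneform \<Rightarrow> 'm line oneform" where
  "pullback \<beta> q v = (if v \<in> Q.T q then \<beta> (fst q) (push q v) else 0)"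

lemma pullback_cotangent:
  assumes \<beta>: "smooth_oneform A N \<beta>" and q: "q \<in> D'"
  shows "pullback \<beta> q \<in> cotangent_space Q q"
  unfolding cotangent_space_def pullback_def
  using form_add[OF \<beta> line_eq(2)[OF q]] form_scale[OF \<beta> line_eq(2)[OF q]] push_in_T[OF q]
  by (auto simp: Q.T_add Q.T_scale pushforward_add pushforward_scale)

lemma pullback_smooth:
  assumes \<beta>: "smooth_oneform A N \<beta>"
  shows "smooth_oneform Q D' (pullback \<beta>)"
  unfolding smooth_oneform_def
proof (intro conjI ballI allI impI)
  show "pullback \<beta> q \<in> cotangent_space Q q" if "q \<in> D'" for q using pullback_cotangent[OF \<beta> that] .
  fix M X assume M: "mopen Q M \<and> M \<subseteq> D' \<and> smooth_vfield Q M X"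
  have coords: "smooth_fun A N (\<lambda>x. \<phi> x \<bullet> b)" for b
    using smooth_fun_subset[OF smooth_fun_coord[OF base_chart(1)] base_chart(3)] .
  have "smooth_fun Q M (\<lambda>q. \<Sum>b\<in>Basis. X q (\<lambda>q. \<phi> (fst q) \<bullet> b) * \<beta> (fst q) (coord_vfield D \<phi> b (fst q)))"
  proof (rule Q.smooth_fun_sum)
    show "mopen Q M" using M by simp
    fix b :: 'e
    have "smooth_fun Q M (\<lambda>q. X q (\<lambda>q. \<phi> (fst q) \<bullet> b))"
      using M Q.vfield_fun[of M X M] Q.smooth_fun_subset[OF smooth_fun_lift_N[OF coords]] by simp
    moreover have "smooth_fun A N (\<lambda>x. \<beta> x (coord_vfield D \<phi> b x))"
      using form_fun[OF \<beta> base_chart(2) subset_refl] vfield_subset[OF vfield_coord[OF base_chart(1)] base_chart(3)] by blast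
    then have "smooth_fun Q M (\<lambda>q. \<beta> (fst q) (coord_vfield D \<phi> b (fst q)))"
      using M Q.smooth_fun_subset[OF smooth_fun_lift_N] by blast
    ultimately show "smooth_fun Q M (\<lambda>q. X q (\<lambda>q. \<phi> (fst q) \<bullet> b) * \<beta> (fst q) (coord_vfield D \<phi> b (fst q)))"
      using M by (intro Q.smooth_fun_mult) auto
  qed
  then show "smooth_fun Q M (\<lambda>q. pullback \<beta> q (X q))"
  proof (rule Q.smooth_fun_cong[rotated 2])
    fix q assume "q \<in> M"
    then have q: "q \<in> D'" "X q \<in> Q.T q" using M Q.vfield_T[of M X] by auto
    have x: "fst q \<in> N" "fst q \<in> D" using line_eq(2)[OF q(1)] base_chart(3) by auto
    have "push q (X q) = (\<Sum>b\<in>Basis. X q (\<lambda>q. \<phi> (fst q) \<bullet> b) *\<^sub>R coord_vfield D \<phi> b (fst q))"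
      using vfield_in_coordinates[OF base_chart(1) x(2) push_in_T[OF q]]
      by (simp add: push_apply smooth_at_coord[OF base_chart(1) x(2)])
    then show "(\<Sum>b\<in>Basis. X q (\<lambda>q. \<phi> (fst q) \<bullet> b) * \<beta> (fst q) (coord_vfield D \<phi> b (fst q))) = pullback \<beta> q (X q)"
      using q(2) coord_vfield_in_T[OF base_chart(1) x(2)] by (simp add: pullback_def form_sum[OF \<beta> x(1)])
  qed (use M in simp)
qed

text \<open>Naturality of the exterior derivative. As \<open>ext_d\<close> may be computed on any extensions, coordinate
  fields are taken: they are related by the projection to coordinate fields on the base, and brackets
  and derivatives of lifted functions descend.\<close>

lemma ext_d_pullback:
  assumes \<beta>: "smooth_oneform A N \<beta>" and q: "q \<in> D'" and v: "v \<in> Q.T q" and w: "w \<in> Q.T q"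
  shows "ext_d Q (pullback \<beta>) q v w = ext_d A \<beta> (fst q) (push q v) (push q w)"
proof -
  obtain a b where ab: "v = coordv a q" "w = coordv b q" using coordvE[OF q] v w by metis
  define V where "V c = coord_vfield D \<phi> (fst c)" for c :: "'e \<times> 'f"
  have V: "smooth_vfield A N (V c)" for c
    unfolding V_def by (rule vfield_subset[OF vfield_coord[OF base_chart(1)] base_chart(3)])
  have pushV: "push p (coordv c p) = V c (fst p)" if "p \<in> D'" for c p using push_coordv[OF that] by (simp add: V_def)
  have x: "fst q \<in> N" using line_eq(2)[OF q] .
  have lift: "coordv c q (\<lambda>p. f (fst p)) = V c (fst q) f" if "smooth_at A (fst q) f" for c f
    using push_apply[OF that] pushV[OF q] by metis
  have fst_form: "coordv c q (\<lambda>p. pullback \<beta> p (coordv d p)) = V c (fst q) (\<lambda>y. \<beta> y (V d y))" for c d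
  proof -
    have "coordv c q (\<lambda>p. pullback \<beta> p (coordv d p)) = coordv c q (\<lambda>p. \<beta> (fst p) (V d (fst p)))"
      by (rule Q.tv_cong[OF coordv_in_T[OF q] open_domain q]) (simp add: pullback_def coordv_in_T pushV)
    then show ?thesis using lift[OF form_smooth_at[OF \<beta> base_chart(2) x V]] by simp
  qed
  have br: "push q (bracket Q (coordv a) (coordv b) q) = bracket A (V a) (V b) (fst q)"
  proof
    fix f
    show "push q (bracket Q (coordv a) (coordv b) q) f = bracket A (V a) (V b) (fst q) f"
    proof (cases "smooth_at A (fst q) f")
      case True
      then obtain M where M: "mopen A M" "fst q \<in> M" "smooth_fun A M f" by (auto simp: smooth_at_def)
      have "coordv c q (\<lambda>p. coordv d p (\<lambda>p. f (fst p))) = V c (fst q) (\<lambda>y. V d y f)" for c d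
      proof -
        have "coordv c q (\<lambda>p. coordv d p (\<lambda>p. f (fst p))) = coordv c q (\<lambda>p. V d (fst p) f)"
        proof (rule Q.tv_cong[OF coordv_in_T[OF q] mopen_lift[OF M(1)]])
          show "q \<in> {q \<in> D'. fst q \<in> M}" using q M by simp
          fix p assume p: "p \<in> {q \<in> D'. fst q \<in> M}"
          then have "smooth_at A (fst p) f" using M smooth_atI by simp
          then show "coordv d p (\<lambda>p. f (fst p)) = V d (fst p) f" using push_apply pushV p by (metis (no_types, lifting) mem_Collect_eq)
        qed
        then show ?thesis using lift[OF vfield_smooth_at[OF V base_chart(2) x True]] by simp
      qed
      then show ?thesis using True by (simp add: push_apply Q.bracket_apply bracket_apply smooth_at_lift[OF q])
    qed (simp add: push_not_smooth bracket_def)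
  qed
  have "ext_d Q (pullback \<beta>) q v w = Q.dform (pullback \<beta>) (coordv a) (coordv b) q"
    unfolding ab by (rule Q.ext_d_eq_dform[OF open_domain q pullback_smooth[OF \<beta>] open_domain q coordv_smooth coordv_smooth])
  also have "\<dots> = dform \<beta> (V a) (V b) (fst q)"
    using Q.bracket_in_T[OF open_domain q coordv_smooth coordv_smooth]
    by (simp add: Q.dform_def dform_def fst_form br pullback_def[of \<beta> q "bracket Q (coordv a) (coordv b) q"])
  also have "\<dots> = ext_d A \<beta> (fst q) (V a (fst q)) (V b (fst q))"
    by (rule ext_d_eq_dform[OF base_chart(2) x \<beta> base_chart(2) x V V, symmetric])
  finally show ?thesis using pushV[OF q] ab by simp
qed

section \<open>The standard filtered frame\<close>

lemma theta_smooth: "smooth_oneform A N \<theta>"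
  using contact_form by (simp add: contact_form_def)

lemma H_eq: "x \<in> N \<Longrightarrow> H x = {v \<in> T x. \<theta> x v = 0}"
  using contact_form by (simp add: contact_form_def)

lemma theta_frame: "x \<in> N \<Longrightarrow> \<theta> x (F x z) = 0"
  using frame_mem[of x z] H_eq by auto

abbreviation d\<theta> :: "'m \<Rightarrow> 'm tvec \<Rightarrow> 'm tvec \<Rightarrow> real" where
  "d\<theta> \<equiv> ext_d A \<theta>"

lemmas d\<theta>_antisym = ext_d_antisym[OF base_chart(2) _ theta_smooth]
  and d\<theta>_add_left = ext_d_add_left[OF base_chart(2) _ theta_smooth]
  and d\<theta>_scale_left = ext_d_scale_left[OF base_chart(2) _ theta_smooth]
  and d\<theta>_add_right = ext_d_add_right[OF base_chart(2) _ theta_smooth]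
  and d\<theta>_scale_right = ext_d_scale_right[OF base_chart(2) _ theta_smooth]
  and d\<theta>_self = ext_d_self[OF base_chart(2) _ theta_smooth]

lemma frame_in_T: "x \<in> N \<Longrightarrow> F x z \<in> T x"
  using vfield_T[OF frame_smooth] .

text \<open>The skew complement is the same for each contact form. On sections of \<open>H\<close> the exterior derivative of
  a contact form is minus the contact form of the bracket, so its vanishing says that the bracket
  lies in \<open>H\<close>, which does not mention the form.\<close>

lemma skew_perp_span_iff:
  assumes x: "x \<in> N" and l: "l \<in> H x"
  shows "v \<in> skew_perp A H x (span {l}) \<longleftrightarrow> v \<in> H x \<and> d\<theta> x l v = 0"
proof (intro iffI conjI)
  assume v: "v \<in> skew_perp A H x (span {l})"
  then show "v \<in> H x" by (simp add: skew_perp_def)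
  have "l \<in> span {l}" by (simp add: span_base)
  then have "d\<theta> x v l = 0" using v contact_form x unfolding skew_perp_def by blast
  then show "d\<theta> x l v = 0" using d\<theta>_antisym[OF x] H_subset_T[OF x] l \<open>v \<in> H x\<close> by (metis subsetD neg_0_equal_iff_equal)
next
  assume v: "v \<in> H x \<and> d\<theta> x l v = 0"
  have "ext_d A \<theta>' x v l' = 0" if c: "contact_form A H M \<theta>'" and xM: "x \<in> M" and l': "l' \<in> span {l}" for M \<theta>' l'
  proof -
    have M: "mopen A M" "smooth_oneform A M \<theta>'" "\<And>y. y \<in> M \<Longrightarrow> H y = {v \<in> T y. \<theta>' y v = 0}"
      using c by (auto simp: contact_form_def)
    obtain c where c: "l' = c *\<^sub>R l" using l' by (auto simp: span_singleton)
    obtain z w where zw: "v = F x z" "l = F x w" using frame_surj[OF x] v l by metis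
    have o: "mopen A (N \<inter> M)" "x \<in> N \<inter> M" using base_chart(2) M(1) x xM by (auto intro: mopen_Int)
    have sm: "smooth_vfield A (N \<inter> M) (\<lambda>x. F x z)" for z by (rule vfield_subset[OF frame_smooth]) auto
    let ?b = "bracket A (\<lambda>x. F x w) (\<lambda>x. F x z) x"
    have "d\<theta> x l v = - \<theta> x ?b"
      unfolding zw by (rule ext_d_kernel[OF base_chart(2) x theta_smooth o sm sm]) (auto simp: theta_frame)
    then have "?b \<in> H x" using v H_eq[OF x] bracket_in_T[OF o sm sm] by simp
    then have "\<theta>' x ?b = 0" using M(3)[OF xM] by simp
    moreover have "ext_d A \<theta>' x l v = - \<theta>' x ?b"
      unfolding zw
      by (rule ext_d_kernel[OF M(1) xM M(2) o sm sm]) (use M(3) frame_mem in blast)+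
    ultimately have "ext_d A \<theta>' x l v = 0" by simp
    moreover have T: "l \<in> T x" "v \<in> T x" using v l H_subset_T[OF x] by auto
    ultimately show ?thesis
      unfolding c using ext_d_antisym[OF M(1) xM M(2), of l v] ext_d_scale_right[OF M(1) xM M(2), of v l c] by simp
  qed
  then show "v \<in> skew_perp A H x (span {l})" using v by (auto simp: skew_perp_def)
qed

text \<open>The tautological vector: a smooth choice of a spanning vector of the line \<open>q\<close>.\<close>

abbreviation lvec :: "'m line \<Rightarrow> 'm tvec" where
  "lvec q \<equiv> F (fst q) (1, snd (\<psi> q))"

lemma line_span: "q \<in> D' \<Longrightarrow> snd q = span {lvec q}"
  using line_eq(1) by (metis snd_conv)

lemma lvec_nonzero: "q \<in> D' \<Longrightarrow> lvec q \<noteq> 0"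
  using frame_zero_iff[OF line_eq(2)] by (simp add: zero_prod_def)

lemma lvec_in_T: "q \<in> D' \<Longrightarrow> lvec q \<in> T (fst q)"
  using frame_in_T[OF line_eq(2)] .

lemma d\<theta>_frame_expand:
  assumes x: "x \<in> N" and u: "u \<in> T x"
  shows "d\<theta> x (F x z) u = (\<Sum>j\<in>Basis. (z \<bullet> j) * d\<theta> x (F x j) u)"
proof -
  have lin: "linear (\<lambda>z. d\<theta> x (F x z) u)"
  proof (rule linearI)
    show "d\<theta> x (F x (z + w)) u = d\<theta> x (F x z) u + d\<theta> x (F x w) u" for z w
      using u by (simp add: linear_add[OF frame_linear[OF x]] d\<theta>_add_left[OF x] frame_in_T[OF x])
    show "d\<theta> x (F x (c *\<^sub>R z)) u = c *\<^sub>R d\<theta> x (F x z) u" for c z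
      using u by (simp add: frame_scale[OF x] d\<theta>_scale_left[OF x] frame_in_T[OF x])
  qed
  have "d\<theta> x (F x z) u = d\<theta> x (F x (\<Sum>j\<in>Basis. (z \<bullet> j) *\<^sub>R j)) u" by (simp only: euclidean_representation)
  then show ?thesis by (simp only: linear_sum[OF lin] linear_scale[OF lin] real_scaleR_def)
qed

lemma fibre_coordinate_smooth: "smooth_fun Q D' (\<lambda>q. (1, snd (\<psi> q)) \<bullet> (j :: real \<times> 'f))"
proof -
  have "smooth_fun Q D' (\<lambda>q. fst j + \<psi> q \<bullet> (0, snd j))"
    by (intro Q.smooth_fun_add open_domain Q.smooth_fun_const Q.smooth_fun_coord Q_chart)
  then show ?thesis by (simp add: inner_prod_def)
qed

text \<open>The first form of the standard filtered frame is the pulled back contact form; it cuts out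
  \<open>\<H>\<close>. The second is the contraction of \<open>d\<theta>\<close> with the tautological vector, pulled back; within \<open>\<H>\<close>
  it cuts out \<open>E\<^sup>\<bottom>\<close>.\<close>

definition \<theta>\<^sub>2 :: "'m line oneform" where "\<theta>\<^sub>2 = pullback \<theta>"

definition \<theta>\<^sub>1 :: "'m line oneform" where
  "\<theta>\<^sub>1 q v = (if v \<in> Q.T q then d\<theta> (fst q) (lvec q) (push q v) else 0)"

text \<open>The contraction of \<open>d\<theta>\<close> with one field of the frame of \<open>H\<close>. By linearity \<open>\<theta>\<^sub>1\<close> is a combination of
  the pullbacks of these, with the homogeneous coordinates \<open>(1, y)\<close> as coefficients.\<close>

definition contraction :: "real \<times> 'f \<Rightarrow> 'm oneform" where
  "contraction j = (\<lambda>x v. if v \<in> T x then d\<theta> x (F x j) v else 0)"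

lemma contraction_smooth: "smooth_oneform A N (contraction j)"
  unfolding contraction_def by (rule interior_product_smooth[OF base_chart(2) theta_smooth frame_smooth])

lemma theta2_smooth: "smooth_oneform Q D' \<theta>\<^sub>2"
  unfolding \<theta>\<^sub>2_def by (rule pullback_smooth[OF theta_smooth])

lemma theta1_smooth: "smooth_oneform Q D' \<theta>\<^sub>1"
  unfolding smooth_oneform_def
proof (intro conjI ballI allI impI)
  fix q assume q: "q \<in> D'"
  note x = line_eq(2)[OF q]
  show "\<theta>\<^sub>1 q \<in> cotangent_space Q q"
    unfolding cotangent_space_def \<theta>\<^sub>1_def
    using d\<theta>_add_right[OF x lvec_in_T[OF q]] d\<theta>_scale_right[OF x lvec_in_T[OF q]] push_in_T[OF q]
    by (auto simp: Q.T_add Q.T_scale pushforward_add pushforward_scale)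
next
  fix M X assume M: "mopen Q M \<and> M \<subseteq> D' \<and> smooth_vfield Q M X"
  then have "smooth_fun Q M (\<lambda>q. \<Sum>j\<in>Basis. ((1, snd (\<psi> q)) \<bullet> j) * pullback (contraction j) q (X q))"
    using Q.smooth_fun_subset[OF fibre_coordinate_smooth] Q.form_fun[OF pullback_smooth[OF contraction_smooth]]
    by (intro Q.smooth_fun_sum Q.smooth_fun_mult) auto
  then show "smooth_fun Q M (\<lambda>q. \<theta>\<^sub>1 q (X q))"
  proof (rule Q.smooth_fun_cong[rotated 2])
    fix q assume "q \<in> M"
    then have q: "q \<in> D'" "X q \<in> Q.T q" using M Q.vfield_T[of M X] by auto
    show "(\<Sum>j\<in>Basis. ((1, snd (\<psi> q)) \<bullet> j) * pullback (contraction j) q (X q)) = \<theta>\<^sub>1 q (X q)"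
      using q push_in_T[OF q] d\<theta>_frame_expand[OF line_eq(2)[OF q(1)] push_in_T[OF q], of "(1, snd (\<psi> q))"]
      by (simp add: \<theta>\<^sub>1_def pullback_def contraction_def)
  qed (use M in simp)
qed

lemma H_bundle_iff: "q \<in> D' \<Longrightarrow> v \<in> H_bundle A H Q q \<longleftrightarrow> v \<in> Q.T q \<and> \<theta>\<^sub>2 q v = 0"
  using push_in_T[of q v] H_eq[OF line_eq(2), of q] by (auto simp: H_bundle_def \<theta>\<^sub>2_def pullback_def)

lemma Eperp_iff:
  assumes q: "q \<in> D'"
  shows "v \<in> Eperp_bundle A H Q q \<longleftrightarrow> v \<in> Q.T q \<and> \<theta>\<^sub>2 q v = 0 \<and> \<theta>\<^sub>1 q v = 0"
proof -
  have "v \<in> Eperp_bundle A H Q q \<longleftrightarrow> v \<in> Q.T q \<and> push q v \<in> skew_perp A H (fst q) (span {lvec q})"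
    by (simp add: Eperp_bundle_def line_span[OF q])
  also have "\<dots> \<longleftrightarrow> v \<in> Q.T q \<and> push q v \<in> H (fst q) \<and> d\<theta> (fst q) (lvec q) (push q v) = 0"
    using skew_perp_span_iff[OF line_eq(2)[OF q] frame_mem[OF line_eq(2)[OF q]]] by simp
  also have "\<dots> \<longleftrightarrow> v \<in> Q.T q \<and> \<theta>\<^sub>2 q v = 0 \<and> \<theta>\<^sub>1 q v = 0"
    using H_bundle_iff[OF q, of v] by (auto simp: H_bundle_def \<theta>\<^sub>1_def)
  finally show ?thesis .
qed

lemma E_bundle_iff: "q \<in> D' \<Longrightarrow> v \<in> E_bundle A Q q \<longleftrightarrow> v \<in> Q.T q \<and> (\<exists>c. push q v = c *\<^sub>R lvec q)"
  by (auto simp: E_bundle_def line_span span_singleton)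

lemma E_subset_Eperp:
  assumes q: "q \<in> D'" and v: "v \<in> E_bundle A Q q"
  shows "v \<in> Eperp_bundle A H Q q"
proof -
  note x = line_eq(2)[OF q]
  obtain c where c: "v \<in> Q.T q" "push q v = c *\<^sub>R lvec q" using v E_bundle_iff[OF q] by blast
  then have "\<theta>\<^sub>2 q v = 0"
    using form_scale[OF theta_smooth x lvec_in_T[OF q]] theta_frame[OF x] by (simp add: \<theta>\<^sub>2_def pullback_def)
  moreover have "\<theta>\<^sub>1 q v = 0"
    using c d\<theta>_scale_right[OF x lvec_in_T[OF q] lvec_in_T[OF q]] d\<theta>_self[OF x lvec_in_T[OF q]] by (simp add: \<theta>\<^sub>1_def)
  ultimately show ?thesis using c Eperp_iff[OF q] by simp
qed

lemma vertical_in_E: "q \<in> D' \<Longrightarrow> coordv (0, \<eta>) q \<in> E_bundle A Q q"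
  using E_bundle_iff coordv_in_T push_vertical by (metis scaleR_zero_left)

lemma exists_transverse:
  assumes q: "q \<in> D'" obtains z where "z \<in> Q.T q" "\<theta>\<^sub>2 q z \<noteq> 0"
proof -
  note x = line_eq(2)[OF q]
  obtain u where u: "\<theta> (fst q) u \<noteq> 0" using contact_form x by (auto simp: contact_form_def fun_eq_iff)
  then have "u \<in> T (fst q)" using form_outside[OF theta_smooth x] by blast
  from push_surj[OF q this] obtain v where "v \<in> Q.T q" "push q v = u" .
  then show ?thesis using u that[of v] by (simp add: \<theta>\<^sub>2_def pullback_def)
qed

lemma exists_nonperp:
  assumes x: "x \<in> N" and l: "l \<in> H x" "l \<noteq> 0" obtains u where "u \<in> H x" "d\<theta> x l u \<noteq> 0"
proof -
  have "\<not> (\<forall>u\<in>H x. d\<theta> x l u = 0)" using contact_form x l unfolding contact_form_def by blast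
  then show ?thesis using that by blast
qed

lemma exists_H_transverse:
  assumes q: "q \<in> D'" obtains w where "w \<in> Q.T q" "\<theta>\<^sub>2 q w = 0" "\<theta>\<^sub>1 q w \<noteq> 0"
proof -
  note x = line_eq(2)[OF q]
  obtain u where u: "u \<in> H (fst q)" "d\<theta> (fst q) (lvec q) u \<noteq> 0"
    using exists_nonperp[OF x frame_mem[OF x] lvec_nonzero[OF q]] .
  from push_surj[OF q subsetD[OF H_subset_T[OF x] u(1)]] obtain v where v: "v \<in> Q.T q" "push q v = u" .
  then have "\<theta>\<^sub>2 q v = 0" using u H_eq[OF x] by (simp add: \<theta>\<^sub>2_def pullback_def)
  then show ?thesis using u v that[of v] by (simp add: \<theta>\<^sub>1_def)
qed

lemmas theta2_linear = Q.form_add[OF theta2_smooth] Q.form_scale[OF theta2_smooth] Q.form_diff[OF theta2_smooth]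
lemmas theta1_linear = Q.form_add[OF theta1_smooth] Q.form_scale[OF theta1_smooth] Q.form_diff[OF theta1_smooth]

text \<open>\<open>E\<^sup>\<bottom>\<close> is the common kernel of two independent functionals, so its annihilator is spanned by them.\<close>

lemma Ann_Eperp_combination:
  assumes q: "q \<in> D'" and \<alpha>: "\<alpha> \<in> Ann Q (Eperp_bundle A H Q) q"
  obtains a b where "\<And>v. v \<in> Q.T q \<Longrightarrow> \<alpha> v = a * \<theta>\<^sub>2 q v + b * \<theta>\<^sub>1 q v"
proof -
  obtain z where z: "z \<in> Q.T q" "\<theta>\<^sub>2 q z \<noteq> 0" using exists_transverse[OF q] .
  obtain w where w: "w \<in> Q.T q" "\<theta>\<^sub>2 q w = 0" "\<theta>\<^sub>1 q w \<noteq> 0" using exists_H_transverse[OF q] .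
  have add: "\<alpha> (u - v) = \<alpha> u - \<alpha> v" if "u \<in> Q.T q" "v \<in> Q.T q" for u v
  proof -
    have "\<alpha> (u + (-1) *\<^sub>R v) = \<alpha> u + \<alpha> ((-1) *\<^sub>R v)" "\<alpha> ((-1) *\<^sub>R v) = -1 * \<alpha> v"
      using \<alpha> that Q.T_scale[OF that(2), of "-1"] unfolding Ann_def cotangent_space_def by blast+
    then show ?thesis by simp
  qed
  have scale: "\<alpha> (c *\<^sub>R v) = c * \<alpha> v" if "v \<in> Q.T q" for c v
    using \<alpha> that unfolding Ann_def cotangent_space_def by blast
  define b where "b = \<alpha> w / \<theta>\<^sub>1 q w"
  define a where "a = (\<alpha> z - b * \<theta>\<^sub>1 q z) / \<theta>\<^sub>2 q z"
  have "\<alpha> v = a * \<theta>\<^sub>2 q v + b * \<theta>\<^sub>1 q v" if v: "v \<in> Q.T q" for v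
  proof -
    define r where "r = \<theta>\<^sub>2 q v / \<theta>\<^sub>2 q z"
    define s where "s = (\<theta>\<^sub>1 q v - r * \<theta>\<^sub>1 q z) / \<theta>\<^sub>1 q w"
    let ?v = "v - r *\<^sub>R z - s *\<^sub>R w"
    note TT = v z(1) w(1) Q.T_scale Q.T_diff
    have "\<theta>\<^sub>2 q ?v = 0" using z w by (simp add: theta2_linear q TT r_def)
    moreover have "\<theta>\<^sub>1 q ?v = 0" using z w by (simp add: theta1_linear q TT s_def)
    ultimately have "?v \<in> Eperp_bundle A H Q q" using Eperp_iff[OF q] by (simp add: TT)
    then have "\<alpha> ?v = 0" using \<alpha> by (simp add: Ann_def)
    then have "\<alpha> v = r * \<alpha> z + s * \<alpha> w" by (simp add: add scale TT)
    then show ?thesis using z w by (simp add: a_def b_def r_def s_def field_simps)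
  qed
  then show ?thesis by (rule that)
qed

lemma Ann_H_combination:
  assumes q: "q \<in> D'" and \<alpha>: "\<alpha> \<in> Ann Q (H_bundle A H Q) q"
  obtains a where "\<alpha> = a *\<^sub>R \<theta>\<^sub>2 q"
proof -
  have "\<alpha> \<in> Ann Q (Eperp_bundle A H Q) q"
    using \<alpha> Eperp_iff[OF q] H_bundle_iff[OF q] by (auto simp: Ann_def)
  from Ann_Eperp_combination[OF q this] obtain a b
    where ab: "\<And>v. v \<in> Q.T q \<Longrightarrow> \<alpha> v = a * \<theta>\<^sub>2 q v + b * \<theta>\<^sub>1 q v" by blast
  obtain w where w: "w \<in> Q.T q" "\<theta>\<^sub>2 q w = 0" "\<theta>\<^sub>1 q w \<noteq> 0" using exists_H_transverse[OF q] .
  then have "\<alpha> w = 0" using \<alpha> H_bundle_iff[OF q] by (auto simp: Ann_def)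
  then have "b = 0" using ab[OF w(1)] w by simp
  moreover have "\<alpha> v = 0" "\<theta>\<^sub>2 q v = 0" if "v \<notin> Q.T q" for v
    using that \<alpha> Q.form_outside[OF theta2_smooth q] by (auto simp: Ann_def cotangent_space_def)
  ultimately have "\<alpha> = a *\<^sub>R \<theta>\<^sub>2 q"
    using ab by (simp add: fun_eq_iff scaleR_fun_apply) (metis mult_zero_right)
  then show ?thesis by (rule that)
qed

lemma filtered_frame_standard:
  assumes M: "mopen Q M" "M \<subseteq> D'"
  shows "filtered_frame A H Q M \<theta>\<^sub>2 \<theta>\<^sub>1"
  unfolding filtered_frame_def
proof (intro conjI ballI)
  show "mopen Q M" "smooth_oneform Q M \<theta>\<^sub>2" "smooth_oneform Q M \<theta>\<^sub>1"
    using M Q.form_subset theta2_smooth theta1_smooth by blast+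
  fix q assume "q \<in> M"
  then have q: "q \<in> D'" using M by blast
  have cot: "\<theta>\<^sub>2 q \<in> cotangent_space Q q" "\<theta>\<^sub>1 q \<in> cotangent_space Q q"
    using theta2_smooth theta1_smooth q by (auto simp: smooth_oneform_def)
  show "\<theta>\<^sub>2 q \<in> Ann Q (Eperp_bundle A H Q) q" "\<theta>\<^sub>1 q \<in> Ann Q (Eperp_bundle A H Q) q"
    using cot Eperp_iff[OF q] by (auto simp: Ann_def)
  obtain z where z: "z \<in> Q.T q" "\<theta>\<^sub>2 q z \<noteq> 0" using exists_transverse[OF q] .
  obtain w where w: "w \<in> Q.T q" "\<theta>\<^sub>2 q w = 0" "\<theta>\<^sub>1 q w \<noteq> 0" using exists_H_transverse[OF q] .
  show ne: "\<theta>\<^sub>2 q \<noteq> \<theta>\<^sub>1 q" using w by auto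
  have "\<theta>\<^sub>1 q \<notin> span {\<theta>\<^sub>2 q}" using w by (auto simp: span_singleton scaleR_fun_apply)
  moreover have "\<theta>\<^sub>2 q \<noteq> 0" using z by auto
  ultimately show "independent {\<theta>\<^sub>2 q, \<theta>\<^sub>1 q}"
    using ne by (subst insert_commute) (simp add: independent_insert)
  show "span {\<theta>\<^sub>2 q} = Ann Q (H_bundle A H Q) q"
  proof (intro equalityI subsetI)
    fix \<alpha> assume "\<alpha> \<in> span {\<theta>\<^sub>2 q}"
    then obtain c where c: "\<alpha> = c *\<^sub>R \<theta>\<^sub>2 q" by (auto simp: span_singleton)
    then show "\<alpha> \<in> Ann Q (H_bundle A H Q) q"
      using cot(1) H_bundle_iff[OF q] by (auto simp: Ann_def cotangent_space_def scaleR_fun_apply algebra_simps)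
  next
    fix \<alpha> assume "\<alpha> \<in> Ann Q (H_bundle A H Q) q"
    from Ann_H_combination[OF q this] show "\<alpha> \<in> span {\<theta>\<^sub>2 q}" by (auto simp: span_singleton)
  qed
qed

section \<open>Brackets with sections of \<open>E\<close>\<close>

lemma frame_apply_expand:
  assumes "x \<in> N" shows "F x z f = (\<Sum>j\<in>Basis. (z \<bullet> j) * F x j f)"
proof -
  have "F x z f = (\<Sum>j\<in>Basis. (z \<bullet> j) *\<^sub>R F x j) f"
    using frame_expand[OF assms] by (rule fun_cong)
  then show ?thesis by (simp only: sum_fun_apply scaleR_fun_apply real_scaleR_def)
qed

lemma lvec_apply: "q \<in> D' \<Longrightarrow> lvec q f = (\<Sum>j\<in>Basis. ((1, snd (\<psi> q)) \<bullet> j) * F (fst q) j f)"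
  by (rule frame_apply_expand[OF line_eq(2)])

lemma frame_apply_smooth:
  assumes "mopen A M" "smooth_fun A M f"
  shows "smooth_fun Q {q \<in> D'. fst q \<in> M} (\<lambda>q. F (fst q) z f)"
proof -
  have "smooth_fun A (M \<inter> N) (\<lambda>x. F x z f)"
    by (rule vfield_fun[OF frame_smooth mopen_Int[OF assms(1) base_chart(2)] _ smooth_fun_subset[OF assms(2)]]) auto
  from smooth_fun_lift[OF mopen_Int[OF assms(1) base_chart(2)] this] show ?thesis
    by (rule Q.smooth_fun_subset) (use line_eq(2) in auto)
qed

lemma lvec_apply_smooth:
  assumes M: "mopen A M" "smooth_fun A M f"
  shows "smooth_fun Q {q \<in> D'. fst q \<in> M} (\<lambda>q. lvec q f)"
proof (rule Q.smooth_fun_cong[OF mopen_lift[OF M(1)]])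
  show "smooth_fun Q {q \<in> D'. fst q \<in> M} (\<lambda>q. \<Sum>j\<in>Basis. ((1, snd (\<psi> q)) \<bullet> j) * F (fst q) j f)"
  proof (rule Q.smooth_fun_sum[OF mopen_lift[OF M(1)]])
    fix j :: "real \<times> 'f"
    have "{q \<in> D'. fst q \<in> M} \<subseteq> D'" by blast
    then show "smooth_fun Q {q \<in> D'. fst q \<in> M} (\<lambda>q. ((1, snd (\<psi> q)) \<bullet> j) * F (fst q) j f)"
      by (rule Q.smooth_fun_mult[OF mopen_lift[OF M(1)] Q.smooth_fun_subset[OF fibre_coordinate_smooth] frame_apply_smooth[OF M]])
  qed
  show "(\<Sum>j\<in>Basis. ((1, snd (\<psi> q)) \<bullet> j) * F (fst q) j f) = lvec q f" if "q \<in> {q \<in> D'. fst q \<in> M}" for q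
    by (rule lvec_apply[symmetric]) (use that in blast)
qed

text \<open>Along a fibre the tautological vector \<open>h\<^sub>0 + h(y)\<close> is affine in \<open>y\<close>, with linear part \<open>h\<close>.\<close>

lemma vertical_derivative_lvec:
  assumes q: "q \<in> D'" and f: "smooth_at A (fst q) f"
  shows "coordv (0, \<eta>) q (\<lambda>p. lvec p f) = F (fst q) (0, \<eta>) f"
proof -
  let ?v = "coordv (0, \<eta>) q"
  note vT = coordv_in_T[OF q, of "(0, \<eta>)"]
  have qp: "q \<in> points Q" using q open_domain by (auto simp: mopen_def)
  have x: "fst q \<in> N" using line_eq(2)[OF q] .
  have sF: "smooth_at A (fst q) (\<lambda>x. F x j f)" for j
    using vfield_smooth_at[OF frame_smooth base_chart(2) x f] .
  have sFl: "smooth_at Q q (\<lambda>p. F (fst p) j f)" for j using smooth_at_lift[OF q sF] .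
  have sc: "smooth_at Q q (\<lambda>p. (1, snd (\<psi> p)) \<bullet> (j :: real \<times> 'f))" for j
    using Q.smooth_atI[OF open_domain q fibre_coordinate_smooth] .
  have vF: "?v (\<lambda>p. F (fst p) j f) = 0" for j
    using push_apply[OF sF, of "?v"] push_vertical[OF q] by simp
  have vc: "?v (\<lambda>p. (1, snd (\<psi> p)) \<bullet> (j :: real \<times> 'f)) = (0, \<eta>) \<bullet> j" for j
  proof -
    have "?v (\<lambda>p. fst j + \<psi> p \<bullet> (0, snd j)) = ?v (\<lambda>p. fst j) + ?v (\<lambda>p. \<psi> p \<bullet> (0, snd j))"
      by (rule Q.tv_add[OF vT Q.smooth_at_const[OF qp] Q.smooth_at_coord[OF Q_chart q]])
    then show ?thesis
      using Q.coord_vfield_coord[OF Q_chart q, of "(0, \<eta>)" "(0, snd j)"] Q.tv_const[OF vT]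
      by (simp add: inner_prod_def)
  qed
  have "?v (\<lambda>p. lvec p f) = ?v (\<lambda>p. \<Sum>j\<in>Basis. ((1, snd (\<psi> p)) \<bullet> j) * F (fst p) j f)"
    by (rule Q.tv_cong[OF vT open_domain q]) (rule lvec_apply)
  also have "\<dots> = (\<Sum>j\<in>Basis. ?v (\<lambda>p. ((1, snd (\<psi> p)) \<bullet> j) * F (fst p) j f))"
    by (rule Q.tv_sum[OF vT qp Q.smooth_at_mult[OF sc sFl]])
  also have "\<dots> = (\<Sum>j\<in>Basis. ((0, \<eta>) \<bullet> j) * F (fst q) j f)"
    by (intro sum.cong refl) (simp add: Q.tv_mult[OF vT sc sFl] vF vc)
  also have "\<dots> = F (fst q) (0, \<eta>) f"
    by (rule frame_apply_expand[OF x, symmetric])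
  finally show ?thesis .
qed

text \<open>The projection of a section of \<open>E\<close> is a multiple of the tautological vector. The factor is smooth
  because it is a quotient of smooth functions: apply both sides to a function \<open>f\<close> on the base on which
  the tautological vector does not vanish.\<close>

lemma E_section_multiplier:
  assumes M: "mopen Q M" "M \<subseteq> D'" and X: "smooth_vfield Q M X" "\<And>q. q \<in> M \<Longrightarrow> X q \<in> E_bundle A Q q"
  obtains m where "smooth_fun Q M m" "\<And>q. q \<in> M \<Longrightarrow> push q (X q) = m q *\<^sub>R lvec q"
proof -
  have "\<forall>q\<in>M. \<exists>c. push q (X q) = c *\<^sub>R lvec q" using X(2) E_bundle_iff M(2) by blast
  then obtain m where m: "\<And>q. q \<in> M \<Longrightarrow> push q (X q) = m q *\<^sub>R lvec q" by metis
  have "smooth_fun Q M m"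
  proof (rule Q.smooth_fun_local)
    fix p assume p: "p \<in> M"
    then have pD: "p \<in> D'" using M by blast
    obtain f where f: "lvec p f \<noteq> 0" using lvec_nonzero[OF pD] by (auto simp: fun_eq_iff)
    then have "smooth_at A (fst p) f" using tv_not_smooth[OF lvec_in_T[OF pD]] by blast
    then obtain M1 where M1: "mopen A M1" "fst p \<in> M1" "smooth_fun A M1 f" by (auto simp: smooth_at_def)
    let ?L = "{q \<in> D'. fst q \<in> M1}"
    define K where "K = {q \<in> M \<inter> ?L. lvec q f \<noteq> 0}"
    have o: "mopen Q (M \<inter> ?L)" using M(1) mopen_lift[OF M1(1)] by (rule Q.mopen_Int)
    have sl: "smooth_fun Q (M \<inter> ?L) (\<lambda>q. lvec q f)" 
      by (rule Q.smooth_fun_subset[OF lvec_apply_smooth[OF M1(1,3)]]) blast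
    have K: "mopen Q K" "p \<in> K" "K \<subseteq> M" "K \<subseteq> ?L"
      using Q.mopen_nonzero[OF o sl] p pD M1(2) f by (auto simp: K_def)
    have "smooth_fun Q K (\<lambda>q. X q (\<lambda>q. f (fst q)) / lvec q f)"
    proof (rule Q.smooth_fun_divide[OF K(1)])
      show "smooth_fun Q K (\<lambda>q. X q (\<lambda>q. f (fst q)))"
        by (rule Q.vfield_fun[OF X(1) K(1,3) Q.smooth_fun_subset[OF smooth_fun_lift[OF M1(1,3)] K(4)]])
      show "smooth_fun Q K (\<lambda>q. lvec q f)" by (rule Q.smooth_fun_subset[OF sl]) (use K in auto)
    qed (simp add: K_def)
    then have "smooth_fun Q K m"
    proof (rule Q.smooth_fun_cong[OF K(1), rotated])
      fix q assume q: "q \<in> K"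
      then have "smooth_at A (fst q) f" using smooth_atI[OF M1(1) _ M1(3)] by (simp add: K_def)
      then have "X q (\<lambda>q. f (fst q)) = m q * lvec q f"
        using m[of q] q push_apply[of q f "X q"] by (simp add: K_def scaleR_fun_apply)
      then show "X q (\<lambda>q. f (fst q)) / lvec q f = m q" using q by (simp add: K_def)
    qed
    then show "\<exists>K. mopen Q K \<and> p \<in> K \<and> smooth_fun Q K m" using K by blast
  qed
  then show ?thesis using m by (rule that)
qed

context
  fixes M X m
  assumes M: "mopen Q M" "M \<subseteq> D'" and X: "smooth_vfield Q M X"
    and m: "smooth_fun Q M m" "\<And>q. q \<in> M \<Longrightarrow> push q (X q) = m q *\<^sub>R lvec q"
begin

lemma multiplier_E: "q \<in> M \<Longrightarrow> X q \<in> E_bundle A Q q"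
proof -
  assume q: "q \<in> M"
  then have "q \<in> D'" using M(2) by blast
  then show ?thesis using E_bundle_iff[of q "X q"] Q.vfield_T[OF X q] m(2)[OF q] by auto
qed

text \<open>The central computation. The vertical field annihilates lifted functions, so applying the bracket to
  a lifted function \<open>f\<close> only leaves the vertical derivative of \<open>m \<cdot> lvec f\<close>, to which the product rule
  applies. Modulo the line, the bracket of a vertical vector with a section of \<open>E\<close> thus projects to
  the corresponding vector of \<open>H\<close>, up to the factor \<open>m\<close>.\<close>

lemma push_bracket_vertical:
  assumes qM: "q \<in> M"
  shows "push q (bracket Q (coordv (0, \<eta>)) X q) = coordv (0, \<eta>) q m *\<^sub>R lvec q + m q *\<^sub>R F (fst q) (0, \<eta>)"
proof
  fix f
  have q: "q \<in> D'" using qM M by blast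
  have x: "fst q \<in> N" using line_eq(2)[OF q] .
  let ?v = "coordv (0, \<eta>) q"
  show "push q (bracket Q (coordv (0, \<eta>)) X q) f = (?v m *\<^sub>R lvec q + m q *\<^sub>R F (fst q) (0, \<eta>)) f"
  proof (cases "smooth_at A (fst q) f")
    case False
    then show ?thesis using tv_not_smooth[OF frame_in_T[OF x]] by (simp add: push_not_smooth scaleR_fun_apply)
  next
    case True
    then obtain M1 where M1: "mopen A M1" "fst q \<in> M1" "smooth_fun A M1 f" by (auto simp: smooth_at_def)
    define K where "K = M \<inter> {q \<in> D'. fst q \<in> M1}"
    have K: "mopen Q K" "q \<in> K" "K \<subseteq> M" "K \<subseteq> D'"
      using M(1) mopen_lift[OF M1(1)] qM q M1(2) by (auto simp: K_def intro: Q.mopen_Int)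
    have fK: "smooth_at A (fst p) f" if "p \<in> K" for p using that smooth_atI[OF M1(1) _ M1(3)] by (simp add: K_def)
    have "X q (\<lambda>p. coordv (0, \<eta>) p (\<lambda>p. f (fst p))) = X q (\<lambda>p. 0)"
    proof (rule Q.tv_cong[OF Q.vfield_T[OF X qM] K(1,2)])
      fix p assume p: "p \<in> K"
      then have "p \<in> D'" using K by blast
      then show "coordv (0, \<eta>) p (\<lambda>p. f (fst p)) = 0"
        using push_apply[OF fK[OF p], of "coordv (0, \<eta>) p"] push_vertical[of p \<eta>] by simp
    qed
    then have 1: "X q (\<lambda>p. coordv (0, \<eta>) p (\<lambda>p. f (fst p))) = 0" using Q.tv_const[OF Q.vfield_T[OF X qM]] by simp
    have "?v (\<lambda>p. X p (\<lambda>p. f (fst p))) = ?v (\<lambda>p. m p * lvec p f)"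
    proof (rule Q.tv_cong[OF coordv_in_T[OF q] K(1,2)])
      fix p assume p: "p \<in> K"
      then show "X p (\<lambda>p. f (fst p)) = m p * lvec p f"
        using m(2)[of p] push_apply[OF fK[OF p], of "X p"] K by (auto simp: scaleR_fun_apply)
    qed
    also have "\<dots> = m q * ?v (\<lambda>p. lvec p f) + lvec q f * ?v m"
      using M1 q by (intro Q.tv_mult coordv_in_T Q.smooth_atI[OF M(1) qM m(1)]
          Q.smooth_atI[OF mopen_lift _ lvec_apply_smooth]) auto
    finally show ?thesis
      using True 1
      by (simp add: push_apply Q.bracket_apply smooth_at_lift[OF q] vertical_derivative_lvec[OF q True] scaleR_fun_apply)
  qed
qed

text \<open>Hence \<open>d\<theta>\<^sub>1\<close> pairs vertical vectors with sections of \<open>E\<close> as \<open>d\<theta>\<close> pairs the vectors of \<open>H\<close> that they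
  stand for with the line.\<close>

lemma ext_d_theta1_vertical:
  assumes qM: "q \<in> M"
  shows "ext_d Q \<theta>\<^sub>1 q (coordv (0, \<eta>) q) (X q) = - (m q * d\<theta> (fst q) (lvec q) (F (fst q) (0, \<eta>)))"
proof -
  have q: "q \<in> D'" using qM M by blast
  note x = line_eq(2)[OF q]
  have V: "smooth_vfield Q M (coordv (0, \<eta>))" by (rule Q.vfield_subset[OF coordv_smooth M(2)])
  have ker: "\<theta>\<^sub>1 p v = 0" if "p \<in> M" "v \<in> E_bundle A Q p" for p v
    using that E_subset_Eperp[of p v] Eperp_iff[of p v] M by blast
  have "ext_d Q \<theta>\<^sub>1 q (coordv (0, \<eta>) q) (X q) = - \<theta>\<^sub>1 q (bracket Q (coordv (0, \<eta>)) X q)"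
    by (rule Q.ext_d_kernel[OF open_domain q theta1_smooth M(1) qM V X])
      (use ker vertical_in_E multiplier_E M in blast)+
  also have "\<theta>\<^sub>1 q (bracket Q (coordv (0, \<eta>)) X q) = m q * d\<theta> (fst q) (lvec q) (F (fst q) (0, \<eta>))"
    using Q.bracket_in_T[OF M(1) qM V X] frame_in_T[OF x]
    by (simp add: \<theta>\<^sub>1_def push_bracket_vertical[OF qM] d\<theta>_add_right[OF x] d\<theta>_scale_right[OF x] d\<theta>_self[OF x] T_scale)
  finally show ?thesis .
qed

end

text \<open>\<open>d\<theta>\<^sub>2\<close> is the pullback of \<open>d\<theta>\<close>, and \<open>E\<^sup>\<bottom>\<close> projects to the skew complement of the line.\<close>

lemma ext_d_theta2_zero:
  assumes q: "q \<in> D'" and v: "v \<in> Eperp_bundle A H Q q" and w: "w \<in> E_bundle A Q q"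
  shows "ext_d Q \<theta>\<^sub>2 q v w = 0"
proof -
  note x = line_eq(2)[OF q]
  obtain c where c: "w \<in> Q.T q" "push q w = c *\<^sub>R lvec q" using w E_bundle_iff[OF q] by blast
  have v': "v \<in> Q.T q" "\<theta>\<^sub>1 q v = 0" using v Eperp_iff[OF q] by auto
  note pv = push_in_T[OF q v'(1)]
  have "ext_d Q \<theta>\<^sub>2 q v w = d\<theta> (fst q) (push q v) (c *\<^sub>R lvec q)"
    unfolding \<theta>\<^sub>2_def using ext_d_pullback[OF theta_smooth q v'(1) c(1)] c(2) by simp
  also have "\<dots> = - (c * d\<theta> (fst q) (lvec q) (push q v))"
    using d\<theta>_scale_right[OF x pv lvec_in_T[OF q]] d\<theta>_antisym[OF x lvec_in_T[OF q] pv] by simp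
  also have "\<dots> = 0" using v' by (simp add: \<theta>\<^sub>1_def)
  finally show ?thesis .
qed

text \<open>Both forms vanish on sections of \<open>E\<^sup>\<bottom>\<close>, so their values on the bracket are given by their exterior
  derivatives; that of \<open>\<theta>\<^sub>2\<close> does not contribute.\<close>

lemma bracket_Eperp_E:
  assumes M: "mopen Q M" "M \<subseteq> D'" "q \<in> M"
    and Y: "smooth_vfield Q M Y" "\<And>p. p \<in> M \<Longrightarrow> Y p \<in> Eperp_bundle A H Q p"
    and X: "smooth_vfield Q M X" "\<And>p. p \<in> M \<Longrightarrow> X p \<in> E_bundle A Q p"
  shows "\<theta>\<^sub>2 q (bracket Q Y X q) = 0"
    and "\<theta>\<^sub>1 q (bracket Q Y X q) = - ext_d Q \<theta>\<^sub>1 q (Y q) (X q)"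
    and "bracket Q Y X q \<in> Eperp_bundle A H Q q \<longleftrightarrow> ext_d Q \<theta>\<^sub>1 q (Y q) (X q) = 0"
proof -
  have q: "q \<in> D'" using M by blast
  have ker: "\<theta>\<^sub>1 p v = 0" "\<theta>\<^sub>2 p v = 0" if "p \<in> M" "v \<in> Eperp_bundle A H Q p" for p v
    using that Eperp_iff[of p v] M by blast+
  have X': "X p \<in> Eperp_bundle A H Q p" if "p \<in> M" for p using E_subset_Eperp X(2) that M by blast
  have "ext_d Q \<theta>\<^sub>2 q (Y q) (X q) = - \<theta>\<^sub>2 q (bracket Q Y X q)"
    by (rule Q.ext_d_kernel[OF open_domain q theta2_smooth M(1,3) Y(1) X(1)]) (use ker Y(2) X' in blast)+
  then show 2: "\<theta>\<^sub>2 q (bracket Q Y X q) = 0" using ext_d_theta2_zero[OF q Y(2)[OF M(3)] X(2)[OF M(3)]] by simp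
  have "ext_d Q \<theta>\<^sub>1 q (Y q) (X q) = - \<theta>\<^sub>1 q (bracket Q Y X q)"
    by (rule Q.ext_d_kernel[OF open_domain q theta1_smooth M(1,3) Y(1) X(1)]) (use ker Y(2) X' in blast)+
  then show 1: "\<theta>\<^sub>1 q (bracket Q Y X q) = - ext_d Q \<theta>\<^sub>1 q (Y q) (X q)" by simp
  show "bracket Q Y X q \<in> Eperp_bundle A H Q q \<longleftrightarrow> ext_d Q \<theta>\<^sub>1 q (Y q) (X q) = 0"
    using Eperp_iff[OF q] Q.bracket_in_T[OF M(1,3) Y(1) X(1)] 1 2 by simp
qed

section \<open>The bundle \<open>U\<close>\<close>

text \<open>The curve \<open>{l + t a(l)}\<close> runs through the lines spanned by \<open>(1 + t c, y + t \<zeta>)\<close>. In the affine chart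
  this is \<open>(y + t \<zeta>) / (1 + t c)\<close>, with velocity \<open>\<zeta> - c y\<close> at \<open>t = 0\<close>.\<close>

lemma hom_to_vert_eq:
  assumes q: "q \<in> D'" and a: "linear a" "a (lvec q) = F (fst q) (c, \<zeta>)"
  shows "hom_to_vert Q q a = coordv (0, \<zeta> - c *\<^sub>R snd (\<psi> q)) q"
proof
  fix f
  let ?x = "fst q" and ?y = "snd (\<psi> q)"
  let ?w = "(0, \<zeta> - c *\<^sub>R ?y)"
  note x = line_eq(2)[OF q]
  define \<gamma> where "\<gamma> t = inverse (1 + t * c) *\<^sub>R (?y + t *\<^sub>R \<zeta>)" for t
  have image: "(\<lambda>l. l + t *\<^sub>R a l) ` snd q = span {F ?x (1, \<gamma> t)}" if t: "1 + t * c \<noteq> 0" for t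
  proof -
    have lin: "linear (\<lambda>l. l + t *\<^sub>R a l)"
      using a(1) by (simp add: linear_iff scaleR_add_right)
    have "lvec q + t *\<^sub>R a (lvec q) = F ?x ((1, ?y) + t *\<^sub>R (c, \<zeta>))"
      unfolding a(2) by (simp only: linear_add[OF frame_linear[OF x]] frame_scale[OF x])
    (* Normalizing the first homogeneous coordinate; this needs 1 + t c to be nonzero. *)
    also have "(1, ?y) + t *\<^sub>R (c, \<zeta>) = (1 + t * c) *\<^sub>R (1, \<gamma> t)" using t by (simp add: \<gamma>_def)
    finally have "lvec q + t *\<^sub>R a (lvec q) = (1 + t * c) *\<^sub>R F ?x (1, \<gamma> t)" by (simp only: frame_scale[OF x])
    then have "span {lvec q + t *\<^sub>R a (lvec q)} = span {F ?x (1, \<gamma> t)}" using span_singleton_scale[OF t] by simp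
    moreover have "(\<lambda>l. l + t *\<^sub>R a l) ` snd q = span {lvec q + t *\<^sub>R a (lvec q)}"
      unfolding line_span[OF q] using linear_span_image[OF lin, of "{lvec q}"] by simp
    ultimately show ?thesis by simp
  qed
  show "hom_to_vert Q q a f = coordv ?w q f"
  proof (cases "smooth_at Q q f")
    case False
    then show ?thesis by (simp add: hom_to_vert_def Q.coord_vfield_def)
  next
    case True
    let ?G = "\<lambda>u. f (the_inv_into D' \<psi> u)"
    have psi_q: "\<psi> q = (\<phi> ?x, \<gamma> 0)" using line_eq(3)[OF q] by (simp add: \<gamma>_def prod_eq_iff)
    have "(\<gamma> has_derivative (\<lambda>s. s *\<^sub>R (\<zeta> - c *\<^sub>R ?y))) (at 0)"
      unfolding \<gamma>_def[abs_def]
      by (rule derivative_eq_intros refl | simp)+ (simp add: fun_eq_iff algebra_simps)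
    then have "((\<lambda>t. (\<phi> ?x, \<gamma> t)) has_derivative (\<lambda>s. (0, s *\<^sub>R (\<zeta> - c *\<^sub>R ?y)))) (at 0)"
      by (intro has_derivative_Pair has_derivative_const)
    from has_derivative_compose[OF this, of ?G "\<lambda>u. coordv u q f"]
    have "((\<lambda>t. ?G (\<phi> ?x, \<gamma> t)) has_derivative (\<lambda>s. coordv (0, s *\<^sub>R (\<zeta> - c *\<^sub>R ?y)) q f)) (at 0)"
      using Q.smooth_at_chart_differentiable[OF True Q_chart q] psi_q by simp
    moreover have "coordv (0, s *\<^sub>R (\<zeta> - c *\<^sub>R ?y)) q f = coordv ?w q f * s" for s
      using linear_scale[OF Q.coord_vfield_linear[OF Q_chart q], of s ?w] by (simp add: scaleR_fun_apply)
    ultimately have der: "((\<lambda>t. ?G (\<phi> ?x, \<gamma> t)) has_derivative (\<lambda>s. coordv ?w q f * s)) (at 0)" by simp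
    have "((\<lambda>t. f (?x, (\<lambda>l. l + t *\<^sub>R a l) ` snd q)) has_derivative (\<lambda>s. coordv ?w q f * s)) (at 0)"
    proof (rule has_derivative_transform_within_open[OF der])
      show "open {t. 1 + t * c \<noteq> 0}" by (intro open_Collect_neq continuous_intros)
      fix t assume "t \<in> {t. 1 + t * c \<noteq> 0}"
      then have "(?x, (\<lambda>l. l + t *\<^sub>R a l) ` snd q) = (?x, span {F ?x (1, \<gamma> t)})" using image by simp
      then show "?G (\<phi> ?x, \<gamma> t) = f (?x, (\<lambda>l. l + t *\<^sub>R a l) ` snd q)"
        using Q.chart_inverse[OF Q_chart domainI[OF x, of "\<gamma> t"]] chart_apply[OF x] by simp
    qed simp
    then have "deriv (\<lambda>t. f (?x, (\<lambda>l. l + t *\<^sub>R a l) ` snd q)) 0 = coordv ?w q f"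
      by (intro DERIV_imp_deriv) (simp add: has_field_derivative_def)
    then show ?thesis using True by (simp add: hom_to_vert_def)
  qed
qed

text \<open>The two vectors differ by \<open>c\<close> times the tautological vector, which is isotropic.\<close>

lemma dtheta_modulo_line:
  assumes q: "q \<in> D'"
  shows "d\<theta> (fst q) (lvec q) (F (fst q) (0, \<zeta> - c *\<^sub>R snd (\<psi> q))) = d\<theta> (fst q) (lvec q) (F (fst q) (c, \<zeta>))"
proof -
  note x = line_eq(2)[OF q]
  have "(c, \<zeta>) = (0, \<zeta> - c *\<^sub>R snd (\<psi> q)) + c *\<^sub>R (1, snd (\<psi> q))" by simp
  then have "F (fst q) (c, \<zeta>) = F (fst q) (0, \<zeta> - c *\<^sub>R snd (\<psi> q)) + c *\<^sub>R lvec q"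
    by (simp only: linear_add[OF frame_linear[OF x]] frame_scale[OF x])
  then show ?thesis
    by (simp add: d\<theta>_add_right[OF x] d\<theta>_scale_right[OF x] d\<theta>_self[OF x] frame_in_T[OF x] T_scale)
qed

lemma U_bundle_iff:
  assumes q: "q \<in> D'"
  shows "v \<in> U_bundle A H Q q \<longleftrightarrow>
    (\<exists>\<eta>. v = coordv (0, \<eta>) q \<and> d\<theta> (fst q) (lvec q) (F (fst q) (0, \<eta>)) = 0)"
proof
  note x = line_eq(2)[OF q]
  note perp = skew_perp_span_iff[OF x frame_mem[OF x]]
  assume "v \<in> U_bundle A H Q q"
  then obtain a where a: "v = hom_to_vert Q q a" "linear a" "a ` snd q \<subseteq> skew_perp A H (fst q) (snd q)"
    by (auto simp: U_bundle_def)
  have "a (lvec q) \<in> skew_perp A H (fst q) (span {lvec q})"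
    using a(3) span_base[of "lvec q" "{lvec q}"] line_span[OF q] by auto
  then have al: "a (lvec q) \<in> H (fst q)" "d\<theta> (fst q) (lvec q) (a (lvec q)) = 0" using perp by auto
  obtain z where "a (lvec q) = F (fst q) z" using frame_surj[OF x al(1)] .
  then obtain c \<zeta> where z: "a (lvec q) = F (fst q) (c, \<zeta>)" by (metis prod.collapse)
  show "\<exists>\<eta>. v = coordv (0, \<eta>) q \<and> d\<theta> (fst q) (lvec q) (F (fst q) (0, \<eta>)) = 0"
    using hom_to_vert_eq[OF q a(2) z] dtheta_modulo_line[OF q, of \<zeta> c] al(2) z a(1) by auto
next
  note x = line_eq(2)[OF q]
  note perp = skew_perp_span_iff[OF x frame_mem[OF x]]
  assume "\<exists>\<eta>. v = coordv (0, \<eta>) q \<and> d\<theta> (fst q) (lvec q) (F (fst q) (0, \<eta>)) = 0"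
  then obtain \<eta> where \<eta>: "v = coordv (0, \<eta>) q" "d\<theta> (fst q) (lvec q) (F (fst q) (0, \<eta>)) = 0" by blast
  have "independent {lvec q}" using lvec_nonzero[OF q] by simp
  from linear_independent_extend[OF this, of "\<lambda>_. F (fst q) (0, \<eta>)"]
  obtain a where a: "linear a" "a (lvec q) = F (fst q) (0, \<eta>)" by auto
  have "a l \<in> skew_perp A H (fst q) (snd q)" if l: "l \<in> snd q" for l
  proof -
    obtain k where "l = k *\<^sub>R lvec q" using l line_span[OF q] by (auto simp: span_singleton)
    then have "a l = k *\<^sub>R F (fst q) (0, \<eta>)" using a linear_scale[OF a(1)] by simp
    then show ?thesis
      using perp \<eta>(2) frame_mem[OF x] subspace_scale[OF H_subspace[OF x]] line_span[OF q]
      by (simp add: d\<theta>_scale_right[OF x] frame_in_T[OF x])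
  qed
  moreover have "v = hom_to_vert Q q a" using hom_to_vert_eq[OF q a] \<eta> by simp
  ultimately show "v \<in> U_bundle A H Q q" using a(1) by (auto simp: U_bundle_def)
qed

lemma U_subset_E: "q \<in> D' \<Longrightarrow> v \<in> U_bundle A H Q q \<Longrightarrow> v \<in> E_bundle A Q q"
  by (auto simp: U_bundle_iff intro: vertical_in_E)

lemma U_subset_Eperp: "q \<in> D' \<Longrightarrow> v \<in> U_bundle A H Q q \<Longrightarrow> v \<in> Eperp_bundle A H Q q"
  using U_subset_E E_subset_Eperp by blast

section \<open>Extending vectors to local sections\<close>

text \<open>Extend \<open>v\<close> and two vectors transverse to the kernels of the two forms arbitrarily, and eliminate:
  first make \<open>\<theta>\<^sub>2\<close> vanish by subtracting multiples of the first transverse field, then \<open>\<theta>\<^sub>1\<close> by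
  subtracting multiples of the second, which has itself been put into the kernel of \<open>\<theta>\<^sub>2\<close>.\<close>

lemma Eperp_extension:
  assumes M: "mopen Q M" "M \<subseteq> D'" "q \<in> M" and v: "v \<in> Eperp_bundle A H Q q"
  obtains M' Y where "mopen Q M'" "q \<in> M'" "M' \<subseteq> M" "smooth_vfield Q M' Y" "Y q = v"
    "\<And>p. p \<in> M' \<Longrightarrow> Y p \<in> Eperp_bundle A H Q p"
proof -
  have q: "q \<in> D'" using M by blast
  obtain z where z: "z \<in> Q.T q" "\<theta>\<^sub>2 q z \<noteq> 0" using exists_transverse[OF q] .
  obtain w where w: "w \<in> Q.T q" "\<theta>\<^sub>2 q w = 0" "\<theta>\<^sub>1 q w \<noteq> 0" using exists_H_transverse[OF q] .
  have vT: "v \<in> Q.T q" "\<theta>\<^sub>2 q v = 0" "\<theta>\<^sub>1 q v = 0" using v Eperp_iff[OF q] by auto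
  obtain M1 E where M1: "mopen Q M1" "q \<in> M1" "M1 \<subseteq> M" and
    E: "\<forall>u\<in>{v, w, z}. smooth_vfield Q M1 (E u) \<and> E u q = u"
    using Q.tangent_vectors_extend[OF M(1,3), of "{v, w, z}"] vT z w by auto
  have f2: "smooth_fun Q K (\<lambda>p. \<theta>\<^sub>2 p (Y p))" and f1: "smooth_fun Q K (\<lambda>p. \<theta>\<^sub>1 p (Y p))"
    if "mopen Q K" "K \<subseteq> M1" "smooth_vfield Q K Y" for K Y
    using that M1 M Q.form_fun[OF theta2_smooth] Q.form_fun[OF theta1_smooth] by blast+
  define M2 where "M2 = {p \<in> M1. \<theta>\<^sub>2 p (E z p) \<noteq> 0}"
  have M2: "mopen Q M2" "q \<in> M2" "M2 \<subseteq> M1" "\<And>p. p \<in> M2 \<Longrightarrow> \<theta>\<^sub>2 p (E z p) \<noteq> 0"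
    using Q.mopen_nonzero[OF M1(1) f2[OF M1(1), of "E z"]] M1 E z by (auto simp: M2_def)
  have E2: "smooth_vfield Q M2 (E u)" if "u \<in> {v, w, z}" for u using Q.vfield_subset M2(3) E that by blast
  define Y where "Y u p = E u p - (\<theta>\<^sub>2 p (E u p) / \<theta>\<^sub>2 p (E z p)) *\<^sub>R E z p" for u p
  have Y: "smooth_vfield Q M2 (Y u)" if "u \<in> {v, w, z}" for u
    unfolding Y_def[abs_def] using that M2
    by (intro Q.vfield_diff Q.vfield_scale Q.smooth_fun_divide E2 f2) auto
  have D2: "p \<in> D'" if "p \<in> M2" for p using that M2 M1 M by blast
  have Y2: "\<theta>\<^sub>2 p (Y u p) = 0" if "p \<in> M2" "u \<in> {v, w, z}" for u p
    using M2(4)[OF that(1)] Q.vfield_T[OF E2[OF that(2)] that(1)] Q.vfield_T[OF E2[of z] that(1)]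
    by (simp add: Y_def theta2_linear D2[OF that(1)] Q.T_scale)
  have Yq: "Y v q = v" "Y w q = w" using E vT w by (auto simp: Y_def)
  define M3 where "M3 = {p \<in> M2. \<theta>\<^sub>1 p (Y w p) \<noteq> 0}"
  have M3: "mopen Q M3" "q \<in> M3" "M3 \<subseteq> M2" "\<And>p. p \<in> M3 \<Longrightarrow> \<theta>\<^sub>1 p (Y w p) \<noteq> 0"
    using Q.mopen_nonzero[OF M2(1) f1[OF M2(1,3) Y[of w]]] M2 Yq w by (auto simp: M3_def)
  have Y3: "smooth_vfield Q M3 (Y u)" if "u \<in> {v, w, z}" for u using Q.vfield_subset M3(3) Y that by blast
  define V where "V p = Y v p - (\<theta>\<^sub>1 p (Y v p) / \<theta>\<^sub>1 p (Y w p)) *\<^sub>R Y w p" for p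
  have V: "smooth_vfield Q M3 V"
    unfolding V_def[abs_def] using M3 M2(3)
    by (intro Q.vfield_diff Q.vfield_scale Q.smooth_fun_divide Y3 f1) auto
  have "V p \<in> Eperp_bundle A H Q p" if p: "p \<in> M3" for p
  proof -
    have p2: "p \<in> M2" "p \<in> D'" using subsetD[OF M3(3) p] D2 by blast+
    have T: "Y v p \<in> Q.T p" "Y w p \<in> Q.T p" using Q.vfield_T[OF Y3 p] by auto
    have "\<theta>\<^sub>2 p (V p) = 0" using T Y2[OF p2(1)] by (simp add: V_def theta2_linear p2(2) Q.T_scale)
    moreover have "\<theta>\<^sub>1 p (V p) = 0" using T M3(4)[OF p] by (simp add: V_def theta1_linear p2(2) Q.T_scale)
    ultimately show ?thesis using Eperp_iff[OF p2(2)] Q.vfield_T[OF V p] by simp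
  qed
  moreover have "V q = v" using Yq vT by (simp add: V_def)
  ultimately show ?thesis using that[OF M3(1,2) _ V] M3 M2 M1 by blast
qed

text \<open>A vector of \<open>U\<close> extends to a section of \<open>U\<close>: the constant vertical extension is corrected by a multiple
  \<open>r\<close> of a constant vertical field outside \<open>U\<close>. Since \<open>r\<close> vanishes at \<open>q\<close>, the correction changes the
  bracket with \<open>X\<close> only by a vertical vector, so the projection of the bracket is still known.\<close>

lemma U_section_with_bracket:
  assumes M: "mopen Q M" "M \<subseteq> D'" and X: "smooth_vfield Q M X"
    and m: "smooth_fun Q M m" "\<And>q. q \<in> M \<Longrightarrow> push q (X q) = m q *\<^sub>R lvec q"
    and qM: "q \<in> M" and \<eta>: "d\<theta> (fst q) (lvec q) (F (fst q) (0, \<eta>)) = 0"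
  obtains M' B k where "mopen Q M'" "q \<in> M'" "M' \<subseteq> M" "is_section Q M' (U_bundle A H Q) B" "B q = coordv (0, \<eta>) q"
    "push q (bracket Q B X q) = k *\<^sub>R lvec q + m q *\<^sub>R F (fst q) (0, \<eta>)"
proof -
  have q: "q \<in> D'" using qM M by blast
  note x = line_eq(2)[OF q]
  define g where "g \<zeta> p = d\<theta> (fst p) (lvec p) (F (fst p) (0, \<zeta>))" for \<zeta> p
  have g: "smooth_fun Q D' (g \<zeta>)" for \<zeta>
  proof (rule Q.smooth_fun_cong[OF open_domain])
    have "smooth_fun A N (\<lambda>x. contraction j x (F x (0, \<zeta>)))" for j
      using form_fun[OF contraction_smooth base_chart(2) subset_refl frame_smooth] .
    then show "smooth_fun Q D' (\<lambda>p. \<Sum>j\<in>Basis. ((1, snd (\<psi> p)) \<bullet> j) * contraction j (fst p) (F (fst p) (0, \<zeta>)))"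
      by (intro Q.smooth_fun_sum[OF open_domain] Q.smooth_fun_mult[OF open_domain fibre_coordinate_smooth] smooth_fun_lift_N)
    fix p assume p: "p \<in> D'"
    show "(\<Sum>j\<in>Basis. ((1, snd (\<psi> p)) \<bullet> j) * contraction j (fst p) (F (fst p) (0, \<zeta>))) = g \<zeta> p"
      unfolding g_def d\<theta>_frame_expand[OF line_eq(2)[OF p] frame_in_T[OF line_eq(2)[OF p]], of "(1, snd (\<psi> p))"]
      by (simp add: contraction_def frame_in_T[OF line_eq(2)[OF p]])
  qed
  (* A vertical direction outside U, from nondegeneracy of the contact form. *)
  obtain u where u: "u \<in> H (fst q)" "d\<theta> (fst q) (lvec q) u \<noteq> 0"
    using exists_nonperp[OF x frame_mem[OF x] lvec_nonzero[OF q]] .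
  obtain c \<zeta> where "u = F (fst q) (c, \<zeta>)" using frame_surj[OF x u(1)] by (metis prod.collapse)
  then obtain \<eta>\<^sub>0 where \<eta>\<^sub>0: "g \<eta>\<^sub>0 q \<noteq> 0" using u(2) dtheta_modulo_line[OF q, of \<zeta> c] g_def by metis
  define M' where "M' = {p \<in> M. g \<eta>\<^sub>0 p \<noteq> 0}"
  have M': "mopen Q M'" "q \<in> M'" "M' \<subseteq> M" "M' \<subseteq> D'" "\<And>p. p \<in> M' \<Longrightarrow> g \<eta>\<^sub>0 p \<noteq> 0"
    using Q.mopen_nonzero[OF M(1) Q.smooth_fun_subset[OF g M(2)]] qM \<eta>\<^sub>0 M by (auto simp: M'_def)
  define r where "r p = - (g \<eta> p / g \<eta>\<^sub>0 p)" for p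
  have r: "smooth_fun Q M' r"
    unfolding r_def[abs_def]
    by (intro Q.smooth_fun_minus Q.smooth_fun_divide M' Q.smooth_fun_subset[OF g M'(4)])
  have rq: "r q = 0" using \<eta> by (simp add: r_def g_def)
  define B where "B p = coordv (0, \<eta>) p + r p *\<^sub>R coordv (0, \<eta>\<^sub>0) p" for p
  have sm: "smooth_vfield Q M' (coordv e)" for e by (rule Q.vfield_subset[OF coordv_smooth M'(4)])
  have XM': "smooth_vfield Q M' X" by (rule Q.vfield_subset[OF X M'(3)])
  have B: "smooth_vfield Q M' B" unfolding B_def[abs_def] by (intro Q.vfield_add Q.vfield_scale sm r)
  have "B p \<in> U_bundle A H Q p" if p: "p \<in> M'" for p
  proof -
    have pD: "p \<in> D'" using p M' by blast
    note xp = line_eq(2)[OF pD]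
    note lin = Q.coord_vfield_linear[OF Q_chart pD]
    have "B p = coordv ((0, \<eta>) + r p *\<^sub>R (0, \<eta>\<^sub>0)) p"
      by (simp only: B_def linear_add[OF lin] linear_scale[OF lin])
    then have "B p = coordv (0, \<eta> + r p *\<^sub>R \<eta>\<^sub>0) p" by simp
    moreover have "F (fst p) (0, \<eta> + r p *\<^sub>R \<eta>\<^sub>0) = F (fst p) (0, \<eta>) + r p *\<^sub>R F (fst p) (0, \<eta>\<^sub>0)"
      using linear_add[OF frame_linear[OF xp], of "(0, \<eta>)" "r p *\<^sub>R (0, \<eta>\<^sub>0)"] frame_scale[OF xp, of "r p" "(0, \<eta>\<^sub>0)"]
      by simp
    then have "g (\<eta> + r p *\<^sub>R \<eta>\<^sub>0) p = g \<eta> p + r p * g \<eta>\<^sub>0 p"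
      unfolding g_def
      by (simp add: d\<theta>_add_right[OF xp] d\<theta>_scale_right[OF xp] frame_in_T[OF xp] T_scale)
    then have "g (\<eta> + r p *\<^sub>R \<eta>\<^sub>0) p = 0" using M'(5)[OF p] by (simp add: r_def)
    ultimately show ?thesis using U_bundle_iff[OF pD] unfolding g_def by blast
  qed
  then have sec: "is_section Q M' (U_bundle A H Q) B" using B by (simp add: is_section_def)
  have "bracket Q B X q = bracket Q (coordv (0, \<eta>)) X q + bracket Q (\<lambda>p. r p *\<^sub>R coordv (0, \<eta>\<^sub>0) p) X q"
    unfolding B_def[abs_def] by (intro Q.bracket_add_left[OF M'(1,2)] sm Q.vfield_scale r XM')
  also have "bracket Q (\<lambda>p. r p *\<^sub>R coordv (0, \<eta>\<^sub>0) p) X q = - (X q r *\<^sub>R coordv (0, \<eta>\<^sub>0) q)"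
    using Q.bracket_scale_left[OF M'(1,2) Q.smooth_atI[OF M'(1,2) r] sm XM'] rq by simp
  finally have "push q (bracket Q B X q) = push q (bracket Q (coordv (0, \<eta>)) X q - X q r *\<^sub>R coordv (0, \<eta>\<^sub>0) q)"
    by (simp only: diff_conv_add_uminus)
  also have "\<dots> = push q (bracket Q (coordv (0, \<eta>)) X q)"
    by (simp add: pushforward_diff pushforward_scale push_vertical[OF q])
  also have "\<dots> = coordv (0, \<eta>) q m *\<^sub>R lvec q + m q *\<^sub>R F (fst q) (0, \<eta>)"
    by (rule push_bracket_vertical[OF M X m qM])
  finally have "push q (bracket Q B X q) = coordv (0, \<eta>) q m *\<^sub>R lvec q + m q *\<^sub>R F (fst q) (0, \<eta>)" .
  moreover have "B q = coordv (0, \<eta>) q" using rq by (simp add: B_def)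
  ultimately show ?thesis using that[OF M'(1-3) sec] by blast
qed

end

section \<open>The skew complement and the contact torsion\<close>

locale contact_path_chart = contact_chart A H D \<phi> N h\<^sub>0 h D' \<psi> Q \<theta>
  for A :: "('m, 'e::euclidean_space) atlas" and H D \<phi> N h\<^sub>0
    and h :: "'m \<Rightarrow> 'f::euclidean_space \<Rightarrow> 'm tvec" and D' \<psi> Q \<theta> +
  fixes S :: "'m line set" and W :: "'m line \<Rightarrow> 'm line tvec set"
  assumes path_geometry: "contact_path_geometry A Q S W"
begin

lemma open_S: "mopen Q S"
  using path_geometry by (simp add: contact_path_geometry_def)

lemma W_subset_E: "q \<in> S \<Longrightarrow> w \<in> W q \<Longrightarrow> w \<in> E_bundle A Q q"
proof -
  assume q: "q \<in> S" "w \<in> W q"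
  from bspec[OF path_geometry[unfolded contact_path_geometry_def, THEN conjunct2, THEN conjunct2] q(1)]
  have "W q \<subseteq> E_bundle A Q q" by (rule conjunct1)
  then show ?thesis using q(2) by (rule subsetD)
qed

lemma W_section:
  assumes "p \<in> S" "p \<in> D'"
  obtains M X where "mopen Q M" "p \<in> M" "M \<subseteq> S" "M \<subseteq> D'" "smooth_vfield Q M X"
    "\<forall>q\<in>M. W q = span {X q}" "\<forall>q\<in>M. X q \<in> E_bundle A Q q" "push p (X p) \<noteq> 0"
proof -
  obtain M X where M: "mopen Q M" "p \<in> M" "M \<subseteq> S" "smooth_vfield Q M X"
    "\<forall>q\<in>M. X q \<noteq> 0 \<and> W q = span {X q}"
    using path_geometry[unfolded contact_path_geometry_def line_subbundle_def, THEN conjunct2, THEN conjunct1] assms(1)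
    by blast
  have XW: "X q \<in> W q" if "q \<in> M" for q using bspec[OF M(5) that] span_base[of "X q" "{X q}"] by simp
  have XE: "X q \<in> E_bundle A Q q" if "q \<in> M" for q using W_subset_E[OF subsetD[OF M(3) that] XW[OF that]] .
  have "push p (X p) \<noteq> 0"
  proof
    assume "push p (X p) = 0"
    then have "X p \<in> vert_bundle A Q p" using Q.vfield_T[OF M(4,2)] by (simp add: vert_bundle_def)
    moreover have "vert_bundle A Q p \<inter> W p = {0}" using path_geometry assms(1) by (simp add: contact_path_geometry_def)
    ultimately have "X p = 0" using XW[OF M(2)] by blast
    then show False using bspec[OF M(5,2)] by simp
  qed
  moreover have "mopen Q (M \<inter> D')" using M(1) open_domain by (rule Q.mopen_Int)
  moreover have "smooth_vfield Q (M \<inter> D') X" by (rule Q.vfield_subset[OF M(4)]) blast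
  moreover have "\<forall>q\<in>M \<inter> D'. W q = span {X q}" "\<forall>q\<in>M \<inter> D'. X q \<in> E_bundle A Q q" using M(5) XE by simp_all
  moreover have "M \<inter> D' \<subseteq> S" using M(3) by blast
  ultimately show ?thesis
    using that[of "M \<inter> D'" X] M(2) assms(2) by simp
qed

text \<open>The skew complement of \<open>W\<close> with respect to \<open>d\<theta>\<^sub>1\<close> alone. It turns out to be the skew complement for
  every filtered frame.\<close>

definition W_complement :: "'m line \<Rightarrow> 'm line tvec set" where
  "W_complement p = {v \<in> Eperp_bundle A H Q p. \<forall>w\<in>W p. ext_d Q \<theta>\<^sub>1 p v w = 0}"

lemma Eperp_in_T: "p \<in> D' \<Longrightarrow> v \<in> Eperp_bundle A H Q p \<Longrightarrow> v \<in> Q.T p"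
  using Eperp_iff by blast

lemma W_in_T: "p \<in> D' \<Longrightarrow> p \<in> S \<Longrightarrow> w \<in> W p \<Longrightarrow> w \<in> Q.T p"
  using W_subset_E E_bundle_iff by blast

lemma Eperp_subspace:
  assumes p: "p \<in> D'" shows "subspace (Eperp_bundle A H Q p)"
  unfolding subspace_def
  using p by (auto simp: Eperp_iff[OF p] theta1_linear theta2_linear Q.T_add Q.T_scale Q.T_zero
      Q.form_zero[OF theta2_smooth] Q.form_zero[OF theta1_smooth])

lemma W_complement_subspace:
  assumes p: "p \<in> D'" "p \<in> S" shows "subspace (W_complement p)"
proof -
  note e = Q.ext_d_add_left[OF open_domain p(1) theta1_smooth] Q.ext_d_scale_left[OF open_domain p(1) theta1_smooth]
  have e0: "ext_d Q \<theta>\<^sub>1 p 0 w = 0" if "w \<in> Q.T p" for w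
    using e(2)[OF Q.T_zero that, of 0] by simp
  show ?thesis
    unfolding subspace_def W_complement_def
    using Eperp_subspace[OF p(1)] W_in_T[OF p] Eperp_in_T[OF p(1)]
    by (auto simp: subspace_def e e0)
qed

text \<open>At \<open>p\<close> the frame is \<open>\<phi>\<^sub>2 = a\<^sub>2 \<theta>\<^sub>2\<close> and \<open>\<phi>\<^sub>1 = a\<^sub>1 \<theta>\<^sub>2 + b\<^sub>1 \<theta>\<^sub>1\<close> on tangent vectors, with \<open>b\<^sub>1 \<noteq> 0\<close>
  by independence. All these forms vanish on sections of \<open>E\<^sup>\<bottom>\<close>, so their exterior derivatives on \<open>E\<^sup>\<bottom>\<close>
  are minus their values on a bracket and satisfy the same linear relations; the terms with \<open>\<theta>\<^sub>2\<close> drop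
  out when one argument lies in \<open>W\<close>.\<close>

lemma frame_symplectic_form_eq:
  assumes frame: "filtered_frame A H Q M0 \<phi>\<^sub>2 \<phi>\<^sub>1" and p: "p \<in> M0" "p \<in> D'" "p \<in> S"
  obtains b where "b \<noteq> 0" "\<And>v w. v \<in> Eperp_bundle A H Q p \<Longrightarrow> w \<in> W p \<Longrightarrow>
    frame_symplectic_form Q \<phi>\<^sub>2 \<phi>\<^sub>1 p v w = b * ext_d Q \<theta>\<^sub>1 p v w"
proof -
  have M0: "mopen Q M0" and sm: "smooth_oneform Q M0 \<phi>\<^sub>2" "smooth_oneform Q M0 \<phi>\<^sub>1"
    and ann: "\<And>q. q \<in> M0 \<Longrightarrow> \<phi>\<^sub>2 q \<in> Ann Q (Eperp_bundle A H Q) q" "\<And>q. q \<in> M0 \<Longrightarrow> \<phi>\<^sub>1 q \<in> Ann Q (Eperp_bundle A H Q) q"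
    and ind: "\<phi>\<^sub>2 p \<noteq> \<phi>\<^sub>1 p" "independent {\<phi>\<^sub>2 p, \<phi>\<^sub>1 p}" and H: "span {\<phi>\<^sub>2 p} = Ann Q (H_bundle A H Q) p"
    using frame p(1) by (auto simp: filtered_frame_def)
  obtain a2 b2 where c2: "\<And>v. v \<in> Q.T p \<Longrightarrow> \<phi>\<^sub>2 p v = a2 * \<theta>\<^sub>2 p v + b2 * \<theta>\<^sub>1 p v"
    using Ann_Eperp_combination[OF p(2) ann(1)[OF p(1)]] by blast
  obtain a1 b1 where c1: "\<And>v. v \<in> Q.T p \<Longrightarrow> \<phi>\<^sub>1 p v = a1 * \<theta>\<^sub>2 p v + b1 * \<theta>\<^sub>1 p v"
    using Ann_Eperp_combination[OF p(2) ann(2)[OF p(1)]] by blast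
  obtain w where w: "w \<in> Q.T p" "\<theta>\<^sub>2 p w = 0" "\<theta>\<^sub>1 p w \<noteq> 0" using exists_H_transverse[OF p(2)] .
  have "\<phi>\<^sub>2 p \<in> Ann Q (H_bundle A H Q) p" using H span_base[of "\<phi>\<^sub>2 p" "{\<phi>\<^sub>2 p}"] by simp
  moreover have "w \<in> H_bundle A H Q p" using w H_bundle_iff[OF p(2)] by simp
  ultimately have "\<phi>\<^sub>2 p w = 0" unfolding Ann_def by blast
  then have b2: "b2 = 0" using c2[OF w(1)] w by simp
  have b1: "b1 \<noteq> 0"
  proof
    assume "b1 = 0"
    then have "\<phi>\<^sub>1 p v = 0" if "v \<in> H_bundle A H Q p" for v
      using that c1[of v] H_bundle_iff[OF p(2)] by simp
    then have "\<phi>\<^sub>1 p \<in> span {\<phi>\<^sub>2 p}" using ann(2)[OF p(1)] H by (simp add: Ann_def)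
    then show False using ind by (simp add: insert_commute[of "\<phi>\<^sub>2 p"] independent_insert)
  qed
  have "frame_symplectic_form Q \<phi>\<^sub>2 \<phi>\<^sub>1 p v w = b1 * ext_d Q \<theta>\<^sub>1 p v w"
    if v: "v \<in> Eperp_bundle A H Q p" and w: "w \<in> W p" for v w
  proof -
    obtain M X where M': "mopen Q M" "p \<in> M" "M \<subseteq> S" "M \<subseteq> D'" "smooth_vfield Q M X"
      "\<forall>q\<in>M. W q = span {X q}" "\<forall>q\<in>M. X q \<in> E_bundle A Q q" "push p (X p) \<noteq> 0"
      using W_section[OF p(3,2)] .
      note M = M'[rule_format]
    obtain c where c: "w = c *\<^sub>R X p" using w M(6)[OF M(2)] by (auto simp: span_singleton)
    define Z where "Z q = c *\<^sub>R X q" for q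
    have o: "mopen Q (M \<inter> M0)" "p \<in> M \<inter> M0" "M \<inter> M0 \<subseteq> D'" using M M0 p(1) by (auto intro: Q.mopen_Int)
    obtain K Y where K: "mopen Q K" "p \<in> K" "K \<subseteq> M \<inter> M0" "smooth_vfield Q K Y" "Y p = v"
      "\<And>q. q \<in> K \<Longrightarrow> Y q \<in> Eperp_bundle A H Q q"
      using Eperp_extension[OF o(1,3,2) v] by metis
    have KD: "K \<subseteq> D'" using K M by blast
    have Z: "smooth_vfield Q K Z"
      unfolding Z_def[abs_def] by (rule Q.vfield_cscale[OF Q.vfield_subset[OF M(5)]]) (use K in blast)
    have ZE: "Z q \<in> E_bundle A Q q" if "q \<in> K" for q
    proof -
      have q: "q \<in> D'" "q \<in> M" using that K KD by auto
      then obtain k where "X q \<in> Q.T q" "push q (X q) = k *\<^sub>R lvec q" using M(7) E_bundle_iff by blast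
      then have "push q (Z q) = (c * k) *\<^sub>R lvec q" by (simp add: Z_def pushforward_scale)
      then show ?thesis using E_bundle_iff[OF q(1)] Q.vfield_T[OF Z that] by blast
    qed
    have ZEp: "Z q \<in> Eperp_bundle A H Q q" if "q \<in> K" for q using ZE E_subset_Eperp KD that by blast
    let ?b = "bracket Q Y Z p"
    have vw: "Y p = v" "Z p = w" using K c by (auto simp: Z_def)
    have 2: "ext_d Q \<phi>\<^sub>2 p (Y p) (Z p) = - \<phi>\<^sub>2 p ?b"
      by (rule Q.ext_d_kernel[OF M0 p(1) sm(1) K(1,2,4) Z]) (use ann K ZEp in \<open>auto simp: Ann_def\<close>)
    have 1: "ext_d Q \<phi>\<^sub>1 p (Y p) (Z p) = - \<phi>\<^sub>1 p ?b"
      by (rule Q.ext_d_kernel[OF M0 p(1) sm(2) K(1,2,4) Z]) (use ann K ZEp in \<open>auto simp: Ann_def\<close>)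
    have bT: "?b \<in> Q.T p" by (rule Q.bracket_in_T[OF K(1,2,4) Z])
    note br = bracket_Eperp_E[OF K(1) KD K(2,4,6) Z ZE]
    show ?thesis
      using 1 2 br(1,2) c1[OF bT] c2[OF bT] b2 by (simp add: frame_symplectic_form_def vw)
  qed
  then show ?thesis by (rule that[OF b1])
qed

lemma frame_skew_complement_eq:
  assumes "filtered_frame A H Q M0 \<phi>\<^sub>2 \<phi>\<^sub>1" "p \<in> M0" "p \<in> D'" "p \<in> S"
  shows "frame_skew_complement A H Q W \<phi>\<^sub>2 \<phi>\<^sub>1 p = W_complement p"
proof (rule frame_symplectic_form_eq[OF assms])
  fix b :: real
  assume b: "b \<noteq> 0" and eq: "\<And>v w. v \<in> Eperp_bundle A H Q p \<Longrightarrow> w \<in> W p \<Longrightarrow>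
    frame_symplectic_form Q \<phi>\<^sub>2 \<phi>\<^sub>1 p v w = b * ext_d Q \<theta>\<^sub>1 p v w"
  have "frame_symplectic_form Q \<phi>\<^sub>2 \<phi>\<^sub>1 p v w = 0 \<longleftrightarrow> ext_d Q \<theta>\<^sub>1 p v w = 0"
    if "v \<in> Eperp_bundle A H Q p" "w \<in> W p" for v w
    using eq[OF that] b by simp
  then show ?thesis unfolding frame_skew_complement_def W_complement_def by blast
qed

lemma section_in_E: "is_section Q M W X \<Longrightarrow> M \<subseteq> S \<Longrightarrow> q \<in> M \<Longrightarrow> X q \<in> E_bundle A Q q"
  unfolding is_section_def using W_subset_E[of q "X q"] by blast

text \<open>This is what makes the torsion depend only on values at the point: it places \<open>[B, X]\<close> in \<open>E\<^sup>\<bottom>\<close>,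
  where \<open>d\<theta>\<^sub>1\<close> can be applied to it.\<close>

lemma bracket_U_W_in_Eperp:
  assumes M: "mopen Q M" "M \<subseteq> S" "M \<subseteq> D'" "q \<in> M"
    and B: "is_section Q M (U_bundle A H Q) B" and X: "is_section Q M W X"
  shows "bracket Q B X q \<in> Eperp_bundle A H Q q"
proof -
  have q: "q \<in> D'" using M by blast
  have X': "smooth_vfield Q M X" "\<And>q. q \<in> M \<Longrightarrow> X q \<in> E_bundle A Q q"
    using X section_in_E[OF X M(2)] by (auto simp: is_section_def)
  have B': "smooth_vfield Q M B" "\<And>q. q \<in> M \<Longrightarrow> B q \<in> Eperp_bundle A H Q q"
    using B U_subset_Eperp M(3) by (auto simp: is_section_def)
  obtain m where m: "smooth_fun Q M m" "\<And>q. q \<in> M \<Longrightarrow> push q (X q) = m q *\<^sub>R lvec q"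
    using E_section_multiplier[OF M(1,3) X'] by metis
  obtain \<eta> where \<eta>: "B q = coordv (0, \<eta>) q" "d\<theta> (fst q) (lvec q) (F (fst q) (0, \<eta>)) = 0"
    using B M(4) U_bundle_iff[OF q] by (auto simp: is_section_def)
  have "ext_d Q \<theta>\<^sub>1 q (B q) (X q) = 0"
    unfolding \<eta>(1) using ext_d_theta1_vertical[OF M(1,3) X'(1) m M(4)] \<eta>(2) by simp
  then show ?thesis using bracket_Eperp_E(3)[OF M(1,3,4) B' X'] by simp
qed

text \<open>The class of \<open>[X, [X', B]]\<close> modulo \<open>E\<^sup>\<bottom>\<close> is zero if and only if \<open>[X', B]\<close> is skew orthogonal to \<open>X\<close>:
  the inner bracket is a section of \<open>E\<^sup>\<bottom>\<close>, so the outer bracket is controlled by \<open>d\<theta>\<^sub>1\<close>.\<close>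

lemma torsion_zero_iff:
  assumes M: "mopen Q M" "M \<subseteq> S" "q \<in> M" "q \<in> D'"
    and X: "is_section Q M W X" and X': "is_section Q M W X'" and B: "is_section Q M (U_bundle A H Q) B"
  shows "contact_torsion A H Q X X' B q = Eperp_bundle A H Q q \<longleftrightarrow>
    ext_d Q \<theta>\<^sub>1 q (bracket Q B X' q) (X q) = 0"
proof -
  let ?K = "M \<inter> D'"
  have K: "mopen Q ?K" "?K \<subseteq> S" "?K \<subseteq> D'" "q \<in> ?K" using M open_domain by (auto intro: Q.mopen_Int)
  have sec: "is_section Q ?K W X" "is_section Q ?K W X'" "is_section Q ?K (U_bundle A H Q) B"
    using X X' B Q.vfield_subset[of M _ ?K] by (auto simp: is_section_def)
  note sm = sec[unfolded is_section_def, THEN conjunct1]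
  let ?Y = "bracket Q B X'"
  have Y: "smooth_vfield Q ?K ?Y" by (rule Q.vfield_bracket[OF K(1) sm(3,2)])
  have YE: "?Y p \<in> Eperp_bundle A H Q p" if "p \<in> ?K" for p
    by (rule bracket_U_W_in_Eperp[OF K(1-3) that sec(3,2)])
  have XE: "X p \<in> E_bundle A Q p" if "p \<in> ?K" for p by (rule section_in_E[OF sec(1) K(2) that])
  have neg: "bracket Q X' B = (\<lambda>p. (-1) *\<^sub>R ?Y p)"
    using Q.bracket_antisym[of X' B] by (simp add: fun_eq_iff)
  have "bracket Q (\<lambda>p. (-1) *\<^sub>R ?Y p) X q = (-1) *\<^sub>R bracket Q ?Y X q"
    using Q.bracket_scale_left[OF K(1,4) Q.smooth_atI[OF K(1,4) Q.smooth_fun_const] Y sm(1), of "-1"]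
      Q.tv_const[OF Q.vfield_T[OF sm(1) K(4)]] by simp
  then have eq: "bracket Q X (bracket Q X' B) q = bracket Q ?Y X q"
    unfolding neg using Q.bracket_antisym[of X "\<lambda>p. (-1) *\<^sub>R ?Y p" q] by simp
  note sub = Eperp_subspace[OF M(4)]
  have "contact_torsion A H Q X X' B q = Eperp_bundle A H Q q \<longleftrightarrow> bracket Q ?Y X q \<in> Eperp_bundle A H Q q"
  proof
    assume "contact_torsion A H Q X X' B q = Eperp_bundle A H Q q"
    moreover have "bracket Q ?Y X q + 0 \<in> contact_torsion A H Q X X' B q"
      unfolding contact_torsion_def eq using subspace_0[OF sub] by blast
    ultimately show "bracket Q ?Y X q \<in> Eperp_bundle A H Q q" by simp
  next
    assume b: "bracket Q ?Y X q \<in> Eperp_bundle A H Q q"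
    show "contact_torsion A H Q X X' B q = Eperp_bundle A H Q q"
      unfolding contact_torsion_def eq
    proof (intro equalityI subsetI)
      fix e assume "e \<in> {bracket Q ?Y X q + e |e. e \<in> Eperp_bundle A H Q q}"
      then show "e \<in> Eperp_bundle A H Q q" using subspace_add[OF sub b] by auto
    next
      fix e assume "e \<in> Eperp_bundle A H Q q"
      then have "e - bracket Q ?Y X q \<in> Eperp_bundle A H Q q" using subspace_diff[OF sub _ b] by simp
      moreover have "e = bracket Q ?Y X q + (e - bracket Q ?Y X q)" by simp
      ultimately show "e \<in> {bracket Q ?Y X q + e |e. e \<in> Eperp_bundle A H Q q}" by blast
    qed
  qed
  then show ?thesis using bracket_Eperp_E(3)[OF K(1,3,4) Y YE sm(1) XE] by simp
qed

abbreviation del :: "'m line \<Rightarrow> 'm line tvec set" where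
  "del \<equiv> del_bundle Q S (U_bundle A H Q) W"

lemma bracket_in_del:
  assumes "mopen Q M" "p \<in> M" "M \<subseteq> S" "is_section Q M (U_bundle A H Q) B" "is_section Q M W X"
  shows "bracket Q B X p \<in> del p"
  unfolding del_bundle_def by (rule span_base) (use assms in blast)

lemma U_section_in_del:
  assumes "mopen Q M" "p \<in> M" "M \<subseteq> S" "is_section Q M (U_bundle A H Q) B"
  shows "B p \<in> del p"
  unfolding del_bundle_def by (rule span_base) (use assms in blast)

lemma W_section_in_del:
  assumes "mopen Q M" "p \<in> M" "M \<subseteq> S" "is_section Q M W X"
  shows "X p \<in> del p"
  unfolding del_bundle_def by (rule span_base) (use assms in blast)

lemma torsion_vanishes_at_if_complement_eq:
  assumes eq: "W_complement q = del q"
    and M: "mopen Q M" "M \<subseteq> S" "q \<in> M" "q \<in> D'"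
    and X: "is_section Q M W X" and X': "is_section Q M W X'" and B: "is_section Q M (U_bundle A H Q) B"
  shows "contact_torsion A H Q X X' B q = Eperp_bundle A H Q q"
proof -
  have "bracket Q B X' q \<in> W_complement q" unfolding eq by (rule bracket_in_del[OF M(1,3,2) B X'])
  moreover have "X q \<in> W q" using X M(3) by (simp add: is_section_def)
  ultimately show ?thesis using torsion_zero_iff[OF M X X' B] by (simp add: W_complement_def)
qed

lemma del_subset_complement:
  assumes torsion: "contact_torsion_vanishes A H Q S W" and p: "p \<in> S" "p \<in> D'"
  shows "del p \<subseteq> W_complement p"
  unfolding del_bundle_def
proof (rule span_minimal[OF _ W_complement_subspace[OF p(2,1)]])
  obtain M X where M': "mopen Q M" "p \<in> M" "M \<subseteq> S" "M \<subseteq> D'" "smooth_vfield Q M X"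
    "\<forall>q\<in>M. W q = span {X q}" "\<forall>q\<in>M. X q \<in> E_bundle A Q q" "push p (X p) \<noteq> 0"
    using W_section[OF p] .
    note M = M'[rule_format]
  obtain m where m: "smooth_fun Q M m" "\<And>q. q \<in> M \<Longrightarrow> push q (X q) = m q *\<^sub>R lvec q"
    using E_section_multiplier[OF M(1,4,5,7)] by metis
  have secX: "is_section Q M W X" using M(5,6) by (auto simp: is_section_def span_base)
  note XT = Q.vfield_T[OF M(5,2)]
  have memI: "v \<in> W_complement p" if v: "v \<in> Eperp_bundle A H Q p" "ext_d Q \<theta>\<^sub>1 p v (X p) = 0" for v
  proof -
    have "ext_d Q \<theta>\<^sub>1 p v (c *\<^sub>R X p) = 0" for c
      using Q.ext_d_scale_right[OF open_domain p(2) theta1_smooth Eperp_in_T[OF p(2) v(1)] XT] v(2) by simp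
    then show ?thesis using v(1) M(6)[OF M(2)] by (auto simp: W_complement_def span_singleton)
  qed
  have U: "v \<in> W_complement p" if vU: "v \<in> U_bundle A H Q p" for v
  proof -
    obtain \<eta> where \<eta>: "v = coordv (0, \<eta>) p" "d\<theta> (fst p) (lvec p) (F (fst p) (0, \<eta>)) = 0"
      using vU U_bundle_iff[OF p(2)] by blast
    have "ext_d Q \<theta>\<^sub>1 p v (X p) = 0"
      unfolding \<eta>(1) using ext_d_theta1_vertical[OF M(1,4,5) m M(2)] \<eta>(2) by simp
    then show ?thesis using memI U_subset_Eperp[OF p(2) vU] by blast
  qed
  have Wc: "w \<in> W_complement p" if w: "w \<in> W p" for w
  proof -
    obtain c where "w = c *\<^sub>R X p" using w M(6)[OF M(2)] by (auto simp: span_singleton)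
    then have "ext_d Q \<theta>\<^sub>1 p w (X p) = 0"
      using Q.ext_d_scale_left[OF open_domain p(2) theta1_smooth XT XT] Q.ext_d_self[OF open_domain p(2) theta1_smooth XT]
      by simp
    then show ?thesis using memI E_subset_Eperp[OF p(2) W_subset_E[OF p(1) w]] by blast
  qed
  have br: "bracket Q B X' p \<in> W_complement p"
    if K: "mopen Q K" "p \<in> K" "K \<subseteq> S" "is_section Q K (U_bundle A H Q) B" "is_section Q K W X'" for B X' K
  proof -
    let ?L = "K \<inter> M"
    have L: "mopen Q ?L" "p \<in> ?L" "?L \<subseteq> S" "?L \<subseteq> D'" using K M by (auto intro: Q.mopen_Int)
    have sec: "is_section Q ?L W X" "is_section Q ?L W X'" "is_section Q ?L (U_bundle A H Q) B"
      using secX K(4,5) Q.vfield_subset[of M X ?L] Q.vfield_subset[of K _ ?L] by (auto simp: is_section_def)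
    have "contact_torsion A H Q X X' B p = Eperp_bundle A H Q p"
      using torsion L sec unfolding contact_torsion_vanishes_def by blast
    then have "ext_d Q \<theta>\<^sub>1 p (bracket Q B X' p) (X p) = 0"
      using torsion_zero_iff[OF L(1,3,2) p(2) sec] by simp
    then show ?thesis using memI bracket_U_W_in_Eperp[OF L(1,3,4,2) sec(3,2)] by blast
  qed
  show "{B p | B N. mopen Q N \<and> p \<in> N \<and> N \<subseteq> S \<and> is_section Q N (U_bundle A H Q) B} \<union>
      {X p | X N. mopen Q N \<and> p \<in> N \<and> N \<subseteq> S \<and> is_section Q N W X} \<union>
      {bracket Q B X p | B X N. mopen Q N \<and> p \<in> N \<and> N \<subseteq> S \<and>
         is_section Q N (U_bundle A H Q) B \<and> is_section Q N W X} \<subseteq> W_complement p"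
    using U Wc br by (auto simp: is_section_def)
qed

text \<open>Given \<open>v\<close> in the skew complement, a section \<open>B\<close> of \<open>U\<close> and a number \<open>s\<close> are chosen such that \<open>[B, X]\<close> and
  \<open>s X\<close> together have the same projection as \<open>v\<close>. The remainder is vertical and still lies in the
  skew complement, and the vertical vectors there are exactly those of \<open>U\<close>.\<close>

lemma complement_subset_del:
  assumes p: "p \<in> S" "p \<in> D'" and sub: "del p \<subseteq> W_complement p"
  shows "W_complement p \<subseteq> del p"
proof
  fix v assume v: "v \<in> W_complement p"
  note x = line_eq(2)[OF p(2)]
  obtain M X where M': "mopen Q M" "p \<in> M" "M \<subseteq> S" "M \<subseteq> D'" "smooth_vfield Q M X"
    "\<forall>q\<in>M. W q = span {X q}" "\<forall>q\<in>M. X q \<in> E_bundle A Q q" "push p (X p) \<noteq> 0"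
    using W_section[OF p] .
    note M = M'[rule_format]
  obtain m where m: "smooth_fun Q M m" "\<And>q. q \<in> M \<Longrightarrow> push q (X q) = m q *\<^sub>R lvec q"
    using E_section_multiplier[OF M(1,4,5,7)] by metis
  have mp: "m p \<noteq> 0" using M(8) m(2)[OF M(2)] by auto
  have secX: "is_section Q M W X" using M(5,6) by (auto simp: is_section_def span_base)
  have subdel: "subspace (del p)" unfolding del_bundle_def by (rule subspace_span)
  have subC: "subspace (W_complement p)" by (rule W_complement_subspace[OF p(2,1)])
  have XC: "X p \<in> del p" by (rule W_section_in_del[OF M(1-3) secX])
  have vE: "v \<in> Eperp_bundle A H Q p" "v \<in> Q.T p"
    using v Eperp_in_T[OF p(2)] by (auto simp: W_complement_def)
  have vH: "push p v \<in> H (fst p)" "d\<theta> (fst p) (lvec p) (push p v) = 0"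
    using vE Eperp_iff[OF p(2), of v] H_bundle_iff[OF p(2), of v] by (auto simp: H_bundle_def \<theta>\<^sub>1_def)
  obtain c \<zeta> where c: "push p v = F (fst p) (c, \<zeta>)" using frame_surj[OF x vH(1)] by (metis prod.collapse)
  define \<eta> where "\<eta> = \<zeta> - c *\<^sub>R snd (\<psi> p)"
  have \<eta>0: "d\<theta> (fst p) (lvec p) (F (fst p) (0, \<eta>)) = 0"
    using dtheta_modulo_line[OF p(2), of \<zeta> c] vH(2) c by (simp add: \<eta>_def)
  have push_v: "push p v = F (fst p) (0, \<eta>) + c *\<^sub>R lvec p"
  proof -
    have "(c, \<zeta>) = (0, \<eta>) + c *\<^sub>R (1, snd (\<psi> p))" by (simp add: \<eta>_def)
    then show ?thesis unfolding c by (simp only: linear_add[OF frame_linear[OF x]] frame_scale[OF x])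
  qed
  (* [B, X] projects to m p times the vector of H belonging to B, whence the factor 1 / m p. *)
  define \<epsilon> where "\<epsilon> = inverse (m p) *\<^sub>R \<eta>"
  have F\<epsilon>: "F (fst p) (0, \<epsilon>) = inverse (m p) *\<^sub>R F (fst p) (0, \<eta>)"
    using frame_scale[OF x, of "inverse (m p)" "(0, \<eta>)"] by (simp add: \<epsilon>_def)
  have "d\<theta> (fst p) (lvec p) (F (fst p) (0, \<epsilon>)) = 0"
    unfolding F\<epsilon> using \<eta>0 d\<theta>_scale_right[OF x frame_in_T[OF x] frame_in_T[OF x]] by simp
  from U_section_with_bracket[OF M(1,4,5) m M(2) this]
  obtain K B k where K: "mopen Q K" "p \<in> K" "K \<subseteq> M" "is_section Q K (U_bundle A H Q) B"
    "push p (bracket Q B X p) = k *\<^sub>R lvec p + m p *\<^sub>R F (fst p) (0, \<epsilon>)" by metis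
  have KX: "is_section Q K W X" using secX K(3) Q.vfield_subset[of M X K] by (auto simp: is_section_def)
  have KS: "K \<subseteq> S" using K(3) M(3) by blast
  have bdel: "bracket Q B X p \<in> del p" by (rule bracket_in_del[OF K(1,2) KS K(4) KX])
  have push_b: "push p (bracket Q B X p) = k *\<^sub>R lvec p + F (fst p) (0, \<eta>)" using K(5) mp by (simp add: F\<epsilon>)
  define s where "s = (c - k) / m p"
  define u where "u = v - bracket Q B X p - s *\<^sub>R X p"
  have uC: "u \<in> W_complement p"
    unfolding u_def using v bdel XC sub by (intro subspace_diff[OF subC] subspace_scale[OF subC]) auto
  have "push p u = 0"
  proof -
    have "push p u = (F (fst p) (0, \<eta>) + c *\<^sub>R lvec p) - (k *\<^sub>R lvec p + F (fst p) (0, \<eta>)) - s *\<^sub>R (m p *\<^sub>R lvec p)"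
      unfolding u_def by (simp only: pushforward_diff pushforward_scale push_v push_b m(2)[OF M(2)])
    moreover have "s *\<^sub>R (m p *\<^sub>R lvec p) = c *\<^sub>R lvec p - k *\<^sub>R lvec p"
      using mp by (simp add: s_def scaleR_left_diff_distrib)
    moreover have "(a + b) - (d + a) - (b - d) = 0" for a b d :: "'x::ab_group_add" by simp
    ultimately show ?thesis by (simp only:)
  qed
  moreover have "u \<in> Q.T p" using uC Eperp_in_T[OF p(2)] by (simp add: W_complement_def)
  ultimately obtain \<xi> where \<xi>: "u = coordv (0, \<xi>) p" using vert_iff[OF p(2), of u] by (auto simp: vert_bundle_def)
  have "X p \<in> W p" using secX M(2) by (simp add: is_section_def)
  then have "ext_d Q \<theta>\<^sub>1 p u (X p) = 0" using uC by (simp add: W_complement_def)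
  then have "d\<theta> (fst p) (lvec p) (F (fst p) (0, \<xi>)) = 0"
    unfolding \<xi> using ext_d_theta1_vertical[OF M(1,4,5) m M(2)] mp by simp
  from U_section_with_bracket[OF M(1,4,5) m M(2) this]
  obtain K' B' where K': "mopen Q K'" "p \<in> K'" "K' \<subseteq> M" "is_section Q K' (U_bundle A H Q) B'" "B' p = coordv (0, \<xi>) p"
    by metis
  have "K' \<subseteq> S" using K'(3) M(3) by blast
  then have "u \<in> del p" using U_section_in_del[OF K'(1,2) _ K'(4)] K'(5) \<xi> by simp
  then have "u + bracket Q B X p + s *\<^sub>R X p \<in> del p"
    by (intro subspace_add[OF subdel] subspace_scale[OF subdel] bdel XC)
  then show "v \<in> del p" unfolding u_def by (simp only: diff_diff_eq add.assoc diff_add_cancel)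
qed

end

lemma contact_form_subset:
  assumes "contact_form A H M \<theta>" "mopen A N" "N \<subseteq> M"
  shows "contact_form A H N \<theta>"
proof -
  have "smooth_oneform A N \<theta>"
    using assms unfolding contact_form_def smooth_oneform_def by (meson subset_iff)
  then show ?thesis using assms unfolding contact_form_def by blast
qed

text \<open>An affine chart around \<open>p\<close>, restricted to the part of its base on which a contact form is given.\<close>

lemma exists_contact_path_chart:
  fixes A :: "('m, 'e::euclidean_space) atlas" and Q :: "('m line, 'e \<times> 'f::euclidean_space) atlas"
  assumes A: "smooth_atlas A" and H: "contact_structure A H" and Q: "Q = proj_atlas A H"
    and W: "contact_path_geometry A Q S W" and p: "p \<in> S"
  shows "\<exists>D \<phi> N h\<^sub>0 (h :: 'm \<Rightarrow> 'f \<Rightarrow> 'm tvec) D' \<psi> \<theta>. contact_path_chart A H D \<phi> N h\<^sub>0 h D' \<psi> Q \<theta> S W \<and> p \<in> D'"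
proof -
  interpret manifold_atlas A by unfold_locales (rule A)
  have "p \<in> points Q" using W p by (auto simp: contact_path_geometry_def mopen_def)
  then obtain D0 \<psi> where D0: "(D0, \<psi>) \<in> Q" "p \<in> D0" by (auto simp: points_def)
  then obtain D \<phi> N0 h\<^sub>0 h where chart: "is_proj_chart A H D \<phi> N0 h\<^sub>0 h D0 \<psi>"
    unfolding Q mem_proj_atlas_iff by blast
  interpret C0: proj_chart_data A H D \<phi> N0 h\<^sub>0 h D0 \<psi> by (rule proj_chart_dataI[OF chart])
  have "fst p \<in> N0" using C0.line_eq(2)[OF D0(2)] .
  moreover from this have "fst p \<in> points A" using C0.base_chart(2) by (auto simp: mopen_def)
  ultimately obtain M \<theta> where M: "fst p \<in> N0 \<inter> M" "contact_form A H M \<theta>"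
    using H unfolding contact_structure_def by blast
  define N where "N = N0 \<inter> M"
  have N: "mopen A N" using M(2) C0.base_chart(2) by (auto simp: N_def contact_form_def intro: mopen_Int)
  define D' where "D' = {(x, L) \<in> proj_H A H. x \<in> N \<and> (\<exists>y. L = span {h\<^sub>0 x + h x y})}"
  have "is_proj_chart A H D \<phi> N h\<^sub>0 h D' \<psi>"
    using chart N vfield_subset[of N0 _ N] unfolding is_proj_chart_def D'_def by (auto simp: N_def)
  moreover have "contact_form A H N \<theta>" by (rule contact_form_subset[OF M(2) N]) (simp add: N_def)
  ultimately have "contact_path_chart A H D \<phi> N h\<^sub>0 h D' \<psi> Q \<theta> S W"
    using W Q by unfold_locales
  moreover have "p \<in> D'"
    using D0(2) chart M(1) unfolding is_proj_chart_def D'_def N_def by auto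
  ultimately show ?thesis by blast
qed

theorem proposition3p3:
  fixes n :: nat
    and A :: "('m, 'e::euclidean_space) atlas"
    and H :: "'m \<Rightarrow> 'm tvec set"
    and Q :: "('m line, 'e \<times> 'f::euclidean_space) atlas"
    and S :: "'m line set"
    and W :: "'m line \<Rightarrow> 'm line tvec set"
  assumes "n \<ge> 3"
    and "DIM('e) = 2 * n - 1" and "DIM('f) = 2 * n - 3"
    and "smooth_manifold A" and "contact_structure A H"
    and "Q = proj_atlas A H"
    and "contact_path_geometry A Q S W"
  shows "(\<forall>N \<phi>\<^sub>2 \<phi>\<^sub>1 N' \<phi>\<^sub>2' \<phi>\<^sub>1'.
            N \<subseteq> S \<and> filtered_frame A H Q N \<phi>\<^sub>2 \<phi>\<^sub>1 \<and> N' \<subseteq> S \<and> filtered_frame A H Q N' \<phi>\<^sub>2' \<phi>\<^sub>1' \<longrightarrow>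
            (\<forall>p\<in>N \<inter> N'. frame_skew_complement A H Q W \<phi>\<^sub>2 \<phi>\<^sub>1 p
                       = frame_skew_complement A H Q W \<phi>\<^sub>2' \<phi>\<^sub>1' p))
       \<and> ((\<forall>N \<phi>\<^sub>2 \<phi>\<^sub>1. N \<subseteq> S \<and> filtered_frame A H Q N \<phi>\<^sub>2 \<phi>\<^sub>1 \<longrightarrow>
            (\<forall>p\<in>N. frame_skew_complement A H Q W \<phi>\<^sub>2 \<phi>\<^sub>1 p = del_bundle Q S (U_bundle A H Q) W p))
          \<longleftrightarrow> contact_torsion_vanishes A H Q S W)"
proof -
  have A: "smooth_atlas A" using assms(4) by (simp add: smooth_manifold_def)
  note chart = exists_contact_path_chart[OF A assms(5-7)]
  have indep: "frame_skew_complement A H Q W \<phi>\<^sub>2 \<phi>\<^sub>1 p = frame_skew_complement A H Q W \<phi>\<^sub>2' \<phi>\<^sub>1' p"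
    if f: "N \<subseteq> S" "filtered_frame A H Q N \<phi>\<^sub>2 \<phi>\<^sub>1" "N' \<subseteq> S" "filtered_frame A H Q N' \<phi>\<^sub>2' \<phi>\<^sub>1'"
      and p: "p \<in> N \<inter> N'" for N \<phi>\<^sub>2 \<phi>\<^sub>1 N' \<phi>\<^sub>2' \<phi>\<^sub>1' p
  proof -
    have pS: "p \<in> S" using f p by blast
    obtain D \<phi> M h\<^sub>0 and h :: "'m \<Rightarrow> 'f \<Rightarrow> 'm tvec" and D' \<psi> \<theta>
      where c: "contact_path_chart A H D \<phi> M h\<^sub>0 h D' \<psi> Q \<theta> S W" "p \<in> D'" using chart[OF pS] by blast
    interpret contact_path_chart A H D \<phi> M h\<^sub>0 h D' \<psi> Q \<theta> S W by (rule c)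
    show ?thesis using frame_skew_complement_eq f p c(2) pS by (metis IntD1 IntD2)
  qed
  have forward: "contact_torsion A H Q X X' B p = Eperp_bundle A H Q p"
    if eq: "\<forall>N \<phi>\<^sub>2 \<phi>\<^sub>1. N \<subseteq> S \<and> filtered_frame A H Q N \<phi>\<^sub>2 \<phi>\<^sub>1 \<longrightarrow>
            (\<forall>p\<in>N. frame_skew_complement A H Q W \<phi>\<^sub>2 \<phi>\<^sub>1 p = del_bundle Q S (U_bundle A H Q) W p)"
      and N: "mopen Q N" "N \<subseteq> S" "p \<in> N"
      and sec: "is_section Q N W X" "is_section Q N W X'" "is_section Q N (U_bundle A H Q) B" for N X X' B p
  proof -
    have pS: "p \<in> S" using N by blast
    obtain D \<phi> M h\<^sub>0 and h :: "'m \<Rightarrow> 'f \<Rightarrow> 'm tvec" and D' \<psi> \<theta>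
      where c: "contact_path_chart A H D \<phi> M h\<^sub>0 h D' \<psi> Q \<theta> S W" "p \<in> D'" using chart[OF pS] by blast
    interpret contact_path_chart A H D \<phi> M h\<^sub>0 h D' \<psi> Q \<theta> S W by (rule c)
    let ?M = "S \<inter> D'"
    have "mopen Q ?M" using open_S open_domain by (rule Q.mopen_Int)
    then have frame: "filtered_frame A H Q ?M \<theta>\<^sub>2 \<theta>\<^sub>1" by (rule filtered_frame_standard) blast
    have pM: "p \<in> ?M" using pS c(2) by blast
    have "W_complement p = del p"
      using frame_skew_complement_eq[OF frame pM c(2) pS] eq frame pM by (metis Int_lower1)
    then show ?thesis by (rule torsion_vanishes_at_if_complement_eq[OF _ N c(2) sec])
  qed
  have backward: "frame_skew_complement A H Q W \<phi>\<^sub>2 \<phi>\<^sub>1 p = del_bundle Q S (U_bundle A H Q) W p"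
    if torsion: "contact_torsion_vanishes A H Q S W"
      and f: "N \<subseteq> S" "filtered_frame A H Q N \<phi>\<^sub>2 \<phi>\<^sub>1" "p \<in> N" for N \<phi>\<^sub>2 \<phi>\<^sub>1 p
  proof -
    have pS: "p \<in> S" using f by blast
    obtain D \<phi> M h\<^sub>0 and h :: "'m \<Rightarrow> 'f \<Rightarrow> 'm tvec" and D' \<psi> \<theta>
      where c: "contact_path_chart A H D \<phi> M h\<^sub>0 h D' \<psi> Q \<theta> S W" "p \<in> D'" using chart[OF pS] by blast
    interpret contact_path_chart A H D \<phi> M h\<^sub>0 h D' \<psi> Q \<theta> S W by (rule c)
    have "del p \<subseteq> W_complement p" by (rule del_subset_complement[OF torsion pS c(2)])
    then show ?thesis
      using frame_skew_complement_eq[OF f(2,3) c(2) pS] complement_subset_del[OF pS c(2)] by blast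
  qed
  show ?thesis
  proof (intro conjI iffI)
    show "\<forall>N \<phi>\<^sub>2 \<phi>\<^sub>1 N' \<phi>\<^sub>2' \<phi>\<^sub>1'.
            N \<subseteq> S \<and> filtered_frame A H Q N \<phi>\<^sub>2 \<phi>\<^sub>1 \<and> N' \<subseteq> S \<and> filtered_frame A H Q N' \<phi>\<^sub>2' \<phi>\<^sub>1' \<longrightarrow>
            (\<forall>p\<in>N \<inter> N'. frame_skew_complement A H Q W \<phi>\<^sub>2 \<phi>\<^sub>1 p
                       = frame_skew_complement A H Q W \<phi>\<^sub>2' \<phi>\<^sub>1' p)"
      by (intro allI impI ballI, elim conjE) (rule indep)
  next
    assume "\<forall>N \<phi>\<^sub>2 \<phi>\<^sub>1. N \<subseteq> S \<and> filtered_frame A H Q N \<phi>\<^sub>2 \<phi>\<^sub>1 \<longrightarrow>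
            (\<forall>p\<in>N. frame_skew_complement A H Q W \<phi>\<^sub>2 \<phi>\<^sub>1 p = del_bundle Q S (U_bundle A H Q) W p)"
    then show "contact_torsion_vanishes A H Q S W"
      unfolding contact_torsion_vanishes_def by (intro allI impI ballI, elim conjE) (rule forward)
  next
    assume "contact_torsion_vanishes A H Q S W"
    then show "\<forall>N \<phi>\<^sub>2 \<phi>\<^sub>1. N \<subseteq> S \<and> filtered_frame A H Q N \<phi>\<^sub>2 \<phi>\<^sub>1 \<longrightarrow>
            (\<forall>p\<in>N. frame_skew_complement A H Q W \<phi>\<^sub>2 \<phi>\<^sub>1 p = del_bundle Q S (U_bundle A H Q) W p)"
      by (intro allI impI ballI, elim conjE) (rule backward)
  qed
qed

end
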